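(* Let $\theta\in T_\rho$ and set $\tilde a_N(\theta):=\frac{1}{\sqrt N}+\sqrt{a_N(\theta)}$. For every $k\ge1$ there exists a constant $K'(\theta,k)>0$ (depending only on $\theta$, $k$ and the fixed model data) such that for every $N\ge k$, every set $\{d_1,\dots,d_k\}\subseteq\{1,\dots,N\}$ of $k$ distinct indices and every bounded measurable $f:\mathbb{R}^k\to\mathbb{R}$, $$\Big|\langle f(g_{d_1},\dots,g_{d_k})\rangle-\int_{\mathbb{R}^k}f(x_1,\dots,x_k)\,d\mu_{\gamma_{d_1}}(x_1)\cdots d\mu_{\gamma_{d_k}}(x_k)\Big|\le K'(\theta,k)\,\|f\|_\infty\,\tilde a_N(\theta).$$
   Context: Eigenvalues. Fix $\tilde\gamma>0$. For each $N\ge1$ let $\gamma_1=\gamma^{(N)}_1,\dots,\gamma_N=\gamma_N^{(N)}$ be deterministic real numbers in $[0,\tilde\gamma]$ such that the empirical measures $N^{-1}\sum_{i\le N}\delta_{\gamma_i^{(N)}}$ converge, as $N\to\infty$, in the 1-Wasserstein metric to a probability measure $\rho$ on $[0,\tilde\gamma]$. The array of eigenvalues, $\tilde\gamma$ and $\rho$ are fixed; constants may depend on them. Model. For $g\in\mathbb{R}^N\setminus\{0\}$ let $H_N(g):=N\sum_{i\le N}\gamma_i\, g_i^2/\|g\|^2$ and $h_N:=N^{-1}H_N$. Let $G$ be the standard normal measure on $\mathbb{R}^N$. For $\theta\in\mathbb{R}$ the Gibbs mean is $\langle f(g)\rangle=\langle f(g)\rangle_\theta:=\frac{1}{Z_N}\int_{\mathbb{R}^N}f(g)\,e^{\theta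 H_N(g)}\,dG(g)$ with $Z_N:=\int e^{\theta H_N}dG$. Transforms. For $z\in\mathbb{R}\setminus[0,\tilde\gamma]$ let $S_\rho(z):=\int\frac{\rho(d\gamma)}{z-\gamma}$, $S_{\max}:=\lim_{z\downarrow\tilde\gamma}S_\rho(z)\in(0,+\infty]$, $S_{\min}:=\lim_{z\uparrow0}S_\rho(z)\in[-\infty,0)$. $S_\rho$ is a bijection from $\mathbb{R}\setminus[0,\tilde\gamma]$ onto $(S_{\min},S_{\max})\setminus\{0\}$ with inverse $K_\rho$; the R-transform is $R_\rho(x):=K_\rho(x)-1/x$ on $(S_{\min},S_{\max})\setminus\{0\}$. Put $T_\rho:=(S_{\min}/2,S_{\max}/2)\setminus\{0\}$ and, for $\theta\in T_\rho$, $v(\theta):=R_\rho(2\theta)$. Rate. $a_N(\theta):=\big\langle(h_N-v(\theta))^2\big\rangle_\theta$. Limiting marginals. For $\gamma\in[0,\tilde\gamma]$, $\mu_\gamma$ is the law of a centred normal random variable with variance $\sigma_\gamma^2:=1/(1+2\theta(v(\theta)-\gamma))$ (which is positive for $\theta\in T_\rho$). *)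

theory Defs
  imports "HOL-Probability.Probability"
begin

definition empirical_measure :: "nat \<Rightarrow> (nat \<Rightarrow> real) \<Rightarrow> real measure" where
  "empirical_measure N x = distr (uniform_count_measure {1..N}) borel x"

lemma emeasure_empirical_measure:
  assumes "N \<ge> 1" "A \<in> sets borel"
  shows "emeasure (empirical_measure N x) A = ennreal ((1 / real N) * (\<Sum>i=1..N. indicator A (x i)))"
proof -
  have x: "x \<in> measurable (uniform_count_measure {1..N}) borel"
    by (simp add: measurable_def space_uniform_count_measure sets_uniform_count_measure)
  have "emeasure (empirical_measure N x) A = emeasure (uniform_count_measure {1..N}) (x -` A \<inter> {1..N})"
    using assms x by (simp add: empirical_measure_def emeasure_distr space_uniform_count_measure)
  also have "\<dots> = ennreal (real (card (x -` A \<inter> {1..N})) / real N)"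
    by (subst emeasure_uniform_count_measure) auto
  also have "real (card (x -` A \<inter> {1..N})) = (\<Sum>i=1..N. indicator A (x i))"
    by (simp add: indicator_def sum.If_cases Int_commute vimage_def)
  finally show ?thesis by simp
qed

definition couplings :: "real measure \<Rightarrow> real measure \<Rightarrow> (real \<times> real) measure set" where
  "couplings \<mu> \<nu> = {\<pi>. sets \<pi> = sets (borel \<Otimes>\<^sub>M borel) \<and> distr \<pi> borel fst = \<mu> \<and> distr \<pi> borel snd = \<nu>}"

definition wasserstein1 :: "real measure \<Rightarrow> real measure \<Rightarrow> ennreal" where
  "wasserstein1 \<mu> \<nu> = (INF \<pi>\<in>couplings \<mu> \<nu>. \<integral>\<^sup>+p. ennreal \<bar>fst p - snd p\<bar> \<partial>\<pi>)"

text \<open>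
  Vectors in \<open>\<real>\<^sup>N\<close> are functions on the index set \<open>{1..N}\<close>, extensional outside it, as in
  the carrier of \<open>Pi\<^sub>M {1..N}\<close>.  An array \<open>\<gamma>\<close> of eigenvalues has \<open>\<gamma> N i\<close> as the \<open>i\<close>-th of
  the \<open>N\<close> eigenvalues in dimension \<open>N\<close>; only \<open>1 \<le> i \<le> N\<close> matters.
\<close>

text \<open>At \<open>g = 0\<close>, a null set, division by zero gives the value 0.\<close>
definition hamiltonian :: "(nat \<Rightarrow> nat \<Rightarrow> real) \<Rightarrow> nat \<Rightarrow> (nat \<Rightarrow> real) \<Rightarrow> real" where
  "hamiltonian \<gamma> N g = real N * (\<Sum>i=1..N. \<gamma> N i * (g i)\<^sup>2 / (L2_set g {1..N})\<^sup>2)"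

definition std_gaussian :: "nat \<Rightarrow> (nat \<Rightarrow> real) measure" where
  "std_gaussian N = Pi\<^sub>M {1..N} (\<lambda>_. density lborel (\<lambda>x. ennreal (std_normal_density x)))"

definition partition_fun :: "(nat \<Rightarrow> nat \<Rightarrow> real) \<Rightarrow> real \<Rightarrow> nat \<Rightarrow> real" where
  "partition_fun \<gamma> \<theta> N = (\<integral>g. exp (\<theta> * hamiltonian \<gamma> N g) \<partial>std_gaussian N)"

definition gibbs_mean :: "(nat \<Rightarrow> nat \<Rightarrow> real) \<Rightarrow> real \<Rightarrow> nat \<Rightarrow> ((nat \<Rightarrow> real) \<Rightarrow> real) \<Rightarrow> real" where
  "gibbs_mean \<gamma> \<theta> N f =
     (1 / partition_fun \<gamma> \<theta> N) * (\<integral>g. f g * exp (\<theta> * hamiltonian \<gamma> N g) \<partial>std_gaussian N)"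

text \<open>
  In what follows \<open>c\<close> is the upper endpoint of the interval \<open>{0..c}\<close> that carries \<open>\<rho>\<close>.
  It need not lie in the support of \<open>\<rho>\<close>.
\<close>

definition stieltjes :: "real measure \<Rightarrow> real \<Rightarrow> real" where
  "stieltjes \<rho> z = (\<integral>x. 1 / (z - x) \<partial>\<rho>)"

definition S_max :: "real \<Rightarrow> real measure \<Rightarrow> ereal" where
  "S_max c \<rho> = Lim (at_right c) (\<lambda>z. ereal (stieltjes \<rho> z))"

definition S_min :: "real measure \<Rightarrow> ereal" where
  "S_min \<rho> = Lim (at_left 0) (\<lambda>z. ereal (stieltjes \<rho> z))"

definition K_transform :: "real \<Rightarrow> real measure \<Rightarrow> real \<Rightarrow> real" where
  "K_transform c \<rho> = the_inv_into (- {0..c}) (stieltjes \<rho>)"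

definition R_transform :: "real \<Rightarrow> real measure \<Rightarrow> real \<Rightarrow> real" where
  "R_transform c \<rho> x = K_transform c \<rho> x - 1 / x"

definition T_set :: "real \<Rightarrow> real measure \<Rightarrow> real set" where
  "T_set c \<rho> = {\<theta>. S_min \<rho> / 2 < ereal \<theta> \<and> ereal \<theta> < S_max c \<rho> / 2} - {0}"

definition v_lim :: "real \<Rightarrow> real measure \<Rightarrow> real \<Rightarrow> real" where
  "v_lim c \<rho> \<theta> = R_transform c \<rho> (2 * \<theta>)"

definition a_rate :: "(nat \<Rightarrow> nat \<Rightarrow> real) \<Rightarrow> real \<Rightarrow> real measure \<Rightarrow> real \<Rightarrow> nat \<Rightarrow> real" where
  "a_rate \<gamma> c \<rho> \<theta> N = gibbs_mean \<gamma> \<theta> N (\<lambda>g. (hamiltonian \<gamma> N g / real N - v_lim c \<rho> \<theta>)\<^sup>2)"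

definition a_tilde :: "(nat \<Rightarrow> nat \<Rightarrow> real) \<Rightarrow> real \<Rightarrow> real measure \<Rightarrow> real \<Rightarrow> nat \<Rightarrow> real" where
  "a_tilde \<gamma> c \<rho> \<theta> N = 1 / sqrt (real N) + sqrt (a_rate \<gamma> c \<rho> \<theta> N)"

definition limit_variance :: "real \<Rightarrow> real measure \<Rightarrow> real \<Rightarrow> real \<Rightarrow> real" where
  "limit_variance c \<rho> \<theta> y = 1 / (1 + 2 * \<theta> * (v_lim c \<rho> \<theta> - y))"

text \<open>The second argument of \<^const>\<open>normal_density\<close> is the standard deviation.\<close>
definition limit_marginal :: "real \<Rightarrow> real measure \<Rightarrow> real \<Rightarrow> real \<Rightarrow> real measure" where
  "limit_marginal c \<rho> \<theta> y =
     density lborel (\<lambda>x. ennreal (normal_density 0 (sqrt (limit_variance c \<rho> \<theta> y)) x))"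

definition sup_norm :: "nat \<Rightarrow> ((nat \<Rightarrow> real) \<Rightarrow> real) \<Rightarrow> real" where
  "sup_norm k f = (SUP x\<in>({1..k} \<rightarrow>\<^sub>E UNIV). \<bar>f x\<bar>)"

end

theory Submission
  imports Defs
begin

text \<open>
  Put \<open>h = H\<^sub>N / N\<close>, \<open>r = N / \<parallel>g\<parallel>\<^sup>2\<close> and \<open>s = 1 + 2 * \<theta> * (v - \<gamma> i)\<close>, the inverse limit variance. In the \<open>i\<close>-th
  coordinate the Gibbs density \<open>p\<close> satisfies
  \<open>p' + s * g i * p = 2 * \<theta> * g i * ((r - 1) * (\<gamma> i - h) + (v - h)) * p\<close>,
  and a Stein estimate in one variable bounds the cost of replacing \<open>g i\<close> by an independent normal variable
  by the mean of the absolute value of the right side. Replacing the coordinates one after the other gives the theorem.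
  The radius \<open>\<parallel>g\<parallel>\<close> is independent of the direction and contributes \<open>1 / sqrt N\<close>; the factor \<open>h - v\<close>
  contributes \<open>sqrt a\<^sub>N\<close> by Cauchy-Schwarz. For this the second moment of \<open>g i\<close> has to be bounded uniformly in
  \<open>N\<close>. Integration by parts gives such a bound on \<open>\<bar>h - v\<bar> < \<epsilon>\<close>, so the whole argument
  is run for the Gibbs weight times a cutoff in \<open>h\<close>; the part removed has mass \<open>O(a\<^sub>N)\<close>.
\<close>

section \<open>Stein bound for one normal variable\<close>

text \<open>The obstacle is the second moment of one coordinate. Under the Gibbs weight
  \<open>(g i)^2\<close> may be traded for \<open>N * (g i)^2 / q\<close>, with \<open>q\<close> the
  squared norm, because the weight is homogeneous of degree 0. After this trade, integration by
  parts leaves the factor 1 - 2\<theta>(\<gamma> i - h) = s + 2\<theta>(h - v), whose sign is under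
  control only where h is close to v. The cutoff in h is cheap: the derivative of h in
  \<open>g i\<close> is 2 \<open>g i\<close> (\<gamma> i - h) / q, so the derivative of the cutoff
  enters without a factor N. The radius is separated from the direction by a scaling identity: for F
  nonnegative and homogeneous of degree 2m, the Gaussian means satisfy E F = (N + 2m - 2) E (F / q).
  For m = 0 this needs N > 2, so the dimensions 1 and 2 are treated apart. Cauchy-Schwarz is used
  pointwise, as 2xy <= t x^2 + y^2 / t with t the rate \<open>a_tilde\<close>, so that only
  integrals with known values or bounds remain. All constants come from c, \<theta>, k, v and a
  lower bound \<delta> of s over the whole interval [0,c], hence they depend neither on N nor on the
  chosen indices.\<close>

lemma nn_integral_normal_density:
  assumes "\<sigma> > 0"
  shows "(\<integral>\<^sup>+x. ennreal (normal_density \<mu> \<sigma> x) \<partial>lborel) = 1"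
  using assms by (subst nn_integral_eq_integral) (auto simp: AE_I2)

text \<open>Shift by \<open>t\<close> and use (t + u)^2 >= t^2 + u^2 for t, u >= 0. The bound
  exp(-t^2 / (2 \<sigma>^2)) is written as a multiple of the density at \<open>t\<close>, since this
  factor later turns q' into n q'.\<close>

lemma normal_density_upper_tail:
  assumes "\<sigma> > 0" "t \<ge> 0"
  shows "(\<integral>\<^sup>+x. ennreal (normal_density 0 \<sigma> x) * indicator {t..} x \<partial>lborel)
           \<le> ennreal (sqrt (2 * pi * \<sigma>\<^sup>2) * normal_density 0 \<sigma> t)"
proof -
  have e: "sqrt (2 * pi * \<sigma>\<^sup>2) * normal_density 0 \<sigma> t = exp (- t\<^sup>2 / (2 * \<sigma>\<^sup>2))"
    using assms by (simp add: normal_density_def)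
  have le: "normal_density 0 \<sigma> (t + u) \<le> exp (- t\<^sup>2 / (2 * \<sigma>\<^sup>2)) * normal_density 0 \<sigma> u" if "u \<ge> 0" for u
  proof -
    have "t\<^sup>2 + u\<^sup>2 \<le> (t + u)\<^sup>2"
      using that assms by (simp add: power2_sum)
    then have "- (t + u)\<^sup>2 / (2 * \<sigma>\<^sup>2) \<le> - t\<^sup>2 / (2 * \<sigma>\<^sup>2) + - u\<^sup>2 / (2 * \<sigma>\<^sup>2)"
      using assms by (simp add: divide_simps)
    then have "exp (- (t + u)\<^sup>2 / (2 * \<sigma>\<^sup>2)) \<le> exp (- t\<^sup>2 / (2 * \<sigma>\<^sup>2)) * exp (- u\<^sup>2 / (2 * \<sigma>\<^sup>2))"
      by (simp flip: exp_add)
    then have "1 / sqrt (2 * pi * \<sigma>\<^sup>2) * exp (- (t + u)\<^sup>2 / (2 * \<sigma>\<^sup>2))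
        \<le> 1 / sqrt (2 * pi * \<sigma>\<^sup>2) * (exp (- t\<^sup>2 / (2 * \<sigma>\<^sup>2)) * exp (- u\<^sup>2 / (2 * \<sigma>\<^sup>2)))"
      by (intro mult_left_mono) auto
    then show ?thesis by (simp add: normal_density_def mult_ac)
  qed
  have "(\<integral>\<^sup>+x. ennreal (normal_density 0 \<sigma> x) * indicator {t..} x \<partial>lborel)
      = (\<integral>\<^sup>+u. ennreal (normal_density 0 \<sigma> (t + u)) * indicator {t..} (t + u) \<partial>lborel)"
    by (subst nn_integral_real_affine[where c = 1 and t = t]) auto
  also have "\<dots> \<le> (\<integral>\<^sup>+u. ennreal (exp (- t\<^sup>2 / (2 * \<sigma>\<^sup>2))) * ennreal (normal_density 0 \<sigma> u) \<partial>lborel)"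
    using le by (intro nn_integral_mono) (auto simp: ennreal_mult'[symmetric] split: split_indicator)
  also have "\<dots> = ennreal (exp (- t\<^sup>2 / (2 * \<sigma>\<^sup>2)))"
    using assms by (subst nn_integral_cmult) (auto simp: nn_integral_normal_density)
  finally show ?thesis using e by simp
qed

lemma normal_density_lower_tail:
  assumes "\<sigma> > 0" "t \<le> 0"
  shows "(\<integral>\<^sup>+x. ennreal (normal_density 0 \<sigma> x) * indicator {..t} x \<partial>lborel)
           \<le> ennreal (sqrt (2 * pi * \<sigma>\<^sup>2) * normal_density 0 \<sigma> t)"
proof -
  have "(\<integral>\<^sup>+x. ennreal (normal_density 0 \<sigma> x) * indicator {..t} x \<partial>lborel)
      = (\<integral>\<^sup>+x. ennreal (normal_density 0 \<sigma> x) * indicator {-t..} x \<partial>lborel)"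
    by (subst nn_integral_real_affine[where c = "-1" and t = 0])
       (auto simp: normal_density_def intro!: nn_integral_cong split: split_indicator)
  also have "\<dots> \<le> ennreal (sqrt (2 * pi * \<sigma>\<^sup>2) * normal_density 0 \<sigma> (-t))"
    using assms by (intro normal_density_upper_tail) auto
  finally show ?thesis by (simp add: normal_density_def)
qed

text \<open>One tail is bounded by 1 and the other decays; which one decays depends on the sign of
  \<open>t\<close>. Only the product is of the order of the density at both ends.\<close>

lemma normal_density_tail_product:
  assumes "\<sigma> > 0"
  shows "(\<integral>\<^sup>+x. ennreal (normal_density 0 \<sigma> x) * indicator {..t} x \<partial>lborel)
         * (\<integral>\<^sup>+x. ennreal (normal_density 0 \<sigma> x) * indicator {t..} x \<partial>lborel)
         \<le> ennreal (sqrt (2 * pi * \<sigma>\<^sup>2) * normal_density 0 \<sigma> t)"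
proof -
  have le1: "(\<integral>\<^sup>+x. ennreal (normal_density 0 \<sigma> x) * indicator A x \<partial>lborel) \<le> 1" for A
    by (rule order_trans[OF nn_integral_mono[of _ _ "\<lambda>x. ennreal (normal_density 0 \<sigma> x)"]])
       (auto simp: nn_integral_normal_density assms split: split_indicator)
  show ?thesis
  proof (cases "t \<ge> 0")
    case True
    show ?thesis
      using mult_mono[OF le1[of "{..t}"] normal_density_upper_tail[OF assms True]] by simp
  next
    case False
    show ?thesis
      using mult_mono[OF normal_density_lower_tail[OF assms, of t] le1[of "{t..}"]] False by simp
  qed
qed

text \<open>Two products of half-line indicators stand in place of the indicator of an interval: one
  formula then covers both orders of \<open>x\<close> and \<open>y\<close>, and for fixed
  \<open>t\<close> each summand splits into a factor in \<open>x\<close> and a factor in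
  \<open>y\<close>.\<close>

lemma abs_diff_le_nn_integral_derivative:
  fixes q q' :: "real \<Rightarrow> real"
  assumes "\<And>x. (q has_real_derivative q' x) (at x)" "\<And>x. isCont q' x"
  shows "ennreal \<bar>q x - q y\<bar>
    \<le> (\<integral>\<^sup>+t. ennreal \<bar>q' t\<bar> * (indicator {x..} t * indicator {..y} t + indicator {y..} t * indicator {..x} t) \<partial>lborel)"
proof -
  have main: "ennreal \<bar>q b - q a\<bar> \<le> (\<integral>\<^sup>+t. ennreal \<bar>q' t\<bar> * indicator {a..b} t \<partial>lborel)" if "a \<le> b" for a b
  proof -
    have 1: "(\<integral>x. q' x * indicator {a..b} x \<partial>lborel) = q b - q a"
      using assms that by (intro integral_FTC_Icc_real) auto
    have "ennreal \<bar>q b - q a\<bar> \<le> (\<integral>\<^sup>+t. ennreal (norm (q' t * indicator {a..b} t)) \<partial>lborel)"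
      using integral_norm_bound_ennreal[of lborel "\<lambda>x. q' x * indicator {a..b} x"]
        has_bochner_integral_FTC_Icc_real[of a b q q'] assms that 1
      by (auto simp: has_bochner_integral_iff)
    then show ?thesis
      by (simp add: abs_mult ennreal_mult' ennreal_indicator)
  qed
  show ?thesis
  proof (cases "x \<le> y")
    case True
    have "ennreal \<bar>q x - q y\<bar> \<le> (\<integral>\<^sup>+t. ennreal \<bar>q' t\<bar> * indicator {x..y} t \<partial>lborel)"
      using main[OF True] by (simp add: abs_minus_commute)
    also have "\<dots> \<le> (\<integral>\<^sup>+t. ennreal \<bar>q' t\<bar> * (indicator {x..} t * indicator {..y} t + indicator {y..} t * indicator {..x} t) \<partial>lborel)"
      by (intro nn_integral_mono mult_left_mono) (auto split: split_indicator)
    finally show ?thesis .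
  next
    case False
    have "ennreal \<bar>q x - q y\<bar> \<le> (\<integral>\<^sup>+t. ennreal \<bar>q' t\<bar> * indicator {y..x} t \<partial>lborel)"
      using main[of y x] False by simp
    also have "\<dots> \<le> (\<integral>\<^sup>+t. ennreal \<bar>q' t\<bar> * (indicator {x..} t * indicator {..y} t + indicator {y..} t * indicator {..x} t) \<partial>lborel)"
      by (intro nn_integral_mono mult_left_mono) (auto split: split_indicator)
    finally show ?thesis .
  qed
qed

text \<open>A Poincare inequality in L1 for the normal law. After Tonelli the weight of \<bar>q'
  t\<bar> is twice the product of the lower and the upper tail at \<open>t\<close>, which is at most
  a constant times \<open>n t\<close>.\<close>

lemma normal_mean_difference_le:
  fixes q q' :: "real \<Rightarrow> real"
  assumes \<sigma>: "\<sigma> > 0"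
    and q: "\<And>x. (q has_real_derivative q' x) (at x)" "\<And>x. isCont q' x"
  defines "n \<equiv> normal_density 0 \<sigma>"
  shows "(\<integral>\<^sup>+x. \<integral>\<^sup>+y. ennreal (n x * n y * \<bar>q x - q y\<bar>) \<partial>lborel \<partial>lborel)
     \<le> ennreal (2 * sqrt (2 * pi * \<sigma>\<^sup>2)) * (\<integral>\<^sup>+t. ennreal (n t * \<bar>q' t\<bar>) \<partial>lborel)"
proof -
  have [measurable]: "n \<in> borel_measurable borel" by (simp add: n_def)
  have [measurable]: "q' \<in> borel_measurable borel"
    using q(2) by (intro borel_measurable_continuous_onI) (simp add: continuous_at_imp_continuous_on)
  have n0: "n x \<ge> 0" for x by (simp add: n_def)
  let ?K = "\<lambda>x y t. indicator {x..} t * indicator {..y} t + indicator {y..} t * indicator {..x} t :: ennreal"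
  let ?L = "\<lambda>t. \<integral>\<^sup>+x. ennreal (n x) * indicator {..t} x \<partial>lborel"
  let ?U = "\<lambda>t. \<integral>\<^sup>+x. ennreal (n x) * indicator {t..} x \<partial>lborel"
  let ?q = "\<lambda>t. ennreal \<bar>q' t\<bar>"
  have K: "?K x y t = indicator {..t} x * indicator {t..} y + indicator {t..} x * indicator {..t} y" for x y t
    by (auto split: split_indicator)
  have "{z \<in> space (borel \<Otimes>\<^sub>M borel). snd z \<le> (fst z :: real)} \<in> sets (borel \<Otimes>\<^sub>M borel)"
    "{z \<in> space (borel \<Otimes>\<^sub>M borel). fst z \<le> (snd z :: real)} \<in> sets (borel \<Otimes>\<^sub>M borel)"
    by measurable
  then have [measurable]: "{z. snd z \<le> (fst z :: real)} \<in> sets (borel \<Otimes>\<^sub>M borel)"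
    "{z. fst z \<le> (snd z :: real)} \<in> sets (borel \<Otimes>\<^sub>M borel)"
    by (simp_all add: space_pair_measure)
  have ind: "indicator {..t} x = (indicator {z. snd z \<le> fst z} (t, x) :: ennreal)"
     "indicator {t..} x = (indicator {z. fst z \<le> snd z} (t, x) :: ennreal)" for t x :: real
    by (auto split: split_indicator)
  have [measurable]: "(\<lambda>(x, y, t). ennreal (n x) * ennreal (n y) * (?q t * ?K x y t)) \<in> borel_measurable (lborel \<Otimes>\<^sub>M lborel \<Otimes>\<^sub>M lborel)"
    unfolding K unfolding ind by measurable
  have m2: "(\<lambda>(y, t). ennreal (n x) * ennreal (n y) * (?q t * ?K x y t)) \<in> borel_measurable (lborel \<Otimes>\<^sub>M lborel)" for x
    unfolding K unfolding ind by measurable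
  have m3: "(\<lambda>(x, t). \<integral>\<^sup>+y. ennreal (n x) * ennreal (n y) * (?q t * ?K x y t) \<partial>lborel) \<in> borel_measurable (lborel \<Otimes>\<^sub>M lborel)"
    unfolding K unfolding ind by measurable
  have "(\<integral>\<^sup>+x. \<integral>\<^sup>+y. ennreal (n x * n y * \<bar>q x - q y\<bar>) \<partial>lborel \<partial>lborel)
      \<le> (\<integral>\<^sup>+x. \<integral>\<^sup>+y. ennreal (n x) * ennreal (n y) * (\<integral>\<^sup>+t. ?q t * ?K x y t \<partial>lborel) \<partial>lborel \<partial>lborel)"
    using n0 by (intro nn_integral_mono)
       (auto simp: ennreal_mult' intro!: mult_left_mono abs_diff_le_nn_integral_derivative q)
  also have "\<dots> = (\<integral>\<^sup>+x. \<integral>\<^sup>+y. \<integral>\<^sup>+t. ennreal (n x) * ennreal (n y) * (?q t * ?K x y t) \<partial>lborel \<partial>lborel \<partial>lborel)"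
    by (simp add: nn_integral_cmult)
  also have "\<dots> = (\<integral>\<^sup>+x. \<integral>\<^sup>+t. \<integral>\<^sup>+y. ennreal (n x) * ennreal (n y) * (?q t * ?K x y t) \<partial>lborel \<partial>lborel \<partial>lborel)"
    using m2 by (intro nn_integral_cong lborel_pair.Fubini') auto
  also have "\<dots> = (\<integral>\<^sup>+t. \<integral>\<^sup>+x. \<integral>\<^sup>+y. ennreal (n x) * ennreal (n y) * (?q t * ?K x y t) \<partial>lborel \<partial>lborel \<partial>lborel)"
    using m3 by (intro lborel_pair.Fubini') auto
  also have "\<dots> = (\<integral>\<^sup>+t. ?q t * (2 * (?L t * ?U t)) \<partial>lborel)"
  proof (intro nn_integral_cong)
    fix t :: real
    have "(\<integral>\<^sup>+x. \<integral>\<^sup>+y. ennreal (n x) * ennreal (n y) * (?q t * ?K x y t) \<partial>lborel \<partial>lborel)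
       = (\<integral>\<^sup>+x. \<integral>\<^sup>+y. ?q t * (ennreal (n x) * indicator {..t} x) * (ennreal (n y) * indicator {t..} y)
          + ?q t * (ennreal (n x) * indicator {t..} x) * (ennreal (n y) * indicator {..t} y) \<partial>lborel \<partial>lborel)"
      unfolding K by (simp add: algebra_simps)
    also have "\<dots> = (\<integral>\<^sup>+x. ?q t * (ennreal (n x) * indicator {..t} x) * ?U t
          + ?q t * (ennreal (n x) * indicator {t..} x) * ?L t \<partial>lborel)"
      by (simp add: nn_integral_add nn_integral_cmult)
    also have "\<dots> = ?q t * ?L t * ?U t + ?q t * ?U t * ?L t"
      by (simp add: nn_integral_add nn_integral_cmult nn_integral_multc)
    also have "\<dots> = ?q t * (2 * (?L t * ?U t))"
      by (simp add: mult_ac flip: mult_2)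
    finally show "(\<integral>\<^sup>+x. \<integral>\<^sup>+y. ennreal (n x) * ennreal (n y) * (?q t * ?K x y t) \<partial>lborel \<partial>lborel) = \<dots>" .
  qed
  also have "\<dots> \<le> (\<integral>\<^sup>+t. ?q t * (2 * ennreal (sqrt (2 * pi * \<sigma>\<^sup>2) * n t)) \<partial>lborel)"
    unfolding n_def by (intro nn_integral_mono mult_left_mono normal_density_tail_product \<sigma>) auto
  also have "\<dots> = (\<integral>\<^sup>+t. ennreal (2 * sqrt (2 * pi * \<sigma>\<^sup>2)) * ennreal (n t * \<bar>q' t\<bar>) \<partial>lborel)"
    using n0 by (intro nn_integral_cong) (simp add: ennreal_mult' mult_ac)
  also have "\<dots> = ennreal (2 * sqrt (2 * pi * \<sigma>\<^sup>2)) * (\<integral>\<^sup>+t. ennreal (n t * \<bar>q' t\<bar>) \<partial>lborel)"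
    by (rule nn_integral_cmult) measurable
  finally show ?thesis .
qed

text \<open>
  Stein's method without solving the Stein equation: with \<open>n\<close> the normal density and \<open>q = p / n\<close>,
  the left side is \<open>\<integral>\<integral> f x n x n y (q x - q y)\<close>, and \<open>n q' = p' + x p / \<sigma>\<^sup>2\<close>.
\<close>

lemma normal_stein_bound:
  fixes p p' f :: "real \<Rightarrow> real"
  assumes \<sigma>: "\<sigma> > 0"
    and p: "\<And>x. (p has_real_derivative p' x) (at x)" "\<And>x. isCont p' x" "integrable lborel p"
    and f[measurable]: "f \<in> borel_measurable borel" and M: "\<And>x. \<bar>f x\<bar> \<le> M"
  shows "ennreal \<bar>(\<integral>x. f x * p x \<partial>lborel) - (\<integral>x. f x * normal_density 0 \<sigma> x \<partial>lborel) * (\<integral>x. p x \<partial>lborel)\<bar>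
     \<le> ennreal (2 * sqrt (2 * pi * \<sigma>\<^sup>2) * M) * (\<integral>\<^sup>+x. ennreal \<bar>p' x + x * p x / \<sigma>\<^sup>2\<bar> \<partial>lborel)"
proof -
  define n where "n = normal_density 0 \<sigma>"
  define q where "q = (\<lambda>x. p x / n x)"
  define q' where "q' = (\<lambda>x. (p' x + x * p x / \<sigma>\<^sup>2) / n x)"
  define P where "P = (\<integral>x. p x \<partial>lborel)"
  have n0: "n x > 0" for x using \<sigma> by (simp add: n_def normal_density_pos)
  have M0: "M \<ge> 0" using M[of 0] by linarith
  have [measurable]: "n \<in> borel_measurable borel" by (simp add: n_def)
  have [measurable]: "p \<in> borel_measurable borel" using p(3) by auto
  have nint: "integrable lborel n" "(\<integral>x. n x \<partial>lborel) = 1" using \<sigma> by (auto simp: n_def)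
  have dn: "(n has_real_derivative - (x / \<sigma>\<^sup>2) * n x) (at x)" for x
    unfolding n_def normal_density_def using \<sigma>
    by (auto intro!: derivative_eq_intros simp: field_simps)
  have cn: "isCont n x" for x using dn DERIV_isCont by blast
  have cp: "isCont p x" for x using p(1) DERIV_isCont by blast
  have dq: "(q has_real_derivative q' x) (at x)" for x
  proof -
    have "(q has_real_derivative (p' x * n x - p x * (- (x / \<sigma>\<^sup>2) * n x)) / (n x * n x)) (at x)"
      unfolding q_def using n0[of x] by (intro DERIV_divide p dn) auto
    moreover have "(p' x * n x - p x * (- (x / \<sigma>\<^sup>2) * n x)) / (n x * n x) = q' x"
      using n0[of x] \<sigma> by (simp add: q'_def field_simps)
    ultimately show ?thesis by simp
  qed
  have cq: "isCont q' x" for x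
    unfolding q'_def using n0[of x] \<sigma> by (intro continuous_intros p(2) cn cp) auto
  have fp: "integrable lborel (\<lambda>x. f x * p x)"
    by (rule Bochner_Integration.integrable_bound[OF integrable_mult_right[OF integrable_abs[OF p(3)], of M]])
       (auto simp: abs_mult intro!: mult_mono M M0 order_trans[OF M abs_ge_self])
  have fn: "integrable lborel (\<lambda>x. f x * n x)"
    by (rule Bochner_Integration.integrable_bound[OF integrable_mult_right[OF integrable_abs[OF nint(1)], of M]])
       (auto simp: abs_mult intro!: mult_mono M M0 order_trans[OF M abs_ge_self])
  have pointwise: "ennreal \<bar>p x - n x * P\<bar> \<le> (\<integral>\<^sup>+y. ennreal (n x * n y * \<bar>q x - q y\<bar>) \<partial>lborel)" for x
  proof -
    have "p x - n x * P = (\<integral>y. n y * p x - n x * p y \<partial>lborel)"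
      using nint p(3) by (simp add: P_def)
    then have "ennreal \<bar>p x - n x * P\<bar> \<le> (\<integral>\<^sup>+y. ennreal (norm (n y * p x - n x * p y)) \<partial>lborel)"
      using integral_norm_bound_ennreal[of lborel "\<lambda>y. n y * p x - n x * p y"] nint p(3) by auto
    also have "\<dots> = (\<integral>\<^sup>+y. ennreal (n x * n y * \<bar>q x - q y\<bar>) \<partial>lborel)"
    proof (intro nn_integral_cong arg_cong[of _ _ ennreal])
      fix y
      have "n y * p x - n x * p y = n x * n y * (q x - q y)"
        using n0[of x] n0[of y] by (simp add: q_def field_simps)
      then show "norm (n y * p x - n x * p y) = n x * n y * \<bar>q x - q y\<bar>"
        using n0[of x] n0[of y] by (simp add: abs_mult)
    qed
    finally show ?thesis .
  qed
  have "(\<integral>x. f x * p x \<partial>lborel) - (\<integral>x. f x * n x \<partial>lborel) * P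
      = (\<integral>x. f x * p x \<partial>lborel) - (\<integral>x. f x * n x * P \<partial>lborel)"
    by simp
  also have "\<dots> = (\<integral>x. f x * p x - f x * n x * P \<partial>lborel)"
    by (rule Bochner_Integration.integral_diff[symmetric]) (use fp fn in auto)
  also have "\<dots> = (\<integral>x. f x * (p x - n x * P) \<partial>lborel)"
    by (simp add: algebra_simps)
  finally have "ennreal \<bar>(\<integral>x. f x * p x \<partial>lborel) - (\<integral>x. f x * n x \<partial>lborel) * P\<bar>
      = ennreal (norm (\<integral>x. f x * (p x - n x * P) \<partial>lborel))" by simp
  also have "\<dots> \<le> (\<integral>\<^sup>+x. ennreal (norm (f x * (p x - n x * P))) \<partial>lborel)"
  proof (rule integral_norm_bound_ennreal)
    have "integrable lborel (\<lambda>x. f x * p x - f x * n x * P)" using fp fn by auto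
    then show "integrable lborel (\<lambda>x. f x * (p x - n x * P))" by (simp add: algebra_simps)
  qed
  also have "\<dots> \<le> (\<integral>\<^sup>+x. ennreal M * (\<integral>\<^sup>+y. ennreal (n x * n y * \<bar>q x - q y\<bar>) \<partial>lborel) \<partial>lborel)"
  proof (intro nn_integral_mono)
    fix x
    have "ennreal (norm (f x * (p x - n x * P))) \<le> ennreal (M * \<bar>p x - n x * P\<bar>)"
      by (intro ennreal_leI) (auto simp: abs_mult intro!: mult_right_mono M)
    also have "\<dots> = ennreal M * ennreal \<bar>p x - n x * P\<bar>" using M0 by (simp add: ennreal_mult')
    also have "\<dots> \<le> ennreal M * (\<integral>\<^sup>+y. ennreal (n x * n y * \<bar>q x - q y\<bar>) \<partial>lborel)"
      by (intro mult_left_mono pointwise) auto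
    finally show "ennreal (norm (f x * (p x - n x * P))) \<le> \<dots>" .
  qed
  also have "\<dots> = ennreal M * (\<integral>\<^sup>+x. \<integral>\<^sup>+y. ennreal (n x * n y * \<bar>q x - q y\<bar>) \<partial>lborel \<partial>lborel)"
    by (rule nn_integral_cmult) (simp add: q_def)
  also have "\<dots> \<le> ennreal M * (ennreal (2 * sqrt (2 * pi * \<sigma>\<^sup>2)) * (\<integral>\<^sup>+t. ennreal (n t * \<bar>q' t\<bar>) \<partial>lborel))"
    unfolding n_def by (intro mult_left_mono normal_mean_difference_le \<sigma> dq cq) auto
  also have "(\<lambda>t. n t * \<bar>q' t\<bar>) = (\<lambda>x. \<bar>p' x + x * p x / \<sigma>\<^sup>2\<bar>)"
  proof
    fix t
    have "n t * \<bar>q' t\<bar> = \<bar>n t * q' t\<bar>" using n0[of t] by (simp add: abs_mult)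
    also have "n t * q' t = p' t + t * p t / \<sigma>\<^sup>2" using n0[of t] by (simp add: q'_def)
    finally show "n t * \<bar>q' t\<bar> = \<bar>p' t + t * p t / \<sigma>\<^sup>2\<bar>" .
  qed
  also have "ennreal M * (ennreal (2 * sqrt (2 * pi * \<sigma>\<^sup>2)) * (\<integral>\<^sup>+x. ennreal \<bar>p' x + x * p x / \<sigma>\<^sup>2\<bar> \<partial>lborel))
    = ennreal (2 * sqrt (2 * pi * \<sigma>\<^sup>2) * M) * (\<integral>\<^sup>+x. ennreal \<bar>p' x + x * p x / \<sigma>\<^sup>2\<bar> \<partial>lborel)"
    using M0 by (simp add: ennreal_mult' mult_ac)
  finally show ?thesis by (simp add: n_def P_def)
qed

section \<open>The Stieltjes transform\<close>

text \<open>\<open>S_max\<close> and \<open>S_min\<close> are given by \<open>Lim\<close>, a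
  definite description that carries no information until a limit is known to exist. Monotonicity
  provides one in the extended reals, possibly infinite.\<close>

lemma antimono_tendsto_SUP_at_right:
  fixes u :: "real \<Rightarrow> real"
  assumes anti: "\<And>x y. a < x \<Longrightarrow> x < y \<Longrightarrow> u y < u x"
  shows "((\<lambda>z. ereal (u z)) \<longlongrightarrow> (SUP z\<in>{a<..}. ereal (u z))) (at_right a)"
proof (rule order_tendstoI)
  fix x assume "x < (SUP z\<in>{a<..}. ereal (u z))"
  then obtain z where z: "z > a" "x < ereal (u z)"
    unfolding less_SUP_iff by auto
  have "\<forall>\<^sub>F y in at_right a. y \<in> {a<..<z}"
    using z by (intro eventually_at_right_real)
  then show "\<forall>\<^sub>F y in at_right a. x < ereal (u y)"
  proof eventually_elim
    case (elim y)
    then have "u z < u y" by (intro anti) auto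
    with z show ?case using order.strict_trans by fastforce
  qed
next
  fix x assume x: "(SUP z\<in>{a<..}. ereal (u z)) < x"
  have "\<forall>\<^sub>F y in at_right a. y \<in> {a<..<a+1}" by (intro eventually_at_right_real) auto
  then show "\<forall>\<^sub>F y in at_right a. ereal (u y) < x"
  proof eventually_elim
    case (elim y)
    then have "ereal (u y) \<le> (SUP z\<in>{a<..}. ereal (u z))" by (intro SUP_upper) auto
    with x show ?case by simp
  qed
qed

text \<open>The intermediate value theorem between a point where \<open>u\<close> exceeds
  \<open>t\<close>, found because the limit at \<open>a\<close> is a supremum, and a far point where
  \<open>u\<close> is below \<open>t\<close>.\<close>

lemma continuous_antimono_attains:
  fixes u :: "real \<Rightarrow> real"
  assumes anti: "\<And>x y. a < x \<Longrightarrow> x < y \<Longrightarrow> u y < u x"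
    and cont: "continuous_on {a<..} u" and lim: "(u \<longlongrightarrow> 0) at_top"
    and t: "0 < t" "ereal t < Lim (at_right a) (\<lambda>z. ereal (u z))"
  obtains z where "z > a" "u z = t"
proof -
  have "Lim (at_right a) (\<lambda>z. ereal (u z)) = (SUP z\<in>{a<..}. ereal (u z))"
    using antimono_tendsto_SUP_at_right[of a u, OF anti] by (intro tendsto_Lim) auto
  with t(2) have "ereal t < (SUP z\<in>{a<..}. ereal (u z))" by simp
  then obtain z1 where z1: "z1 > a" "t < u z1"
    unfolding less_SUP_iff by auto
  obtain z2 where z2: "z2 > z1" "u z2 < t"
  proof -
    have "\<forall>\<^sub>F z in at_top. u z < t \<and> z > z1"
      using order_tendstoD(2)[OF lim t(1)] eventually_gt_at_top[of z1] by eventually_elim auto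
    from eventually_happens'[OF trivial_limit_at_top_linorder this] that show thesis by blast
  qed
  obtain z where "z \<ge> z1" "u z = t"
    using IVT2'[of u z2 t z1] z1 z2 continuous_on_subset[OF cont, of "{z1..z2}"] by fastforce
  with z1(1) show thesis by (intro that[of z]) auto
qed

context
  fixes \<rho> :: "real measure" and c :: real
  assumes \<rho>: "prob_space \<rho>" "sets \<rho> = sets borel" "emeasure \<rho> {0..c} = 1" and c: "c > 0"
begin

interpretation prob_space \<rho> by (rule \<rho>(1))

lemma AE_supportI:
  assumes "\<And>x. x \<in> {0..c} \<Longrightarrow> P x"
  shows "AE x in \<rho>. P x"
proof -
  have "prob {0..c} = 1" using \<rho>(3) by (simp add: measure_def)
  then have "AE x in \<rho>. x \<in> {0..c}"
    using \<rho>(2) by (subst AE_in_set_eq_1) auto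
  then show ?thesis by (rule eventually_mono) (rule assms)
qed

lemma resolvent_bound:
  assumes "z \<notin> {0..c}"
  obtains B where "B > 0" "\<And>x. x \<in> {0..c} \<Longrightarrow> \<bar>1 / (z - x)\<bar> \<le> B"
proof (cases "z > c")
  case True
  then have "\<bar>1 / (z - x)\<bar> \<le> 1 / (z - c)" if "x \<in> {0..c}" for x
    using that by (auto simp: frac_le)
  then show thesis using that[of "1 / (z - c)"] True by auto
next
  case False
  with assms c have "z < 0" by auto
  then have "\<bar>1 / (z - x)\<bar> \<le> 1 / (- z)" if "x \<in> {0..c}" for x
    using that by (simp add: divide_simps)
  then show thesis using that[of "1 / (- z)"] \<open>z < 0\<close> by auto
qed

lemma integrable_resolvent:
  assumes "z \<notin> {0..c}"
  shows "integrable \<rho> (\<lambda>x. 1 / (z - x))"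
proof -
  obtain B where B: "B > 0" "\<And>x. x \<in> {0..c} \<Longrightarrow> \<bar>1 / (z - x)\<bar> \<le> B"
    using resolvent_bound[OF assms] by auto
  note [measurable_cong] = \<rho>(2)
  show ?thesis
    by (intro integrable_const_bound[of _ B] AE_supportI) (auto simp: B(2)[simplified])
qed

lemma resolvent_identity:
  assumes "z \<notin> {0..c}" "z' \<notin> {0..c}" "x \<in> {0..c}"
  shows "1 / (z - x) - 1 / (z' - x) = (z' - z) / ((z - x) * (z' - x))"
proof -
  have "z - x \<noteq> 0" "z' - x \<noteq> 0" using assms by auto
  then show ?thesis by (simp add: diff_frac_eq)
qed

lemma stieltjes_diff:
  assumes "z \<notin> {0..c}" "z' \<notin> {0..c}"
  shows "stieltjes \<rho> z - stieltjes \<rho> z' = (\<integral>x. (z' - z) / ((z - x) * (z' - x)) \<partial>\<rho>)"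
proof -
  note [measurable_cong] = \<rho>(2)
  have "stieltjes \<rho> z - stieltjes \<rho> z' = (\<integral>x. 1 / (z - x) - 1 / (z' - x) \<partial>\<rho>)"
    using assms unfolding stieltjes_def
    by (intro Bochner_Integration.integral_diff[symmetric] integrable_resolvent)
  also have "\<dots> = (\<integral>x. (z' - z) / ((z - x) * (z' - x)) \<partial>\<rho>)"
    using resolvent_identity assms by (intro integral_cong_AE AE_supportI) auto
  finally show ?thesis .
qed

lemma integrable_resolvent_product:
  assumes "z \<notin> {0..c}" "z' \<notin> {0..c}"
  shows "integrable \<rho> (\<lambda>x. (z' - z) / ((z - x) * (z' - x)))"
proof -
  note [measurable_cong] = \<rho>(2)
  have "integrable \<rho> (\<lambda>x. 1 / (z - x) - 1 / (z' - x))"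
    using assms by (intro Bochner_Integration.integrable_diff integrable_resolvent)
  then show ?thesis
    by (rule integrable_cong_AE_imp) (use resolvent_identity assms in \<open>auto intro!: AE_supportI\<close>)
qed

text \<open>Both points lie on the same side of the interval, so the difference of the resolvents is
  positive. Bounding it below by the constant (z' - z) / m keeps the inequality strict under the
  integral.\<close>

lemma stieltjes_strict_antimono:
  assumes "z < z'" "z > c \<or> z' < 0"
  shows "stieltjes \<rho> z' < stieltjes \<rho> z"
proof -
  have out: "z \<notin> {0..c}" "z' \<notin> {0..c}" using assms c by auto
  define m where "m = (\<bar>z\<bar> + c) * (\<bar>z'\<bar> + c)"
  have m: "m > 0" unfolding m_def using c by (intro mult_pos_pos) auto
  have pw: "(z' - z) / m \<le> (z' - z) / ((z - x) * (z' - x))" if "x \<in> {0..c}" for x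
  proof -
    have sgn: "(z - x) * (z' - x) > 0"
      using that assms by (auto intro: mult_pos_pos mult_neg_neg)
    have "\<bar>z - x\<bar> * \<bar>z' - x\<bar> \<le> m"
      unfolding m_def using that c by (intro mult_mono) auto
    then have "(z - x) * (z' - x) \<le> m" by (simp flip: abs_mult)
    with sgn m assms show ?thesis by (intro divide_left_mono) auto
  qed
  have "0 < (z' - z) / m" using assms m by simp
  also have "(z' - z) / m = (\<integral>x. (z' - z) / m \<partial>\<rho>)" by (simp add: prob_space)
  also have "\<dots> \<le> stieltjes \<rho> z - stieltjes \<rho> z'"
    unfolding stieltjes_diff[OF out]
    by (intro integral_mono_AE integrable_resolvent_product out AE_supportI pw) auto
  finally show ?thesis by simp
qed

lemma stieltjes_pos:
  assumes "z > c"
  shows "0 < stieltjes \<rho> z"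
proof -
  have "0 < 1 / z" using assms c by simp
  also have "1 / z = (\<integral>x. 1 / z \<partial>\<rho>)" by (simp add: prob_space)
  also have "\<dots> \<le> stieltjes \<rho> z" unfolding stieltjes_def
    using assms c
    by (intro integral_mono_AE integrable_resolvent AE_supportI frac_le) auto
  finally show ?thesis .
qed

lemma stieltjes_neg:
  assumes "z < 0"
  shows "stieltjes \<rho> z < 0"
proof -
  have "stieltjes \<rho> z \<le> (\<integral>x. 1 / (z - c) \<partial>\<rho>)" unfolding stieltjes_def
  proof (intro integral_mono_AE integrable_resolvent AE_supportI)
    fix x assume "x \<in> {0..c}"
    then have "1 / (c - z) \<le> 1 / (x - z)" using assms by (intro frac_le) auto
    then show "1 / (z - x) \<le> 1 / (z - c)"
      using minus_divide_right[of 1 "x - z"] minus_divide_right[of 1 "c - z"] by simp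
  qed (use assms in auto)
  also have "\<dots> = 1 / (z - c)" by (simp add: prob_space)
  also have "\<dots> < 0" using assms c by simp
  finally show ?thesis .
qed

text \<open>On each side of the interval strict monotonicity applies; across it the values differ in
  sign.\<close>

lemma inj_on_stieltjes: "inj_on (stieltjes \<rho>) (- {0..c})"
proof (rule linorder_inj_onI')
  fix z z' assume z: "z \<in> - {0..c}" "z' \<in> - {0..c}" "z < z'"
  show "stieltjes \<rho> z \<noteq> stieltjes \<rho> z'"
  proof (cases "z > c \<or> z' < 0")
    case True
    then show ?thesis using stieltjes_strict_antimono[of z z'] z by simp
  next
    case False
    then have "z < 0" "z' > c" using z by auto
    then show ?thesis using stieltjes_neg[of z] stieltjes_pos[of z'] by simp
  qed
qed

lemma isCont_stieltjes:
  assumes "z \<notin> {0..c}"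
  shows "isCont (stieltjes \<rho>) z"
proof -
  have "open (- {0..c})" by auto
  then obtain e where e: "e > 0" "ball z e \<subseteq> - {0..c}" using assms by (meson ComplI openE)
  \<comment> \<open>A point within e/2 of \<open>z\<close> keeps distance at least e/2 from the
    interval, so both resolvents are at most 2/e and \<open>B\<close> is a local Lipschitz
    constant.\<close>
  define B where "B = 2 / e * (2 / e)"
  have dist: "e \<le> \<bar>z - x\<bar>" if "x \<in> {0..c}" for x
    using e(2) that by (force simp: dist_real_def)
  have lip: "norm (stieltjes \<rho> y - stieltjes \<rho> z) \<le> B * \<bar>z - y\<bar>" if y: "\<bar>z - y\<bar> < e / 2" for y
  proof -
    have out: "y \<notin> {0..c}" using dist y e(1) by (fastforce)
    have "norm (stieltjes \<rho> y - stieltjes \<rho> z) \<le> (\<integral>x. B * \<bar>z - y\<bar> \<partial>\<rho>)"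
      unfolding stieltjes_diff[OF out assms]
    proof (rule order_trans[OF integral_norm_bound], rule integral_mono_AE)
      show "AE x in \<rho>. norm ((z - y) / ((y - x) * (z - x))) \<le> B * \<bar>z - y\<bar>"
      proof (rule AE_supportI)
        fix x assume elim: "x \<in> {0..c}"
        have "\<bar>z - x\<bar> \<le> \<bar>z - y\<bar> + \<bar>y - x\<bar>" by linarith
        then have 1: "e / 2 \<le> \<bar>z - x\<bar>" "e / 2 \<le> \<bar>y - x\<bar>" using dist[OF elim] y e(1) by auto
        have "(e / 2) * (e / 2) \<le> \<bar>y - x\<bar> * \<bar>z - x\<bar>" using 1 e(1) by (intro mult_mono) auto
        then have "\<bar>z - y\<bar> / (\<bar>y - x\<bar> * \<bar>z - x\<bar>) \<le> \<bar>z - y\<bar> / ((e / 2) * (e / 2))"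
          using 1 e(1) by (intro divide_left_mono mult_pos_pos) auto
        then show "norm ((z - y) / ((y - x) * (z - x))) \<le> B * \<bar>z - y\<bar>" by (simp add: abs_mult B_def mult.commute[of 4])
      qed
    qed (use integrable_norm[OF integrable_resolvent_product[OF out assms]] in auto)
    also have "\<dots> = B * \<bar>z - y\<bar>" by (simp add: prob_space)
    finally show ?thesis .
  qed
  have "(stieltjes \<rho> \<longlongrightarrow> stieltjes \<rho> z) (at z)"
  proof (rule Lim_null[THEN iffD2], rule Lim_null_comparison)
    show "\<forall>\<^sub>F y in at z. norm (stieltjes \<rho> y - stieltjes \<rho> z) \<le> B * \<bar>z - y\<bar>"
      unfolding eventually_at
      using lip e(1) by (intro exI[of _ "e / 2"]) (auto simp: dist_real_def abs_minus_commute)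
    have "((\<lambda>y. B * \<bar>z - y\<bar>) \<longlongrightarrow> B * \<bar>z - z\<bar>) (at z)" by (intro tendsto_intros)
    then show "((\<lambda>y. B * \<bar>z - y\<bar>) \<longlongrightarrow> 0) (at z)" by simp
  qed
  then show ?thesis by (simp add: isCont_def)
qed

lemma stieltjes_attains_pos:
  assumes "0 < t" "ereal t < S_max c \<rho>"
  obtains z where "z > c" "stieltjes \<rho> z = t"
proof (rule continuous_antimono_attains)
  show "continuous_on {c<..} (stieltjes \<rho>)"
    by (intro continuous_at_imp_continuous_on ballI isCont_stieltjes) auto
  show "(stieltjes \<rho> \<longlongrightarrow> 0) at_top"
  proof (rule tendsto_sandwich)
    show "\<forall>\<^sub>F z in at_top. 0 \<le> stieltjes \<rho> z"
      using eventually_gt_at_top[of c] by eventually_elim (simp add: stieltjes_pos less_imp_le)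
    show "\<forall>\<^sub>F z in at_top. stieltjes \<rho> z \<le> 1 / (z - c)"
      using eventually_gt_at_top[of c]
    proof eventually_elim
      case (elim z)
      have "stieltjes \<rho> z \<le> (\<integral>x. 1 / (z - c) \<partial>\<rho>)" unfolding stieltjes_def
        using elim
        by (intro integral_mono_AE integrable_resolvent AE_supportI) (auto simp: frac_le)
      then show ?case by (simp add: prob_space)
    qed
    show "((\<lambda>z. 1 / (z - c)) \<longlongrightarrow> 0) at_top"
      using filterlim_tendsto_add_at_top[OF tendsto_const[of "- c"] filterlim_ident]
      by (intro tendsto_divide_0[OF tendsto_const] filterlim_at_top_imp_at_infinity) simp
  qed auto
qed (use assms that in \<open>auto simp: S_max_def intro: stieltjes_strict_antimono\<close>)

lemma stieltjes_attains_neg: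
  assumes "t < 0" "S_min \<rho> < ereal t"
  obtains z where "z < 0" "stieltjes \<rho> z = t"
proof -
  \<comment> \<open>Reflection at 0 turns the branch left of the interval into a decreasing positive
    function on the positive half-line, to which the argument for the right branch applies.\<close>
  let ?u = "\<lambda>y. - stieltjes \<rho> (- y)"
  have Lim: "Lim (at_right 0) (\<lambda>z. ereal (?u z)) = - S_min \<rho>"
  proof -
    define L where "L = (SUP z\<in>{0<..}. ereal (?u z))"
    have 1: "((\<lambda>z. ereal (?u z)) \<longlongrightarrow> L) (at_right 0)"
      unfolding L_def by (intro antimono_tendsto_SUP_at_right) (auto intro!: stieltjes_strict_antimono)
    then have "((\<lambda>z. - ereal (?u z)) \<longlongrightarrow> - L) (at_right 0)" by (rule tendsto_uminus_ereal)
    then have "((\<lambda>z. ereal (stieltjes \<rho> z)) \<longlongrightarrow> - L) (at_left 0)"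
      by (simp add: filterlim_at_left_to_right)
    then have "S_min \<rho> = - L" unfolding S_min_def by (intro tendsto_Lim) auto
    with tendsto_Lim[OF _ 1] show ?thesis by simp
  qed
  obtain y where "y > 0" "?u y = - t"
  proof (rule continuous_antimono_attains)
    show "continuous_on {0<..} ?u"
      by (intro continuous_at_imp_continuous_on ballI continuous_minus
            isCont_o2[OF continuous_minus[OF continuous_ident] isCont_stieltjes]) auto
    show "(?u \<longlongrightarrow> 0) at_top"
    proof (rule tendsto_sandwich)
      show "\<forall>\<^sub>F z in at_top. 0 \<le> ?u z"
        using eventually_gt_at_top[of 0] by eventually_elim (simp add: stieltjes_neg less_imp_le)
      show "\<forall>\<^sub>F z in at_top. ?u z \<le> 1 / z"
        using eventually_gt_at_top[of 0]
      proof eventually_elim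
        case (elim z)
        have "(\<integral>x. - (1 / z) \<partial>\<rho>) \<le> stieltjes \<rho> (- z)" unfolding stieltjes_def
          using elim
          by (intro integral_mono_AE integrable_resolvent AE_supportI) (auto simp: field_simps)
        then show ?case by (simp add: prob_space)
      qed
      show "((\<lambda>z::real. 1 / z) \<longlongrightarrow> 0) at_top"
        by (intro tendsto_divide_0[OF tendsto_const] filterlim_at_top_imp_at_infinity filterlim_ident)
    qed auto
    show "ereal (- t) < Lim (at_right 0) (\<lambda>z. ereal (?u z))"
      using assms unfolding Lim by (simp flip: uminus_ereal.simps)
  qed (use assms in \<open>auto intro!: stieltjes_strict_antimono\<close>)
  then show thesis using that[of "- y"] by simp
qed

text \<open>For \<open>\<theta> \<in> T_set c \<rho>\<close> the inverse variance is \<open>2 * \<theta> * (z - y)\<close> with \<open>z = K_transform c \<rho> (2 * \<theta>)\<close> outside \<open>{0..c}\<close>.\<close>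

lemma inverse_limit_variance_bounded_below:
  assumes "\<theta> \<in> T_set c \<rho>"
  obtains \<delta> where "\<delta> > 0" "\<And>y. y \<in> {0..c} \<Longrightarrow> \<delta> \<le> 1 + 2 * \<theta> * (v_lim c \<rho> \<theta> - y)"
proof -
  have \<theta>0: "\<theta> \<noteq> 0" using assms by (auto simp: T_set_def)
  have half: "ereal (2 * \<theta>) < x" if "ereal \<theta> < x / 2" for x
    using that by (cases x) auto
  have half': "x < ereal (2 * \<theta>)" if "x / 2 < ereal \<theta>" for x
    using that by (cases x) auto
  obtain z where z: "z \<notin> {0..c}" "stieltjes \<rho> z = 2 * \<theta>" "\<theta> > 0 \<longrightarrow> z > c" "\<theta> < 0 \<longrightarrow> z < 0"
  proof (cases "\<theta> > 0")
    case True
    then obtain z where "z > c" "stieltjes \<rho> z = 2 * \<theta>"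
      using stieltjes_attains_pos[of "2 * \<theta>"] assms half by (auto simp: T_set_def)
    then show thesis using that[of z] True by auto
  next
    case False
    then obtain z where "z < 0" "stieltjes \<rho> z = 2 * \<theta>"
      using stieltjes_attains_neg[of "2 * \<theta>"] assms half' \<theta>0 by (auto simp: T_set_def)
    then show thesis using that[of z] False by auto
  qed
  have "K_transform c \<rho> (2 * \<theta>) = z"
    unfolding K_transform_def using z(1,2) by (intro the_inv_into_f_eq inj_on_stieltjes) auto
  then have v: "1 + 2 * \<theta> * (v_lim c \<rho> \<theta> - y) = 2 * \<theta> * (z - y)" for y
    using \<theta>0 by (simp add: v_lim_def R_transform_def field_simps)
  \<comment> \<open>\<theta> and z - y have the same sign, so the minimum over y is attained at the
    endpoint of the interval nearest to z.\<close>
  show thesis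
  proof (cases "\<theta> > 0")
    case True
    have "2 * \<theta> * (z - c) \<le> 1 + 2 * \<theta> * (v_lim c \<rho> \<theta> - y)" if "y \<in> {0..c}" for y
      unfolding v using that True by (intro mult_left_mono) auto
    then show thesis using True z by (intro that[of "2 * \<theta> * (z - c)"]) auto
  next
    case False
    then have neg: "\<theta> < 0" using \<theta>0 by simp
    have "2 * \<theta> * z \<le> 1 + 2 * \<theta> * (v_lim c \<rho> \<theta> - y)" if "y \<in> {0..c}" for y
      unfolding v using that neg by (intro mult_left_mono_neg) auto
    then show thesis using neg z by (intro that[of "2 * \<theta> * z"]) (auto intro: mult_neg_neg)
  qed
qed

end

section \<open>Scaling of Gaussian integrals\<close>

abbreviation std_normal :: "real measure" where
  "std_normal \<equiv> density lborel (\<lambda>x. ennreal (std_normal_density x))"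

lemma prob_space_std_normal: "prob_space std_normal"
  by (rule prob_space_normal_density) simp

text \<open>The weight on the right is the density of the centred normal law with standard deviation
  \<open>a\<close> relative to the standard one.\<close>

lemma nn_integral_std_normal_scale:
  assumes a: "a > 0" and [measurable]: "f \<in> borel_measurable borel"
  shows "(\<integral>\<^sup>+x. f (a * x) \<partial>std_normal)
       = (\<integral>\<^sup>+x. f x * ennreal (inverse a * exp ((1 - inverse (a\<^sup>2)) / 2 * x\<^sup>2)) \<partial>std_normal)"
proof -
  have eq: "inverse a * exp ((1 - inverse (a\<^sup>2)) / 2 * (a * x)\<^sup>2) * std_normal_density (a * x) * a = std_normal_density x" for x
  proof -
    have "(1 - inverse (a\<^sup>2)) / 2 * (a * x)\<^sup>2 + - (a * x)\<^sup>2 / 2 = - x\<^sup>2 / 2"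
      using a by (simp add: field_simps power2_eq_square)
    then show ?thesis
      using a unfolding std_normal_density_def by (simp add: mult_ac flip: exp_add)
  qed
  have "(\<integral>\<^sup>+x. f x * ennreal (inverse a * exp ((1 - inverse (a\<^sup>2)) / 2 * x\<^sup>2)) \<partial>std_normal)
    = (\<integral>\<^sup>+x. ennreal (std_normal_density x) * (f x * ennreal (inverse a * exp ((1 - inverse (a\<^sup>2)) / 2 * x\<^sup>2))) \<partial>lborel)"
    by (rule nn_integral_density) measurable
  also have "\<dots> = ennreal \<bar>a\<bar> * (\<integral>\<^sup>+x. ennreal (std_normal_density (a * x)) * (f (a * x) * ennreal (inverse a * exp ((1 - inverse (a\<^sup>2)) / 2 * (a * x)\<^sup>2))) \<partial>lborel)"
    using a by (subst nn_integral_real_affine[where c = a and t = 0]) auto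
  also have "\<dots> = (\<integral>\<^sup>+x. ennreal \<bar>a\<bar> * (ennreal (std_normal_density (a * x)) * (f (a * x) * ennreal (inverse a * exp ((1 - inverse (a\<^sup>2)) / 2 * (a * x)\<^sup>2)))) \<partial>lborel)"
    by (rule nn_integral_cmult[symmetric]) measurable
  also have "\<dots> = (\<integral>\<^sup>+x. ennreal (std_normal_density x) * f (a * x) \<partial>lborel)"
  proof (intro nn_integral_cong)
    fix x
    have "ennreal \<bar>a\<bar> * (ennreal (std_normal_density (a * x)) * (f (a * x) * ennreal (inverse a * exp ((1 - inverse (a\<^sup>2)) / 2 * (a * x)\<^sup>2))))
       = ennreal (inverse a * exp ((1 - inverse (a\<^sup>2)) / 2 * (a * x)\<^sup>2)) * ennreal (std_normal_density (a * x)) * ennreal a * f (a * x)"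
      using a by (simp add: mult_ac)
    also have "\<dots> = ennreal (std_normal_density x) * f (a * x)"
      using a by (subst eq[of x, symmetric]) (simp add: ennreal_mult')
    finally show "ennreal \<bar>a\<bar> * (ennreal (std_normal_density (a * x)) * (f (a * x) * ennreal (inverse a * exp ((1 - inverse (a\<^sup>2)) / 2 * (a * x)\<^sup>2)))) = \<dots>" .
  qed
  also have "\<dots> = (\<integral>\<^sup>+x. f (a * x) \<partial>std_normal)"
    by (rule nn_integral_density[symmetric]) measurable
  finally show ?thesis ..
qed

interpretation std_normal: prob_space std_normal
  by (rule prob_space_std_normal)

interpretation std_normals: product_sigma_finite "\<lambda>_ :: nat. std_normal"
  by unfold_locales

lemma prob_space_PiM_std_normal: "prob_space (Pi\<^sub>M I (\<lambda>_. std_normal))"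
  by (intro prob_space_PiM prob_space_std_normal)

lemma sigma_finite_PiM_std_normal: "sigma_finite_measure (Pi\<^sub>M I (\<lambda>_. std_normal))"
  by (rule prob_space_imp_sigma_finite[OF prob_space_PiM_std_normal])

text \<open>The weights of the coordinates multiply to a function of the squared norm alone; this is
  what makes the radius separable. The induction freezes the new coordinate at \<open>a * y\<close>,
  scales the others, exchanges the integrals and scales the last one.\<close>

lemma nn_integral_PiM_std_normal_scale:
  fixes F :: "(nat \<Rightarrow> real) \<Rightarrow> ennreal"
  assumes a: "a > 0" and "finite I" "F \<in> borel_measurable (Pi\<^sub>M I (\<lambda>_. std_normal))"
  shows "(\<integral>\<^sup>+g. F (\<lambda>i\<in>I. a * g i) \<partial>Pi\<^sub>M I (\<lambda>_. std_normal))
       = (\<integral>\<^sup>+g. F g * ennreal (inverse a ^ card I * exp ((1 - inverse (a\<^sup>2)) / 2 * (\<Sum>i\<in>I. (g i)\<^sup>2))) \<partial>Pi\<^sub>M I (\<lambda>_. std_normal))"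
  using assms(2,3)
proof (induction I arbitrary: F rule: finite_induct)
  case empty
  show ?case
  proof (intro nn_integral_cong)
    fix g :: "nat \<Rightarrow> real" assume "g \<in> space (Pi\<^sub>M {} (\<lambda>_. std_normal))"
    then have "g = (\<lambda>_. undefined)" by (simp add: space_PiM)
    then have "(\<lambda>i\<in>{}. a * g i) = g" by (simp add: restrict_def)
    then show "F (\<lambda>i\<in>{}. a * g i)
      = F g * ennreal (inverse a ^ card {} * exp ((1 - inverse (a\<^sup>2)) / 2 * (\<Sum>i\<in>{}. (g i)\<^sup>2)))"
      by simp
  qed
next
  case (insert j I)
  note [measurable] = insert.prems
  let ?M = "\<lambda>_::nat. std_normal"
  let ?c = "(1 - inverse (a\<^sup>2)) / 2"
  have restr[measurable]: "(\<lambda>g. \<lambda>i\<in>J. a * g i) \<in> measurable (Pi\<^sub>M J ?M) (Pi\<^sub>M J ?M)" for J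
    by (intro measurable_restrict) measurable
  have upd: "(\<lambda>i\<in>insert j I. a * (x(j := y)) i) = (\<lambda>i\<in>I. a * x i)(j := a * y)" for x :: "nat \<Rightarrow> real" and y
    using insert.hyps by (auto simp: fun_eq_iff)
  have updm[measurable]: "(\<lambda>(x, y). F (x(j := y))) \<in> borel_measurable (Pi\<^sub>M I ?M \<Otimes>\<^sub>M std_normal)"
    using measurable_comp[OF measurable_add_dim insert.prems, unfolded comp_def] by (simp add: case_prod_unfold)
  have upd1: "(\<lambda>x. F (x(j := y))) \<in> borel_measurable (Pi\<^sub>M I ?M)" for y
    using measurable_Pair2'[of y std_normal "Pi\<^sub>M I ?M"] updm
    by (intro measurable_compose[OF _ updm, of "\<lambda>x. (x, y)", simplified]) auto
  have upd2: "(\<lambda>y. F (x(j := y))) \<in> borel_measurable borel" if "x \<in> space (Pi\<^sub>M I ?M)" for x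
    using measurable_compose[OF measurable_Pair1'[OF that] updm] by simp
  have "(\<lambda>g. F (\<lambda>i\<in>insert j I. a * g i)) \<in> borel_measurable (Pi\<^sub>M (insert j I) ?M)"
    by (rule measurable_compose[OF restr insert.prems])
  from std_normals.product_nn_integral_insert_rev[OF insert.hyps this]
  have "(\<integral>\<^sup>+g. F (\<lambda>i\<in>insert j I. a * g i) \<partial>Pi\<^sub>M (insert j I) ?M)
      = (\<integral>\<^sup>+y. \<integral>\<^sup>+x. F ((\<lambda>i\<in>I. a * x i)(j := a * y)) \<partial>Pi\<^sub>M I ?M \<partial>std_normal)"
    by (simp only: upd)
  also have "\<dots> = (\<integral>\<^sup>+y. \<integral>\<^sup>+x. F (x(j := a * y)) * ennreal (inverse a ^ card I * exp (?c * (\<Sum>i\<in>I. (x i)\<^sup>2))) \<partial>Pi\<^sub>M I ?M \<partial>std_normal)"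
    by (intro nn_integral_cong insert.IH upd1)
  also have "\<dots> = (\<integral>\<^sup>+x. \<integral>\<^sup>+y. F (x(j := a * y)) * ennreal (inverse a ^ card I * exp (?c * (\<Sum>i\<in>I. (x i)\<^sup>2))) \<partial>std_normal \<partial>Pi\<^sub>M I ?M)"
  proof -
    interpret P: pair_sigma_finite "Pi\<^sub>M I ?M" std_normal
      by (rule pair_sigma_finite.intro[OF sigma_finite_PiM_std_normal std_normal.sigma_finite_measure_axioms])
    have "(\<lambda>z. (\<lambda>(x, y). F (x(j := y))) (fst z, a * snd z)) \<in> borel_measurable (Pi\<^sub>M I ?M \<Otimes>\<^sub>M std_normal)"
      by (rule measurable_compose[OF _ updm]) measurable
    then have [measurable]: "(\<lambda>(x, y). F (x(j := a * y))) \<in> borel_measurable (Pi\<^sub>M I ?M \<Otimes>\<^sub>M std_normal)"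
      by (simp add: case_prod_unfold)
    have "(\<lambda>(x, y). F (x(j := a * y)) * ennreal (inverse a ^ card I * exp (?c * (\<Sum>i\<in>I. (x i)\<^sup>2))))
        \<in> borel_measurable (Pi\<^sub>M I ?M \<Otimes>\<^sub>M std_normal)"
      by measurable
    then show ?thesis by (rule P.Fubini')
  qed
  also have "\<dots> = (\<integral>\<^sup>+x. \<integral>\<^sup>+y. (F (x(j := y)) * ennreal (inverse a ^ card I * exp (?c * (\<Sum>i\<in>I. (x i)\<^sup>2))))
       * ennreal (inverse a * exp (?c * y\<^sup>2)) \<partial>std_normal \<partial>Pi\<^sub>M I ?M)"
    by (intro nn_integral_cong nn_integral_std_normal_scale a borel_measurable_times upd2) auto
  also have "\<dots> = (\<integral>\<^sup>+x. \<integral>\<^sup>+y. F (x(j := y)) *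
       ennreal (inverse a ^ card (insert j I) * exp (?c * (\<Sum>i\<in>insert j I. ((x(j := y)) i)\<^sup>2))) \<partial>std_normal \<partial>Pi\<^sub>M I ?M)"
  proof (intro nn_integral_cong)
    fix x :: "nat \<Rightarrow> real" and y :: real
    have "(\<Sum>i\<in>I. ((x(j := y)) i)\<^sup>2) = (\<Sum>i\<in>I. (x i)\<^sup>2)"
      by (rule sum.cong) (use insert.hyps in auto)
    then have "(\<Sum>i\<in>insert j I. ((x(j := y)) i)\<^sup>2) = y\<^sup>2 + (\<Sum>i\<in>I. (x i)\<^sup>2)"
      using insert.hyps by simp
    then show "(F (x(j := y)) * ennreal (inverse a ^ card I * exp (?c * (\<Sum>i\<in>I. (x i)\<^sup>2)))) * ennreal (inverse a * exp (?c * y\<^sup>2))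
      = F (x(j := y)) * ennreal (inverse a ^ card (insert j I) * exp (?c * (\<Sum>i\<in>insert j I. ((x(j := y)) i)\<^sup>2)))"
      using a insert.hyps by (simp add: ennreal_mult'[symmetric] exp_add distrib_left mult_ac)
  qed
  also have "\<dots> = (\<integral>\<^sup>+g. F g * ennreal (inverse a ^ card (insert j I) * exp (?c * (\<Sum>i\<in>insert j I. (g i)\<^sup>2))) \<partial>Pi\<^sub>M (insert j I) ?M)"
    using insert.hyps by (subst std_normals.product_nn_integral_insert) auto
  finally show ?case .
qed

lemma AE_sum_squares_pos:
  fixes I :: "nat set"
  assumes "finite I" "I \<noteq> {}"
  shows "AE g in Pi\<^sub>M I (\<lambda>_. std_normal). 0 < (\<Sum>i\<in>I. (g i)\<^sup>2)"
proof -
  obtain j where j: "j \<in> I" using assms by auto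
  have "AE x in std_normal. x \<noteq> 0"
    using AE_lborel_singleton[of "0::real"] by (subst AE_density) (auto elim: eventually_mono)
  then have "AE g in Pi\<^sub>M I (\<lambda>_. std_normal). g j \<noteq> 0"
    by (intro AE_PiM_component prob_space_std_normal j)
  then show ?thesis
  proof eventually_elim
    case (elim g)
    have "0 < (g j)\<^sup>2" using elim by simp
    also have "\<dots> \<le> (\<Sum>i\<in>I. (g i)\<^sup>2)" using assms j by (intro member_le_sum) auto
    finally show ?case .
  qed
qed

text \<open>Represents 1/q as a superposition of the weights that arise from scaling a Gaussian
  vector by 1 / sqrt t.\<close>

lemma nn_integral_exp_shifted:
  assumes "q > 0"
  shows "(\<integral>\<^sup>+t. ennreal (exp ((1 - t) / 2 * q)) * indicator {1..} t \<partial>lborel) = ennreal (2 / q)"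
proof -
  have lim: "((\<lambda>t. exp ((1 - t) / 2 * q)) \<longlongrightarrow> 0) at_top"
  proof (intro filterlim_compose[OF exp_at_bot])
    have "filterlim (\<lambda>t. - 1 + t) at_top (at_top :: real filter)"
      by (intro filterlim_tendsto_add_at_top[OF tendsto_const] filterlim_ident)
    then have "filterlim (\<lambda>t. (q / 2) * (- 1 + t)) at_top at_top"
      using assms by (intro filterlim_tendsto_pos_mult_at_top[OF tendsto_const]) auto
    also have "(\<lambda>t. (q / 2) * (- 1 + t)) = (\<lambda>t. - ((1 - t) / 2 * q))"
      by (auto simp: field_simps)
    finally show "filterlim (\<lambda>t. (1 - t) / 2 * q) at_bot at_top"
      unfolding filterlim_uminus_at_bot .
  qed
  have "(\<integral>\<^sup>+t. ennreal (exp ((1 - t) / 2 * q)) * indicator {1..} t \<partial>lborel)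
      = ennreal (- (2 / q) * 0 - - (2 / q) * exp ((1 - 1) / 2 * q))"
    using assms
    by (intro nn_integral_FTC_atLeast tendsto_mult tendsto_const lim)
       (auto intro!: derivative_eq_intros simp: field_simps)
  then show ?thesis by simp
qed

text \<open>The other side of the integrated scaling identity. Convergence for \<alpha> > 1 is the
  source of the condition \<open>card I + 2 * m > 2\<close>.\<close>

lemma nn_integral_powr_atLeast_1:
  assumes "\<alpha> > 1"
  shows "(\<integral>\<^sup>+t. ennreal (t powr - \<alpha>) * indicator {1..} t \<partial>lborel) = ennreal (1 / (\<alpha> - 1))"
proof -
  have lim: "((\<lambda>t::real. t powr (1 - \<alpha>)) \<longlongrightarrow> 0) at_top"
    using assms by (intro tendsto_neg_powr filterlim_ident) auto
  have der: "((\<lambda>t. - (1 / (\<alpha> - 1)) * t powr (1 - \<alpha>)) has_real_derivative t powr - \<alpha>) (at t)" if "t \<ge> 1" for t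
  proof -
    have "- (1 / (\<alpha> - 1)) * ((1 - \<alpha>) * t powr (1 - \<alpha> - 1)) = t powr - \<alpha>"
      using assms by (simp add: field_simps)
    with DERIV_cmult[OF has_real_derivative_powr[of t "1 - \<alpha>"], of "- (1 / (\<alpha> - 1))"] that
    show ?thesis by simp
  qed
  have "(\<integral>\<^sup>+t. ennreal (t powr - \<alpha>) * indicator {1..} t \<partial>lborel)
      = ennreal (- (1 / (\<alpha> - 1)) * 0 - - (1 / (\<alpha> - 1)) * 1 powr (1 - \<alpha>))"
    by (intro nn_integral_FTC_atLeast[where F = "\<lambda>t. - (1 / (\<alpha> - 1)) * t powr (1 - \<alpha>)"]
          tendsto_mult tendsto_const lim der) auto
  then show ?thesis by simp
qed

text \<open>Both sides of the scaling identity are integrated over the scale.\<close>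

lemma nn_integral_PiM_std_normal_radial:
  fixes F :: "(nat \<Rightarrow> real) \<Rightarrow> ennreal"
  assumes I: "finite I" "card I + 2 * m > 2" "I \<noteq> {}"
    and F[measurable]: "F \<in> borel_measurable (Pi\<^sub>M I (\<lambda>_. std_normal))"
    and hom: "\<And>a g. a > 0 \<Longrightarrow> g \<in> space (Pi\<^sub>M I (\<lambda>_. std_normal)) \<Longrightarrow> F (\<lambda>i\<in>I. a * g i) = ennreal (a ^ (2 * m)) * F g"
  shows "ennreal (real (card I) + 2 * real m - 2) * (\<integral>\<^sup>+g. F g * ennreal (1 / (\<Sum>i\<in>I. (g i)\<^sup>2)) \<partial>Pi\<^sub>M I (\<lambda>_. std_normal))
       = (\<integral>\<^sup>+g. F g \<partial>Pi\<^sub>M I (\<lambda>_. std_normal))"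
proof -
  let ?G = "Pi\<^sub>M I (\<lambda>_. std_normal)"
  define q :: "(nat \<Rightarrow> real) \<Rightarrow> real" where "q = (\<lambda>g. \<Sum>i\<in>I. (g i)\<^sup>2)"
  \<comment> \<open>Scaling by 1 / sqrt t gives t^(card I / 2) from the Gaussian density and t^(-m)
    from homogeneity; \<alpha> is the resulting exponent.\<close>
  define \<alpha> where "\<alpha> = real (card I) / 2 + real m"
  have \<alpha>: "\<alpha> > 1" using I(2) unfolding \<alpha>_def by linarith
  have [measurable]: "q \<in> borel_measurable ?G" unfolding q_def by measurable
  define IF where "IF = (\<integral>\<^sup>+g. F g \<partial>?G)"
  have scale: "(\<integral>\<^sup>+g. F g * ennreal (exp ((1 - t) / 2 * q g)) \<partial>?G) = ennreal (t powr - \<alpha>) * IF" if t: "t > 0" for t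
  proof -
    define a where "a = 1 / sqrt t"
    have a: "a > 0" "inverse (a\<^sup>2) = t" "inverse a = t powr (1/2)" "a = t powr (- 1/2)"
      using t by (auto simp: a_def field_simps powr_half_sqrt powr_minus_divide)
    have 1: "a ^ (2 * m) = t powr - real m" "inverse a ^ card I = t powr (real (card I) / 2)"
      using t unfolding a(3) by (simp_all add: a(4) powr_realpow[symmetric] powr_powr del: powr_realpow)
    have "ennreal (t powr - real m) * IF = (\<integral>\<^sup>+g. ennreal (a ^ (2 * m)) * F g \<partial>?G)"
      unfolding IF_def 1 by (rule nn_integral_cmult[symmetric]) measurable
    also have "\<dots> = (\<integral>\<^sup>+g. F (\<lambda>i\<in>I. a * g i) \<partial>?G)"
      using hom a(1) by (intro nn_integral_cong) simp
    also have "\<dots> = (\<integral>\<^sup>+g. F g * ennreal (inverse a ^ card I * exp ((1 - t) / 2 * q g)) \<partial>?G)"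
      using nn_integral_PiM_std_normal_scale[OF a(1) I(1) F] by (simp add: a(2) q_def)
    also have "\<dots> = (\<integral>\<^sup>+g. ennreal (t powr (real (card I) / 2)) * (F g * ennreal (exp ((1 - t) / 2 * q g))) \<partial>?G)"
      by (simp add: 1 ennreal_mult' mult_ac)
    also have "\<dots> = ennreal (t powr (real (card I) / 2)) * (\<integral>\<^sup>+g. F g * ennreal (exp ((1 - t) / 2 * q g)) \<partial>?G)"
      by (rule nn_integral_cmult) measurable
    finally have "ennreal (t powr - (real (card I) / 2)) * (ennreal (t powr - real m) * IF)
       = ennreal (t powr - (real (card I) / 2)) * (ennreal (t powr (real (card I) / 2)) * (\<integral>\<^sup>+g. F g * ennreal (exp ((1 - t) / 2 * q g)) \<partial>?G))"
      by simp
    then show ?thesis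
      using t by (simp add: mult.assoc[symmetric] ennreal_mult'[symmetric] powr_add[symmetric] \<alpha>_def)
  qed
  have "(\<integral>\<^sup>+g. F g * ennreal (2 / q g) \<partial>?G)
      = (\<integral>\<^sup>+g. (\<integral>\<^sup>+t. F g * (ennreal (exp ((1 - t) / 2 * q g)) * indicator {1..} t) \<partial>lborel) \<partial>?G)"
  proof (intro nn_integral_cong_AE eventually_mono[OF AE_sum_squares_pos[OF I(1,3)]])
    fix g :: "nat \<Rightarrow> real" assume "0 < (\<Sum>i\<in>I. (g i)\<^sup>2)"
    then have "(\<integral>\<^sup>+t. ennreal (exp ((1 - t) / 2 * q g)) * indicator {1..} t \<partial>lborel) = ennreal (2 / q g)"
      by (intro nn_integral_exp_shifted) (simp add: q_def)
    moreover have "(\<lambda>t. ennreal (exp ((1 - t) / 2 * q g)) * indicator {1..} t) \<in> borel_measurable lborel"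
      by measurable
    ultimately show "F g * ennreal (2 / q g) = (\<integral>\<^sup>+t. F g * (ennreal (exp ((1 - t) / 2 * q g)) * indicator {1..} t) \<partial>lborel)"
      by (simp only: nn_integral_cmult)
  qed
  also have "\<dots> = (\<integral>\<^sup>+t. (\<integral>\<^sup>+g. F g * (ennreal (exp ((1 - t) / 2 * q g)) * indicator {1..} t) \<partial>?G) \<partial>lborel)"
  proof -
    interpret P: pair_sigma_finite lborel ?G
      by (rule pair_sigma_finite.intro[OF lborel.sigma_finite_measure_axioms sigma_finite_PiM_std_normal])
    have "(\<lambda>(t, g). F g * (ennreal (exp ((1 - t) / 2 * q g)) * indicator {1..} t)) \<in> borel_measurable (lborel \<Otimes>\<^sub>M ?G)"
      by measurable
    then show ?thesis by (rule P.Fubini')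
  qed
  also have "\<dots> = (\<integral>\<^sup>+t. (ennreal (t powr - \<alpha>) * indicator {1..} t) * IF \<partial>lborel)"
  proof (intro nn_integral_cong)
    fix t :: real
    show "(\<integral>\<^sup>+g. F g * (ennreal (exp ((1 - t) / 2 * q g)) * indicator {1..} t) \<partial>?G) = (ennreal (t powr - \<alpha>) * indicator {1..} t) * IF"
      using scale[of t] by (auto split: split_indicator)
  qed
  also have "\<dots> = ennreal (1 / (\<alpha> - 1)) * IF"
    using \<alpha> by (simp add: nn_integral_multc nn_integral_powr_atLeast_1)
  finally have eq: "(\<integral>\<^sup>+g. F g * ennreal (2 / q g) \<partial>?G) = ennreal (1 / (\<alpha> - 1)) * IF" .
  have "ennreal (real (card I) + 2 * real m - 2) * (\<integral>\<^sup>+g. F g * ennreal (1 / q g) \<partial>?G)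
      = (\<integral>\<^sup>+g. ennreal (2 * \<alpha> - 2) * (F g * ennreal (1 / q g)) \<partial>?G)"
    by (subst nn_integral_cmult) (auto simp: \<alpha>_def)
  also have "\<dots> = (\<integral>\<^sup>+g. ennreal (\<alpha> - 1) * (F g * ennreal (2 / q g)) \<partial>?G)"
  proof (intro nn_integral_cong)
    fix g
    have "(2 * \<alpha> - 2) * (1 / q g) = (\<alpha> - 1) * (2 / q g)" by (simp add: field_simps)
    then have "ennreal (2 * \<alpha> - 2) * ennreal (1 / q g) = ennreal (\<alpha> - 1) * ennreal (2 / q g)"
      using \<alpha> by (simp only: ennreal_mult'[symmetric, of "2 * \<alpha> - 2"] ennreal_mult'[symmetric, of "\<alpha> - 1"])
    then show "ennreal (2 * \<alpha> - 2) * (F g * ennreal (1 / q g)) = ennreal (\<alpha> - 1) * (F g * ennreal (2 / q g))"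
      by (metis mult.left_commute)
  qed
  also have "\<dots> = ennreal (\<alpha> - 1) * (ennreal (1 / (\<alpha> - 1)) * IF)"
    by (subst nn_integral_cmult) (auto simp: eq)
  also have "\<dots> = IF"
    using \<alpha> by (simp add: mult.assoc[symmetric] ennreal_mult'[symmetric])
  finally show ?thesis by (simp add: q_def IF_def)
qed

text \<open>This replaces polar coordinates. The case m = 0 evaluates means with a factor 1/q and
  the case m = 1 removes a quotient by q. Integrability is an equivalence because the first case
  passes from F to F/q and the second from F/q to F.\<close>

lemma integral_PiM_std_normal_radial:
  fixes F :: "(nat \<Rightarrow> real) \<Rightarrow> real"
  assumes I: "finite I" "card I + 2 * m > 2" "I \<noteq> {}"
    and F[measurable]: "F \<in> borel_measurable (Pi\<^sub>M I (\<lambda>_. std_normal))"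
    and nonneg: "\<And>g. 0 \<le> F g"
    and hom: "\<And>a g. a > 0 \<Longrightarrow> g \<in> space (Pi\<^sub>M I (\<lambda>_. std_normal)) \<Longrightarrow> F (\<lambda>i\<in>I. a * g i) = a ^ (2 * m) * F g"
  shows "integrable (Pi\<^sub>M I (\<lambda>_. std_normal)) (\<lambda>g. F g / (\<Sum>i\<in>I. (g i)\<^sup>2)) \<longleftrightarrow> integrable (Pi\<^sub>M I (\<lambda>_. std_normal)) F"
    and "(\<integral>g. F g \<partial>Pi\<^sub>M I (\<lambda>_. std_normal))
       = (real (card I) + 2 * real m - 2) * (\<integral>g. F g / (\<Sum>i\<in>I. (g i)\<^sup>2) \<partial>Pi\<^sub>M I (\<lambda>_. std_normal))"
proof -
  let ?G = "Pi\<^sub>M I (\<lambda>_. std_normal)"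
  let ?q = "\<lambda>g. \<Sum>i\<in>I. (g i)\<^sup>2 :: real"
  define d where "d = real (card I) + 2 * real m - 2"
  have d: "d > 0" unfolding d_def using I(2) by linarith
  have q0: "?q g \<ge> 0" for g by (intro sum_nonneg) auto
  have "ennreal d * (\<integral>\<^sup>+g. ennreal (F g) * ennreal (1 / ?q g) \<partial>?G) = (\<integral>\<^sup>+g. ennreal (F g) \<partial>?G)"
    unfolding d_def using nonneg hom
    by (intro nn_integral_PiM_std_normal_radial I) (auto simp: ennreal_mult')
  also have "(\<lambda>g. ennreal (F g) * ennreal (1 / ?q g)) = (\<lambda>g. ennreal (F g / ?q g))"
    using nonneg q0 by (auto simp: ennreal_mult'[symmetric])
  finally have eq: "ennreal d * (\<integral>\<^sup>+g. ennreal (F g / ?q g) \<partial>?G) = (\<integral>\<^sup>+g. ennreal (F g) \<partial>?G)" .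
  have Fq: "0 \<le> F g / ?q g" for g using nonneg q0 by simp
  have [measurable]: "(\<lambda>g. F g / ?q g) \<in> borel_measurable ?G" by measurable
  have int: "integrable ?G X \<longleftrightarrow> (\<integral>\<^sup>+g. ennreal (X g) \<partial>?G) < \<infinity>" if "X \<in> borel_measurable ?G" "\<And>g. 0 \<le> X g" for X :: "(nat \<Rightarrow> real) \<Rightarrow> real"
    using that by (simp add: integrable_iff_bounded)
  show iff: "integrable ?G (\<lambda>g. F g / ?q g) \<longleftrightarrow> integrable ?G F"
    using d by (auto simp: int F nonneg Fq eq[symmetric] ennreal_mult_less_top)
  show "(\<integral>g. F g \<partial>?G) = d * (\<integral>g. F g / ?q g \<partial>?G)"
    by (subst (1 2) integral_eq_nn_integral)
       (use d in \<open>auto simp: nonneg Fq eq[symmetric] enn2real_mult\<close>)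
qed

section \<open>The Gibbs weight in one coordinate\<close>

text \<open>The outer square makes the derivative continuous at the edge \<bar>y - v\<bar> =
  \<epsilon>, as integration by parts and the Stein bound require. The inner square makes
  \<open>1 - cutoff\<close> quadratic at \<open>v\<close>, so that its Gibbs mean is controlled by
  the rate a.\<close>

definition cutoff :: "real \<Rightarrow> real \<Rightarrow> real \<Rightarrow> real" where
  "cutoff v \<epsilon> y = (max 0 (1 - ((y - v) / \<epsilon>)\<^sup>2))\<^sup>2"

definition cutoff_deriv :: "real \<Rightarrow> real \<Rightarrow> real \<Rightarrow> real" where
  "cutoff_deriv v \<epsilon> y = - (4 * (y - v) / \<epsilon>\<^sup>2) * max 0 (1 - ((y - v) / \<epsilon>)\<^sup>2)"

lemma DERIV_max_0_square: "((\<lambda>y. (max 0 y)\<^sup>2) has_real_derivative 2 * max 0 x) (at x)" for x :: real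
proof -
  consider "x < 0" | "x > 0" | "x = 0" by linarith
  then show ?thesis
  proof cases
    case 1
    have "((\<lambda>y. 0) has_real_derivative 2 * max 0 x) (at x)"
      using 1 by (auto intro!: derivative_eq_intros)
    then show ?thesis
      by (rule has_field_derivative_transform_within_open[where S = "{..<0}"]) (use 1 in auto)
  next
    case 2
    have "((\<lambda>y. y\<^sup>2) has_real_derivative 2 * max 0 x) (at x)"
      using 2 by (auto intro!: derivative_eq_intros)
    then show ?thesis
      by (rule has_field_derivative_transform_within_open[where S = "{0<..}"]) (use 2 in auto)
  next
    case 3
    have "((\<lambda>y::real. (max 0 y)\<^sup>2 / y) \<longlongrightarrow> 0) (at 0)"
    proof (rule Lim_null_comparison)
      show "\<forall>\<^sub>F y::real in at 0. norm ((max 0 y)\<^sup>2 / y) \<le> \<bar>y\<bar>"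
        by (intro always_eventually) (auto simp: max_def power2_eq_square)
      show "((\<lambda>y::real. \<bar>y\<bar>) \<longlongrightarrow> 0) (at 0)"
        by (intro tendsto_rabs_zero tendsto_ident_at)
    qed
    then show ?thesis using 3 by (simp add: has_field_derivative_iff)
  qed
qed

lemma DERIV_cutoff:
  assumes "\<epsilon> > 0"
  shows "(cutoff v \<epsilon> has_real_derivative cutoff_deriv v \<epsilon> y) (at y)"
proof -
  have "((\<lambda>y. 1 - ((y - v) / \<epsilon>)\<^sup>2) has_real_derivative - (2 * (y - v) / \<epsilon>\<^sup>2)) (at y)"
    using assms by (auto intro!: derivative_eq_intros simp: field_simps power2_eq_square)
  from DERIV_chain2[OF DERIV_max_0_square this]
  have "((\<lambda>y. (max 0 (1 - ((y - v) / \<epsilon>)\<^sup>2))\<^sup>2) has_real_derivative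
      2 * max 0 (1 - ((y - v) / \<epsilon>)\<^sup>2) * - (2 * (y - v) / \<epsilon>\<^sup>2)) (at y)" .
  moreover have "2 * max 0 (1 - ((y - v) / \<epsilon>)\<^sup>2) * - (2 * (y - v) / \<epsilon>\<^sup>2) = cutoff_deriv v \<epsilon> y"
    by (simp add: cutoff_deriv_def field_simps)
  ultimately show ?thesis unfolding cutoff_def[abs_def] by simp
qed

lemma isCont_cutoff: "\<epsilon> > 0 \<Longrightarrow> isCont (cutoff v \<epsilon>) y"
  using DERIV_cutoff DERIV_isCont by blast

lemma isCont_cutoff_deriv: "\<epsilon> > 0 \<Longrightarrow> isCont (cutoff_deriv v \<epsilon>) y"
  unfolding cutoff_deriv_def[abs_def] by (intro continuous_intros) auto

lemma cutoff_nonneg: "0 \<le> cutoff v \<epsilon> y"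
  by (simp add: cutoff_def)

lemma cutoff_le_1: "cutoff v \<epsilon> y \<le> 1"
  unfolding cutoff_def by (intro power_le_one) auto

lemma cutoff_eq_0:
  assumes "\<epsilon> > 0" "\<epsilon> \<le> \<bar>y - v\<bar>"
  shows "cutoff v \<epsilon> y = 0"
proof -
  have "1 \<le> \<bar>(y - v) / \<epsilon>\<bar>" using assms by simp
  then have "1 \<le> ((y - v) / \<epsilon>)\<^sup>2"
    by (metis one_le_power power2_abs)
  then show ?thesis by (simp add: cutoff_def)
qed

text \<open>(1 - t)^2 >= 1 - 2t. Through this inequality the mass lost to the cutoff is charged to
  the mean of (h - v)^2.\<close>

lemma one_minus_cutoff_le: "1 - cutoff v \<epsilon> y \<le> 2 * ((y - v) / \<epsilon>)\<^sup>2"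
proof -
  define t where "t = ((y - v) / \<epsilon>)\<^sup>2"
  have "1 - 2 * t \<le> (max 0 (1 - t))\<^sup>2"
  proof (cases "t \<le> 1")
    case True
    then have "(max 0 (1 - t))\<^sup>2 = 1 - 2 * t + t\<^sup>2" by (simp add: power2_eq_square algebra_simps)
    then show ?thesis by simp
  next
    case False
    then show ?thesis by simp
  qed
  then show ?thesis unfolding cutoff_def t_def[symmetric] by linarith
qed

lemma abs_cutoff_deriv_le:
  assumes "\<epsilon> > 0"
  shows "\<bar>cutoff_deriv v \<epsilon> y\<bar> \<le> 4 / \<epsilon>"
proof (cases "\<epsilon> \<le> \<bar>y - v\<bar>")
  case True
  then have "1 \<le> \<bar>(y - v) / \<epsilon>\<bar>" using assms by simp
  then have "1 \<le> ((y - v) / \<epsilon>)\<^sup>2"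
    by (metis one_le_power power2_abs)
  then show ?thesis using assms by (simp add: cutoff_deriv_def)
next
  case False
  have "\<bar>cutoff_deriv v \<epsilon> y\<bar> = (4 * \<bar>y - v\<bar> / \<epsilon>\<^sup>2) * max 0 (1 - ((y - v) / \<epsilon>)\<^sup>2)"
    unfolding cutoff_deriv_def abs_mult abs_minus_cancel abs_divide by simp
  also have "\<dots> \<le> (4 * \<epsilon> / \<epsilon>\<^sup>2) * 1"
    using False assms by (intro mult_mono divide_right_mono) auto
  finally show ?thesis using assms by (simp add: power2_eq_square)
qed

text \<open>Times the normal density, the integrand is the derivative of x \<phi>(x) u(x), which
  vanishes at both ends. The additional factor x is what produces a second moment.\<close>

lemma integral_std_normal_parts:
  fixes u u' :: "real \<Rightarrow> real"
  assumes u: "\<And>x. (u has_real_derivative u' x) (at x)" "\<And>x. isCont u' x"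
    and bound: "\<And>x. \<bar>u x\<bar> \<le> B" "\<And>x. \<bar>x * u' x\<bar> \<le> B"
  shows "(\<integral>x. u x + x * u' x - x\<^sup>2 * u x \<partial>std_normal) = 0"
proof -
  let ?\<phi> = std_normal_density
  let ?F = "\<lambda>x. x * ?\<phi> x * u x"
  let ?f = "\<lambda>x. ?\<phi> x * (u x + x * u' x - x\<^sup>2 * u x)"
  have B: "B \<ge> 0" using bound(1)[of 0] by linarith
  have cu: "isCont u x" for x using u(1) DERIV_isCont by blast
  have [measurable]: "u \<in> borel_measurable borel" "u' \<in> borel_measurable borel"
    using u(2) cu by (auto intro!: borel_measurable_continuous_onI simp: continuous_at_imp_continuous_on)
  have d\<phi>: "(?\<phi> has_real_derivative - x * ?\<phi> x) (at x)" for x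
    unfolding std_normal_density_def by (auto intro!: derivative_eq_intros simp: field_simps)
  have c\<phi>: "isCont ?\<phi> x" for x using d\<phi> DERIV_isCont by blast
  have dF: "(?F has_real_derivative ?f x) (at x)" for x
    by (auto intro!: derivative_eq_intros d\<phi> u simp: algebra_simps power2_eq_square)
  have cf: "isCont ?f x" for x
    by (intro continuous_intros cu u(2) c\<phi>)
  have int: "integrable lborel ?f"
  proof (rule Bochner_Integration.integrable_bound)
    show "integrable lborel (\<lambda>x. 2 * B * ?\<phi> x + B * (?\<phi> x * x ^ 2))"
      by (intro Bochner_Integration.integrable_add integrable_mult_right integrable_std_normal_moment) simp
    show "AE x in lborel. norm (?f x) \<le> norm (2 * B * ?\<phi> x + B * (?\<phi> x * x ^ 2))"
    proof (rule AE_I2)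
      fix x
      have "\<bar>x\<^sup>2 * u x\<bar> \<le> x\<^sup>2 * B" using bound(1)[of x] by (simp add: abs_mult mult_left_mono)
      then have "\<bar>u x + x * u' x - x\<^sup>2 * u x\<bar> \<le> 2 * B + x\<^sup>2 * B"
        using bound(1)[of x] bound(2)[of x] by linarith
      then have "?\<phi> x * \<bar>u x + x * u' x - x\<^sup>2 * u x\<bar> \<le> ?\<phi> x * (2 * B + x\<^sup>2 * B)"
        by (intro mult_left_mono) auto
      moreover have "norm (?f x) = ?\<phi> x * \<bar>u x + x * u' x - x\<^sup>2 * u x\<bar>"
        by (simp only: real_norm_def abs_mult[of "?\<phi> x"]) simp
      moreover have "?\<phi> x * (2 * B + x\<^sup>2 * B) = 2 * B * ?\<phi> x + B * (?\<phi> x * x ^ 2)"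
        by (simp add: algebra_simps)
      ultimately show "norm (?f x) \<le> norm (2 * B * ?\<phi> x + B * (?\<phi> x * x ^ 2))"
        by (metis abs_ge_self order_trans real_norm_def)
    qed
  qed measurable
  have F0: "(?F \<longlongrightarrow> 0) F" if lim: "((\<lambda>x. x * ?\<phi> x) \<longlongrightarrow> 0) F" for F
  proof (rule Lim_null_comparison)
    show "\<forall>\<^sub>F x in F. norm (?F x) \<le> B * norm (x * ?\<phi> x)"
    proof (intro always_eventually allI)
      fix x
      have "norm (?F x) = \<bar>u x\<bar> * norm (x * ?\<phi> x)" by (simp add: abs_mult)
      also have "\<dots> \<le> B * norm (x * ?\<phi> x)" by (intro mult_right_mono bound(1)) auto
      finally show "norm (?F x) \<le> B * norm (x * ?\<phi> x)" .
    qed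
    show "((\<lambda>x. B * norm (x * ?\<phi> x)) \<longlongrightarrow> 0) F"
      using tendsto_mult_right_zero[OF tendsto_norm_zero[OF lim]] .
  qed
  have lim: "((\<lambda>x. x * ?\<phi> x) \<longlongrightarrow> 0) at_infinity"
  proof (rule Lim_null_comparison)
    show "\<forall>\<^sub>F x in at_infinity. norm (x * ?\<phi> x) \<le> 2 * norm (inverse x)"
    proof (intro always_eventually allI)
      fix x :: real
      \<comment> \<open>Any decay suffices here: exp y >= 1 + y already gives a bound of order
        1/\<bar>x\<bar>.\<close>
      have "x\<^sup>2 \<le> 2 * exp (x\<^sup>2 / 2)"
        using exp_ge_add_one_self[of "x\<^sup>2 / 2"] by linarith
      then have "\<bar>x\<bar> * \<bar>x\<bar> \<le> 2 * exp (x\<^sup>2 / 2)"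
        by (simp add: power2_eq_square)
      then have 1: "\<bar>x\<bar> * exp (- (x\<^sup>2 / 2)) \<le> 2 * inverse \<bar>x\<bar>"
        by (cases "x = 0") (auto simp: exp_minus field_simps)
      have "1 \<le> sqrt (2 * pi)" using pi_gt3 by (intro real_le_rsqrt) simp
      then have "1 / sqrt (2 * pi) \<le> 1" by simp
      then have "1 / sqrt (2 * pi) * (\<bar>x\<bar> * exp (- (x\<^sup>2 / 2))) \<le> 1 * (2 * inverse \<bar>x\<bar>)"
        by (intro mult_mono 1) auto
      then show "norm (x * ?\<phi> x) \<le> 2 * norm (inverse x)"
        by (simp add: std_normal_density_def abs_mult)
    qed
    show "((\<lambda>x::real. 2 * norm (inverse x)) \<longlongrightarrow> 0) at_infinity"
      by (intro tendsto_mult_right_zero tendsto_norm_zero tendsto_inverse_0)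
  qed
  have lim1: "((\<lambda>x. x * ?\<phi> x) \<longlongrightarrow> 0) at_top" "((\<lambda>x. x * ?\<phi> x) \<longlongrightarrow> 0) at_bot"
    using tendsto_mono[OF at_top_le_at_infinity lim] tendsto_mono[OF at_bot_le_at_infinity lim] by auto
  have "(LBINT x=-\<infinity>..\<infinity>. ?f x) = 0 - 0"
  proof (rule interval_integral_FTC_integrable)
    show "set_integrable lborel (einterval (-\<infinity>) \<infinity>) ?f"
      using int by (simp add: set_integrable_def einterval_eq)
    show "((?F \<circ> real_of_ereal) \<longlongrightarrow> 0) (at_right (-\<infinity>))" "((?F \<circ> real_of_ereal) \<longlongrightarrow> 0) (at_left \<infinity>)"
      using F0 lim1 by (simp_all add: ereal_tendsto_simps)
  qed (use dF cf in \<open>auto simp flip: has_real_derivative_iff_has_vector_derivative\<close>)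
  then have "(\<integral>x. ?f x \<partial>lborel) = 0"
    by (simp add: interval_lebesgue_integral_def set_lebesgue_integral_def einterval_eq)
  then show ?thesis
    by (subst integral_density) auto
qed


text \<open>
  The Gibbs weight as a function of one coordinate \<open>x\<close>, the others being fixed: \<open>a\<close> and \<open>b\<close> are the
  contributions of the other coordinates to \<open>\<Sum>i. \<gamma> i * (g i)\<^sup>2\<close> and to \<open>\<Sum>i. (g i)\<^sup>2\<close>.
\<close>

locale coordinate_weight =
  fixes a b c y \<kappa> v \<epsilon> :: real
  assumes b: "b > 0" and a: "0 \<le> a" "a \<le> c * b" and y: "0 \<le> y" "y \<le> c" and \<epsilon>: "\<epsilon> > 0"
begin

text \<open>\<eta> is the energy per dimension along the coordinate, \<open>u\<close> the Gibbs
  weight with cutoff relative to the standard normal density; \<kappa> stands for \<theta> times the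
  dimension.\<close>

definition \<eta> :: "real \<Rightarrow> real" where "\<eta> x = (a + y * x\<^sup>2) / (b + x\<^sup>2)"
definition \<eta>' :: "real \<Rightarrow> real" where "\<eta>' x = 2 * x * (y - \<eta> x) / (b + x\<^sup>2)"
definition u :: "real \<Rightarrow> real" where "u x = exp (\<kappa> * \<eta> x) * cutoff v \<epsilon> (\<eta> x)"
definition u' :: "real \<Rightarrow> real" where
  "u' x = exp (\<kappa> * \<eta> x) * (\<kappa> * cutoff v \<epsilon> (\<eta> x) + cutoff_deriv v \<epsilon> (\<eta> x)) * \<eta>' x"

lemma denominator_pos: "b + x\<^sup>2 > 0"
  using b by (simp add: add_pos_nonneg)

lemma c_nonneg: "c \<ge> 0"
  using y by linarith

lemma \<eta>_bounds: "0 \<le> \<eta> x" "\<eta> x \<le> c"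
proof -
  show "0 \<le> \<eta> x" unfolding \<eta>_def using a y denominator_pos[of x] by simp
  have "y * x\<^sup>2 \<le> c * x\<^sup>2" using y by (intro mult_right_mono) auto
  then have "a + y * x\<^sup>2 \<le> c * (b + x\<^sup>2)" using a by (simp add: algebra_simps)
  then show "\<eta> x \<le> c" unfolding \<eta>_def using denominator_pos[of x] by (simp add: divide_simps)
qed

lemma abs_y_minus_\<eta>: "\<bar>y - \<eta> x\<bar> \<le> c"
  using \<eta>_bounds[of x] y by linarith

lemma DERIV_\<eta>: "(\<eta> has_real_derivative \<eta>' x) (at x)"
proof -
  have "((\<lambda>x. a + y * x\<^sup>2) has_real_derivative 2 * y * x) (at x)"
    "((\<lambda>x. b + x\<^sup>2) has_real_derivative 2 * x) (at x)"
    by (auto intro!: derivative_eq_intros)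
  from DERIV_divide[OF this] denominator_pos[of x]
  have "((\<lambda>x. (a + y * x\<^sup>2) / (b + x\<^sup>2)) has_real_derivative
     (2 * y * x * (b + x\<^sup>2) - (a + y * x\<^sup>2) * (2 * x)) / ((b + x\<^sup>2) * (b + x\<^sup>2))) (at x)" by simp
  moreover have "(2 * y * x * (b + x\<^sup>2) - (a + y * x\<^sup>2) * (2 * x)) / ((b + x\<^sup>2) * (b + x\<^sup>2)) = \<eta>' x"
    using denominator_pos[of x] by (simp add: \<eta>'_def \<eta>_def field_simps)
  ultimately show ?thesis by (simp add: \<eta>_def[abs_def])
qed

lemma isCont_\<eta>: "isCont \<eta> x"
  using DERIV_\<eta> DERIV_isCont by blast

lemma DERIV_u: "(u has_real_derivative u' x) (at x)"
proof -
  have 1: "((\<lambda>x. cutoff v \<epsilon> (\<eta> x)) has_real_derivative cutoff_deriv v \<epsilon> (\<eta> x) * \<eta>' x) (at x)"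
    by (rule DERIV_chain2[OF DERIV_cutoff[OF \<epsilon>] DERIV_\<eta>])
  have 2: "((\<lambda>x. exp (\<kappa> * \<eta> x)) has_real_derivative exp (\<kappa> * \<eta> x) * (\<kappa> * \<eta>' x)) (at x)"
    by (rule DERIV_chain2[OF DERIV_exp DERIV_cmult[OF DERIV_\<eta>]])
  show ?thesis
    unfolding u_def[abs_def]
    by (rule DERIV_cong[OF DERIV_mult[OF 2 1]]) (simp add: u'_def algebra_simps)
qed

lemma isCont_u: "isCont u x"
  using DERIV_u DERIV_isCont by blast

lemma isCont_u': "isCont u' x"
proof -
  have 1: "isCont (\<lambda>x. cutoff v \<epsilon> (\<eta> x)) x" by (rule isCont_o2[OF isCont_\<eta> isCont_cutoff[OF \<epsilon>]])
  have 2: "isCont (\<lambda>x. cutoff_deriv v \<epsilon> (\<eta> x)) x" by (rule isCont_o2[OF isCont_\<eta> isCont_cutoff_deriv[OF \<epsilon>]])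
  have 3: "isCont \<eta>' x" unfolding \<eta>'_def[abs_def]
    using denominator_pos[of x] by (intro continuous_intros isCont_\<eta>) auto
  show ?thesis unfolding u'_def[abs_def]
    by (intro continuous_intros 1 2 3 isCont_\<eta>)
qed

lemma exp_\<kappa>\<eta>_le: "exp (\<kappa> * \<eta> x) \<le> exp (\<bar>\<kappa>\<bar> * c)"
proof -
  have "\<kappa> * \<eta> x \<le> \<bar>\<kappa>\<bar> * \<eta> x" using \<eta>_bounds[of x] by (intro mult_right_mono) auto
  also have "\<dots> \<le> \<bar>\<kappa>\<bar> * c" using \<eta>_bounds[of x] by (intro mult_left_mono) auto
  finally show ?thesis by simp
qed

lemma u_nonneg: "0 \<le> u x"
  by (simp add: u_def cutoff_nonneg)

lemma u_le: "u x \<le> exp (\<bar>\<kappa>\<bar> * c)"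
  using mult_mono[OF exp_\<kappa>\<eta>_le cutoff_le_1 _ cutoff_nonneg] by (simp add: u_def)

text \<open>The quotient x^2 / (b + x^2) is the share of this coordinate in the squared norm. In
  this form the term is visibly bounded, and it can be read as a function of the whole
  vector.\<close>

lemma x_times_u':
  "x * u' x = 2 * (x\<^sup>2 / (b + x\<^sup>2)) * (y - \<eta> x) * (exp (\<kappa> * \<eta> x) * (\<kappa> * cutoff v \<epsilon> (\<eta> x) + cutoff_deriv v \<epsilon> (\<eta> x)))"
  by (simp add: u'_def \<eta>'_def power2_eq_square mult_ac)

lemma abs_x_times_u'_le: "\<bar>x * u' x\<bar> \<le> 2 * c * (exp (\<bar>\<kappa>\<bar> * c) * (\<bar>\<kappa>\<bar> + 4 / \<epsilon>))"
proof -
  have 1: "\<bar>2 * (x\<^sup>2 / (b + x\<^sup>2))\<bar> \<le> 2"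
    using b denominator_pos[of x] by (simp add: divide_simps)
  have "\<bar>\<kappa> * cutoff v \<epsilon> (\<eta> x)\<bar> \<le> \<bar>\<kappa>\<bar> * 1"
    unfolding abs_mult using cutoff_le_1 cutoff_nonneg by (intro mult_left_mono) auto
  then have 2: "\<bar>\<kappa> * cutoff v \<epsilon> (\<eta> x) + cutoff_deriv v \<epsilon> (\<eta> x)\<bar> \<le> \<bar>\<kappa>\<bar> + 4 / \<epsilon>"
    using abs_cutoff_deriv_le[OF \<epsilon>, of v "\<eta> x"] by linarith
  have 3: "0 \<le> \<bar>\<kappa>\<bar> + 4 / \<epsilon>" using \<epsilon> by simp
  show ?thesis
    unfolding x_times_u' abs_mult[of _ "_ * (_ + _)"] abs_mult[of _ "y - _"] abs_mult[of "exp _"]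
    using c_nonneg exp_\<kappa>\<eta>_le 3 by (intro mult_mono 1 2 abs_y_minus_\<eta>) auto
qed

lemma integral_second_moment:
  "(\<integral>x. u x - x\<^sup>2 * u x + 2 * (x\<^sup>2 / (b + x\<^sup>2)) * (y - \<eta> x) *
       (exp (\<kappa> * \<eta> x) * (\<kappa> * cutoff v \<epsilon> (\<eta> x) + cutoff_deriv v \<epsilon> (\<eta> x))) \<partial>std_normal) = 0"
proof -
  define B where "B = max (exp (\<bar>\<kappa>\<bar> * c)) (2 * c * (exp (\<bar>\<kappa>\<bar> * c) * (\<bar>\<kappa>\<bar> + 4 / \<epsilon>)))"
  have "(\<integral>x. u x + x * u' x - x\<^sup>2 * u x \<partial>std_normal) = 0"
  proof (rule integral_std_normal_parts)
    show "\<bar>u x\<bar> \<le> B" for x using u_le[of x] u_nonneg[of x] by (simp add: B_def)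
    show "\<bar>x * u' x\<bar> \<le> B" for x using abs_x_times_u'_le[of x] by (simp add: B_def)
  qed (rule DERIV_u isCont_u')+
  then show ?thesis unfolding x_times_u' by (simp add: algebra_simps)
qed

text \<open>With p the weight \<open>u\<close> times the standard normal density, \<open>s\<close>
  is the rate for which p' + s x p vanishes up to the errors n / (b + x^2) - 1 and \<eta> - v, apart
  from the cutoff. The last summand is the derivative of the cutoff: it has no factor
  \<open>n\<close>, so the crude bound 4/\<epsilon> is enough.\<close>

lemma stein_bound:
  assumes \<kappa>: "\<kappa> = \<theta> * n" and s: "s = 1 + 2 * \<theta> * (v - y)" "s > 0"
    and f[measurable]: "f \<in> borel_measurable borel" and M: "\<And>x. \<bar>f x\<bar> \<le> M"
  shows "ennreal \<bar>(\<integral>x. f x * u x \<partial>std_normal)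
        - (\<integral>x. f x * normal_density 0 (sqrt (1 / s)) x \<partial>lborel) * (\<integral>x. u x \<partial>std_normal)\<bar>
     \<le> ennreal (2 * sqrt (2 * pi / s) * M) * (\<integral>\<^sup>+x. ennreal (exp (\<kappa> * \<eta> x) * (\<bar>x\<bar> *
         (2 * \<bar>\<theta>\<bar> * (cutoff v \<epsilon> (\<eta> x) * (c * \<bar>n / (b + x\<^sup>2) - 1\<bar> + \<bar>\<eta> x - v\<bar>)) + 8 * c / \<epsilon> * (1 / (b + x\<^sup>2))))) \<partial>std_normal)"
proof -
  let ?\<phi> = std_normal_density
  define \<sigma> where "\<sigma> = sqrt (1 / s)"
  have \<sigma>: "\<sigma> > 0" "\<sigma>\<^sup>2 = 1 / s" using s(2) by (auto simp: \<sigma>_def)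
  define p where "p = (\<lambda>x. ?\<phi> x * u x)"
  define p' where "p' = (\<lambda>x. ?\<phi> x * (u' x - x * u x))"
  let ?R = "\<lambda>x. exp (\<kappa> * \<eta> x) * (\<bar>x\<bar> *
         (2 * \<bar>\<theta>\<bar> * (cutoff v \<epsilon> (\<eta> x) * (c * \<bar>n / (b + x\<^sup>2) - 1\<bar> + \<bar>\<eta> x - v\<bar>)) + 8 * c / \<epsilon> * (1 / (b + x\<^sup>2))))"
  have M0: "M \<ge> 0" using M[of 0] by linarith
  have meas[measurable]: "u \<in> borel_measurable borel" "\<eta> \<in> borel_measurable borel" "cutoff v \<epsilon> \<in> borel_measurable borel"
    using isCont_u isCont_\<eta> isCont_cutoff[OF \<epsilon>]
    by (auto intro!: borel_measurable_continuous_onI simp: continuous_at_imp_continuous_on)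
  have d\<phi>: "(?\<phi> has_real_derivative - x * ?\<phi> x) (at x)" for x
    unfolding std_normal_density_def by (auto intro!: derivative_eq_intros simp: field_simps)
  have c\<phi>: "isCont ?\<phi> x" for x using d\<phi> DERIV_isCont by blast
  have dp: "(p has_real_derivative p' x) (at x)" for x
    unfolding p_def
    by (rule DERIV_cong[OF DERIV_mult[OF d\<phi> DERIV_u]]) (simp add: p'_def algebra_simps)
  have cp': "isCont p' x" for x
    unfolding p'_def by (intro continuous_intros isCont_u isCont_u' c\<phi>)
  have ip: "integrable lborel p"
  proof (rule Bochner_Integration.integrable_bound)
    show "integrable lborel (\<lambda>x. exp (\<bar>\<kappa>\<bar> * c) * ?\<phi> x)" by simp
    show "AE x in lborel. norm (p x) \<le> norm (exp (\<bar>\<kappa>\<bar> * c) * ?\<phi> x)"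
      using u_le u_nonneg by (intro AE_I2) (auto simp: p_def abs_mult mult.commute intro!: mult_left_mono)
  qed (simp add: p_def)
  have bound: "\<bar>p' x + x * p x / \<sigma>\<^sup>2\<bar> \<le> ?\<phi> x * ?R x" for x
  proof -
    define E X X' r where "E = exp (\<kappa> * \<eta> x)" and "X = cutoff v \<epsilon> (\<eta> x)" and "X' = cutoff_deriv v \<epsilon> (\<eta> x)"
      and "r = 1 / (b + x\<^sup>2)"
    have r: "r > 0" unfolding r_def using denominator_pos[of x] by simp
    have X: "0 \<le> X" "X \<le> 1" "\<bar>X'\<bar> \<le> 4 / \<epsilon>"
      using cutoff_nonneg cutoff_le_1 abs_cutoff_deriv_le[OF \<epsilon>] by (auto simp: X_def X'_def)
    have u'r: "u' x = E * (\<kappa> * X + X') * (2 * x * (y - \<eta> x) * r)" and ur: "u x = E * X"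
      by (simp_all add: u'_def \<eta>'_def u_def E_def X_def X'_def r_def)
    \<comment> \<open>Uses n r (y - \<eta>) + (v - y) = (y - \<eta>)(n r - 1) - (\<eta> - v), which
      separates the error of the radius from the error of the energy.\<close>
    have eq: "p' x + x * p x / \<sigma>\<^sup>2
       = ?\<phi> x * (E * (x * (2 * \<theta> * (X * ((y - \<eta> x) * (n * r - 1) - (\<eta> x - v))) + 2 * (X' * ((y - \<eta> x) * r)))))"
      unfolding p'_def p_def \<sigma>(2) u'r ur by (simp add: s(1) \<kappa> algebra_simps)
    have "\<bar>2 * \<theta> * (X * ((y - \<eta> x) * (n * r - 1) - (\<eta> x - v))) + 2 * (X' * ((y - \<eta> x) * r))\<bar>
       \<le> \<bar>2 * \<theta> * (X * ((y - \<eta> x) * (n * r - 1) - (\<eta> x - v)))\<bar> + \<bar>2 * (X' * ((y - \<eta> x) * r))\<bar>"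
      by (rule abs_triangle_ineq)
    also have "\<dots> \<le> 2 * \<bar>\<theta>\<bar> * (X * (c * \<bar>n * r - 1\<bar> + \<bar>\<eta> x - v\<bar>)) + 8 * c / \<epsilon> * r"
    proof (rule add_mono)
      have "\<bar>(y - \<eta> x) * (n * r - 1)\<bar> \<le> c * \<bar>n * r - 1\<bar>"
        unfolding abs_mult by (intro mult_right_mono abs_y_minus_\<eta>) auto
      then have "\<bar>(y - \<eta> x) * (n * r - 1) - (\<eta> x - v)\<bar> \<le> c * \<bar>n * r - 1\<bar> + \<bar>\<eta> x - v\<bar>"
        by linarith
      then show "\<bar>2 * \<theta> * (X * ((y - \<eta> x) * (n * r - 1) - (\<eta> x - v)))\<bar> \<le> 2 * \<bar>\<theta>\<bar> * (X * (c * \<bar>n * r - 1\<bar> + \<bar>\<eta> x - v\<bar>))"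
        unfolding abs_mult using X by (simp add: mult_left_mono)
      have "\<bar>X' * ((y - \<eta> x) * r)\<bar> \<le> (4 / \<epsilon>) * (c * r)"
        unfolding abs_mult using X r \<epsilon> c_nonneg by (intro mult_mono abs_y_minus_\<eta>) auto
      then show "\<bar>2 * (X' * ((y - \<eta> x) * r))\<bar> \<le> 8 * c / \<epsilon> * r"
        by (simp add: abs_mult)
    qed
    finally have "?\<phi> x * (E * (\<bar>x\<bar> * \<bar>2 * \<theta> * (X * ((y - \<eta> x) * (n * r - 1) - (\<eta> x - v))) + 2 * (X' * ((y - \<eta> x) * r))\<bar>))
       \<le> ?\<phi> x * (E * (\<bar>x\<bar> * (2 * \<bar>\<theta>\<bar> * (X * (c * \<bar>n * r - 1\<bar> + \<bar>\<eta> x - v\<bar>)) + 8 * c / \<epsilon> * r)))"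
      by (intro mult_left_mono) (auto simp: E_def)
    moreover have "E > 0" by (simp add: E_def)
    ultimately show ?thesis
      unfolding eq by (simp add: abs_mult E_def X_def r_def)
  qed
  have R0: "0 \<le> ?R x" for x
    using c_nonneg \<epsilon> denominator_pos[of x] cutoff_nonneg by (intro mult_nonneg_nonneg add_nonneg_nonneg) auto
  have 1: "(\<integral>x. f x * u x \<partial>std_normal) = (\<integral>x. f x * p x \<partial>lborel)" "(\<integral>x. u x \<partial>std_normal) = (\<integral>x. p x \<partial>lborel)"
    by (subst integral_density; simp add: p_def mult_ac)+
  have "ennreal \<bar>(\<integral>x. f x * p x \<partial>lborel) - (\<integral>x. f x * normal_density 0 \<sigma> x \<partial>lborel) * (\<integral>x. p x \<partial>lborel)\<bar>
     \<le> ennreal (2 * sqrt (2 * pi * \<sigma>\<^sup>2) * M) * (\<integral>\<^sup>+x. ennreal \<bar>p' x + x * p x / \<sigma>\<^sup>2\<bar> \<partial>lborel)"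
    by (rule normal_stein_bound[OF \<sigma>(1) dp cp' ip f M])
  also have "\<dots> \<le> ennreal (2 * sqrt (2 * pi * \<sigma>\<^sup>2) * M) * (\<integral>\<^sup>+x. ennreal (?\<phi> x) * ennreal (?R x) \<partial>lborel)"
    using bound by (intro mult_left_mono nn_integral_mono) (auto simp: ennreal_mult'[symmetric] simp del: ennreal_mult' intro!: ennreal_leI)
  also have "(\<integral>\<^sup>+x. ennreal (?\<phi> x) * ennreal (?R x) \<partial>lborel) = (\<integral>\<^sup>+x. ennreal (?R x) \<partial>std_normal)"
    by (rule nn_integral_density[symmetric]) measurable
  finally show ?thesis unfolding 1 \<sigma>_def[symmetric] using \<sigma>(2) by simp
qed

end

section \<open>The Gibbs measure in a fixed dimension\<close>

text \<open>A Bochner integral without integrability is 0, so the bound needs no hypothesis. It is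
  applied to integrals over slices without checking how they depend on the slice.\<close>

lemma ennreal_abs_integral_le:
  fixes f :: "'a \<Rightarrow> real"
  shows "ennreal \<bar>\<integral>x. f x \<partial>M\<bar> \<le> (\<integral>\<^sup>+x. ennreal \<bar>f x\<bar> \<partial>M)"
proof (cases "integrable M f")
  case True
  then show ?thesis using integral_norm_bound_ennreal[of M f] by simp
next
  case False
  then show ?thesis by (simp add: not_integrable_integral_eq)
qed

text \<open>In the degenerate cases, total weight 0 or a product that is not integrable, the left
  side is 0 by the conventions for division and for the integral.\<close>

lemma abs_weighted_mean_le:
  fixes f w :: "'a \<Rightarrow> real"
  assumes f: "\<And>x. \<bar>f x\<bar> \<le> B" and w: "\<And>x. 0 \<le> w x"
  shows "\<bar>1 / (\<integral>x. w x \<partial>M) * (\<integral>x. f x * w x \<partial>M)\<bar> \<le> B"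
proof -
  have B: "0 \<le> B" using f[of undefined] by linarith
  show ?thesis
  proof (cases "(\<integral>x. w x \<partial>M) = 0 \<or> \<not> integrable M (\<lambda>x. f x * w x)")
    case True
    then show ?thesis using B by (auto simp: not_integrable_integral_eq)
  next
    case False
    then have int: "integrable M w" "integrable M (\<lambda>x. f x * w x)"
      using not_integrable_integral_eq by blast+
    have pos: "0 < (\<integral>x. w x \<partial>M)" using False w by (simp add: order_less_le integral_nonneg_AE)
    have "norm (\<integral>x. f x * w x \<partial>M) \<le> (\<integral>x. B * w x \<partial>M)"
    proof (rule order_trans[OF integral_norm_bound], rule integral_mono)
      show "norm (f x * w x) \<le> B * w x" for x
        using mult_right_mono[OF f w] w by (simp add: abs_mult)
    qed (use int in auto)
    then have "\<bar>\<integral>x. f x * w x \<partial>M\<bar> \<le> B * (\<integral>x. w x \<partial>M)" by simp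
    then show ?thesis using pos by (simp add: abs_mult divide_le_eq)
  qed
qed

lemma (in prob_space) abs_integral_le:
  fixes f :: "'a \<Rightarrow> real"
  assumes "\<And>x. \<bar>f x\<bar> \<le> B"
  shows "\<bar>\<integral>x. f x \<partial>M\<bar> \<le> B"
  using abs_weighted_mean_le[where f = f and B = B and w = "\<lambda>_. 1" and M = M] assms by (simp add: prob_space)

lemma sigma_finite_density_normal: "sigma_finite_measure (density lborel (\<lambda>x. ennreal (normal_density \<mu> \<sigma> x)))"
  by (subst sigma_finite_measure.sigma_finite_iff_density_finite[OF lborel.sigma_finite_measure_axioms]) auto

text \<open>Pointwise substitute for Cauchy-Schwarz; the free parameter is later the expected size
  of the error.\<close>

lemma two_mult_le:
  fixes x y t :: real
  assumes t: "t > 0"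
  shows "2 * (x * y) \<le> t * x\<^sup>2 + y\<^sup>2 / t"
proof -
  have "0 \<le> (t * x - y)\<^sup>2 / t" using t by simp
  also have "\<dots> = t * x\<^sup>2 + y\<^sup>2 / t - 2 * (x * y)"
    using t by (simp add: field_simps power2_eq_square)
  finally show ?thesis by simp
qed

text \<open>Three coordinates make the mean of 1/q finite. The condition on \<epsilon> says that on
  the support of the cutoff the deviation of h from \<open>v\<close> costs at most half of
  \<delta>.\<close>

locale gibbs =
  fixes I :: "nat set" and \<gamma> :: "nat \<Rightarrow> real" and c \<theta> v \<delta> \<epsilon> :: real
  assumes I: "finite I" "card I \<ge> 3" and \<gamma>: "\<And>i. i \<in> I \<Longrightarrow> \<gamma> i \<in> {0..c}"
    and \<delta>: "\<delta> > 0" "\<And>y. y \<in> {0..c} \<Longrightarrow> \<delta> \<le> 1 + 2 * \<theta> * (v - y)"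
    and \<epsilon>: "\<epsilon> > 0" "2 * \<bar>\<theta>\<bar> * \<epsilon> \<le> \<delta> / 2"
begin

abbreviation G :: "(nat \<Rightarrow> real) measure" where "G \<equiv> Pi\<^sub>M I (\<lambda>_. std_normal)"

definition q :: "(nat \<Rightarrow> real) \<Rightarrow> real" where "q g = (\<Sum>i\<in>I. (g i)\<^sup>2)"
definition h :: "(nat \<Rightarrow> real) \<Rightarrow> real" where "h g = (\<Sum>i\<in>I. \<gamma> i * (g i)\<^sup>2) / q g"
definition w :: "(nat \<Rightarrow> real) \<Rightarrow> real" where "w g = exp (\<theta> * real (card I) * h g)"
definition X :: "(nat \<Rightarrow> real) \<Rightarrow> real" where "X g = cutoff v \<epsilon> (h g)"
definition Z :: real where "Z = (\<integral>g. w g \<partial>G)"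

sublocale G: prob_space G by (rule prob_space_PiM_std_normal)

lemma I_nonempty: "I \<noteq> {}"
  using I by auto

lemma c_nonneg: "c \<ge> 0"
  using \<gamma> I_nonempty by fastforce

lemma q_nonneg: "q g \<ge> 0"
  unfolding q_def by (intro sum_nonneg) auto

lemma coord_le_q: "i \<in> I \<Longrightarrow> (g i)\<^sup>2 \<le> q g"
  unfolding q_def using I by (intro member_le_sum) auto

lemma coord_over_q: "i \<in> I \<Longrightarrow> 0 \<le> (g i)\<^sup>2 / q g" "i \<in> I \<Longrightarrow> (g i)\<^sup>2 / q g \<le> 1"
  using coord_le_q[of i g] q_nonneg[of g] by (auto simp: divide_le_eq_1)

lemma AE_q_pos: "AE g in G. q g > 0"
  unfolding q_def by (intro AE_sum_squares_pos I I_nonempty)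

lemma measurable_cutoff[measurable]: "cutoff v \<epsilon> \<in> borel_measurable borel"
  using isCont_cutoff[OF \<epsilon>(1)]
  by (auto intro!: borel_measurable_continuous_onI simp: continuous_at_imp_continuous_on)

lemma measurable_cutoff_deriv[measurable]: "cutoff_deriv v \<epsilon> \<in> borel_measurable borel"
  using isCont_cutoff_deriv[OF \<epsilon>(1)]
  by (auto intro!: borel_measurable_continuous_onI simp: continuous_at_imp_continuous_on)

lemma measurable_q[measurable]: "q \<in> borel_measurable G"
  unfolding q_def[abs_def] by measurable

lemma measurable_h[measurable]: "h \<in> borel_measurable G"
  unfolding h_def[abs_def] by measurable

lemma measurable_w[measurable]: "w \<in> borel_measurable G"
  unfolding w_def[abs_def] by measurable

lemma measurable_X[measurable]: "X \<in> borel_measurable G"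
  unfolding X_def[abs_def] by measurable

lemma h_bounds: "0 \<le> h g" "h g \<le> c"
proof -
  show "0 \<le> h g" unfolding h_def using \<gamma> q_nonneg
    by (intro divide_nonneg_nonneg sum_nonneg mult_nonneg_nonneg) auto
  have "(\<Sum>i\<in>I. \<gamma> i * (g i)\<^sup>2) \<le> c * q g"
    unfolding q_def sum_distrib_left using \<gamma> by (intro sum_mono mult_right_mono) auto
  then show "h g \<le> c"
    unfolding h_def using q_nonneg[of g] c_nonneg by (cases "q g = 0") (auto simp: divide_simps)
qed

lemma w_pos: "w g > 0"
  by (simp add: w_def)

lemma w_le: "w g \<le> exp (\<bar>\<theta>\<bar> * real (card I) * c)"
proof -
  have "\<theta> * real (card I) * h g \<le> \<bar>\<theta>\<bar> * real (card I) * c"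
    using h_bounds[of g] by (intro mult_mono) auto
  then show ?thesis by (simp add: w_def)
qed

lemma X_bounds: "0 \<le> X g" "X g \<le> 1"
  by (simp_all add: X_def cutoff_nonneg cutoff_le_1)

lemma integrable_w_bounded:
  assumes [measurable]: "f \<in> borel_measurable G" and B: "\<And>g. g \<in> space G \<Longrightarrow> \<bar>f g\<bar> \<le> B"
  shows "integrable G (\<lambda>g. w g * f g)"
proof (rule G.integrable_const_bound[of _ "exp (\<bar>\<theta>\<bar> * real (card I) * c) * B"])
  show "AE g in G. norm (w g * f g) \<le> exp (\<bar>\<theta>\<bar> * real (card I) * c) * B"
    using w_pos w_le B by (intro AE_I2) (auto simp: abs_mult less_imp_le intro!: mult_mono)
qed measurable

lemma integrable_w: "integrable G w"
  using integrable_w_bounded[of "\<lambda>_. 1" 1] by simp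

lemma Z_pos: "Z > 0"
proof -
  have "0 < exp (- (\<bar>\<theta>\<bar> * real (card I) * c))" by simp
  also have "\<dots> = (\<integral>g. exp (- (\<bar>\<theta>\<bar> * real (card I) * c)) \<partial>G)" by (simp add: G.prob_space)
  also have "\<dots> \<le> Z" unfolding Z_def
  proof (intro integral_mono integrable_w)
    fix g
    have "- \<theta> * real (card I) * h g \<le> \<bar>\<theta>\<bar> * real (card I) * c"
      using h_bounds[of g] by (intro mult_mono) auto
    then show "exp (- (\<bar>\<theta>\<bar> * real (card I) * c)) \<le> w g" by (simp add: w_def)
  qed simp
  finally show ?thesis .
qed

section \<open>Homogeneity of the weight and radial moments\<close>

lemma q_scale: "q (\<lambda>i\<in>I. a * g i) = a\<^sup>2 * q g"
  unfolding q_def sum_distrib_left by (intro sum.cong) (auto simp: power_mult_distrib)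

lemma h_scale:
  assumes "a > 0"
  shows "h (\<lambda>i\<in>I. a * g i) = h g"
proof -
  have "(\<Sum>i\<in>I. \<gamma> i * ((\<lambda>i\<in>I. a * g i) i)\<^sup>2) = a\<^sup>2 * (\<Sum>i\<in>I. \<gamma> i * (g i)\<^sup>2)"
    unfolding sum_distrib_left by (intro sum.cong) (auto simp: power_mult_distrib)
  then show ?thesis unfolding h_def q_scale using assms by simp
qed

lemma w_scale: "a > 0 \<Longrightarrow> w (\<lambda>i\<in>I. a * g i) = w g"
  unfolding w_def h_scale ..

lemma X_scale: "a > 0 \<Longrightarrow> X (\<lambda>i\<in>I. a * g i) = X g"
  unfolding X_def h_scale ..

text \<open>The weight has degree 0, hence leaves the law of the radius as it is under the standard
  Gaussian: the case m = 0 of the radial identity.\<close>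

lemma
  shows integrable_w_over_q: "integrable G (\<lambda>g. w g / q g)"
    and integral_w_over_q: "(\<integral>g. w g / q g \<partial>G) = Z / (real (card I) - 2)"
proof -
  have *: "integrable G (\<lambda>g. w g / q g) \<longleftrightarrow> integrable G w"
    "Z = (real (card I) + 2 * real 0 - 2) * (\<integral>g. w g / q g \<partial>G)"
    using integral_PiM_std_normal_radial[where I = I and m = 0 and F = w] I I_nonempty
    by (simp_all add: Z_def w_pos less_imp_le w_scale flip: q_def)
  then show "integrable G (\<lambda>g. w g / q g)" using integrable_w by simp
  show "(\<integral>g. w g / q g \<partial>G) = Z / (real (card I) - 2)" using * I by (simp add: field_simps)
qed

lemma
  shows integrable_w_times_q: "integrable G (\<lambda>g. w g * q g)"
    and integral_w_times_q: "(\<integral>g. w g * q g \<partial>G) = real (card I) * Z"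
proof -
  have *: "integrable G (\<lambda>g. w g * q g / q g) \<longleftrightarrow> integrable G (\<lambda>g. w g * q g)"
    "(\<integral>g. w g * q g \<partial>G) = (real (card I) + 2 * real 1 - 2) * (\<integral>g. w g * q g / q g \<partial>G)"
    using integral_PiM_std_normal_radial[where I = I and m = 1 and F = "\<lambda>g. w g * q g"] I I_nonempty
    by (simp_all add: w_pos less_imp_le q_nonneg w_scale q_scale mult_ac del: nonzero_mult_div_cancel_right flip: q_def)
  have AE: "AE g in G. w g = w g * q g / q g"
    using AE_q_pos by eventually_elim simp
  have "integrable G (\<lambda>g. w g * q g / q g)"
    by (rule integrable_cong_AE_imp[OF integrable_w _ AE]) measurable
  then show "integrable G (\<lambda>g. w g * q g)" using * by simp
  have "(\<integral>g. w g * q g / q g \<partial>G) = Z"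
    unfolding Z_def using AE by (intro integral_cong_AE[symmetric]) auto
  then show "(\<integral>g. w g * q g \<partial>G) = real (card I) * Z" using * by simp
qed

lemma integrable_w_coord:
  assumes "i \<in> I" and [measurable]: "f \<in> borel_measurable G" and f: "\<And>g. \<bar>f g\<bar> \<le> 1"
  shows "integrable G (\<lambda>g. w g * f g * (g i)\<^sup>2)"
proof (rule Bochner_Integration.integrable_bound[OF integrable_w_times_q])
  show "AE g in G. norm (w g * f g * (g i)\<^sup>2) \<le> norm (w g * q g)"
  proof (rule AE_I2)
    fix g
    have "\<bar>f g\<bar> * (g i)\<^sup>2 \<le> 1 * q g" using f coord_le_q[OF assms(1)] by (intro mult_mono) auto
    then show "norm (w g * f g * (g i)\<^sup>2) \<le> norm (w g * q g)"
      using w_pos[of g] q_nonneg[of g] by (simp add: abs_mult mult.assoc)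
  qed
qed (use assms(1) in measurable)

text \<open>The case m = 1 of the radial identity. It brings the second moment into the form in
  which the coordinate enters the derivative of h.\<close>

lemma integral_coord_over_q:
  assumes i: "i \<in> I"
  shows "(\<integral>g. w g * X g * (g i)\<^sup>2 \<partial>G) = real (card I) * (\<integral>g. w g * X g * (g i)\<^sup>2 / q g \<partial>G)"
proof -
  have "(\<integral>g. w g * X g * (g i)\<^sup>2 \<partial>G) = (real (card I) + 2 * real 1 - 2) * (\<integral>g. w g * X g * (g i)\<^sup>2 / (\<Sum>i\<in>I. (g i)\<^sup>2) \<partial>G)"
    using I I_nonempty i X_bounds
    by (intro integral_PiM_std_normal_radial(2))
       (simp_all add: w_scale X_scale w_pos less_imp_le power_mult_distrib)
  then show ?thesis by (simp add: q_def)
qed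


lemma abs_\<gamma>_minus_h: "i \<in> I \<Longrightarrow> \<bar>\<gamma> i - h g\<bar> \<le> c"
  using h_bounds[of g] \<gamma>[of i] by auto

section \<open>Integration along one coordinate\<close>

definition a_rest :: "nat \<Rightarrow> (nat \<Rightarrow> real) \<Rightarrow> real" where
  "a_rest i x = (\<Sum>j\<in>I - {i}. \<gamma> j * (x j)\<^sup>2)"
definition b_rest :: "nat \<Rightarrow> (nat \<Rightarrow> real) \<Rightarrow> real" where
  "b_rest i x = (\<Sum>j\<in>I - {i}. (x j)\<^sup>2)"

lemma AE_b_rest_pos:
  assumes i: "i \<in> I"
  shows "AE x in Pi\<^sub>M (I - {i}) (\<lambda>_. std_normal). b_rest i x > 0"
proof -
  have "card (I - {i}) \<noteq> 0" using I i by (simp add: card_Diff_singleton)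
  then have "I - {i} \<noteq> {}" by fastforce
  then show ?thesis unfolding b_rest_def using I by (intro AE_sum_squares_pos) auto
qed

lemma coordinate_weight_rest:
  assumes i: "i \<in> I" and "b_rest i x > 0"
  shows "coordinate_weight (a_rest i x) (b_rest i x) c (\<gamma> i) \<epsilon>"
proof
  show "0 \<le> a_rest i x" unfolding a_rest_def using \<gamma> by (intro sum_nonneg mult_nonneg_nonneg) auto
  show "a_rest i x \<le> c * b_rest i x"
    unfolding a_rest_def b_rest_def sum_distrib_left using \<gamma> by (intro sum_mono mult_right_mono) auto
qed (use assms \<gamma>[OF i] \<epsilon> in auto)

lemma q_update:
  assumes i: "i \<in> I"
  shows "q (x(i := t)) = b_rest i x + t\<^sup>2"
proof -
  have "q (x(i := t)) = ((x(i := t)) i)\<^sup>2 + (\<Sum>j\<in>I - {i}. ((x(i := t)) j)\<^sup>2)"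
    unfolding q_def using I i by (simp only: sum.remove)
  also have "(\<Sum>j\<in>I - {i}. ((x(i := t)) j)\<^sup>2) = b_rest i x"
    unfolding b_rest_def by (intro sum.cong) auto
  finally show ?thesis unfolding fun_upd_same by (simp only: add.commute)
qed

lemma h_update:
  assumes i: "i \<in> I" and b: "b_rest i x > 0"
  shows "h (x(i := t)) = coordinate_weight.\<eta> (a_rest i x) (b_rest i x) (\<gamma> i) t"
proof -
  interpret coordinate_weight "a_rest i x" "b_rest i x" c "\<gamma> i" 0 v \<epsilon>
    by (rule coordinate_weight_rest[OF i b])
  have "(\<Sum>j\<in>I. \<gamma> j * ((x(i := t)) j)\<^sup>2) = \<gamma> i * ((x(i := t)) i)\<^sup>2 + (\<Sum>j\<in>I - {i}. \<gamma> j * ((x(i := t)) j)\<^sup>2)"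
    using I i by (simp only: sum.remove)
  also have "(\<Sum>j\<in>I - {i}. \<gamma> j * ((x(i := t)) j)\<^sup>2) = a_rest i x"
    unfolding a_rest_def by (intro sum.cong) auto
  finally show ?thesis unfolding h_def \<eta>_def q_update[OF i] by simp
qed

lemma integral_coordinate:
  fixes f :: "(nat \<Rightarrow> real) \<Rightarrow> real"
  assumes "i \<in> I" "integrable G f"
  shows "(\<integral>g. f g \<partial>G) = (\<integral>x. \<integral>t. f (x(i := t)) \<partial>std_normal \<partial>Pi\<^sub>M (I - {i}) (\<lambda>_. std_normal))"
  using std_normals.product_integral_insert[of "I - {i}" i f] I assms by (simp add: insert_absorb)

lemma nn_integral_coordinate:
  assumes "i \<in> I" "f \<in> borel_measurable G"
  shows "(\<integral>\<^sup>+g. f g \<partial>G) = (\<integral>\<^sup>+x. \<integral>\<^sup>+t. f (x(i := t)) \<partial>std_normal \<partial>Pi\<^sub>M (I - {i}) (\<lambda>_. std_normal))"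
  using std_normals.product_nn_integral_insert[of "I - {i}" i f] I assms by (simp add: insert_absorb)

text \<open>2/\<delta> comes from dividing by the lower bound \<delta>/2; 8c/\<epsilon> is twice
  \<open>c\<close> times the bound 4/\<epsilon> for the derivative of the cutoff.\<close>

definition C0 :: real where "C0 = 2 / \<delta> * (1 + 8 * c / \<epsilon>)"

lemma C0_pos: "C0 > 0"
  unfolding C0_def using \<delta> c_nonneg \<epsilon> by (intro mult_pos_pos add_pos_nonneg) auto

text \<open>
  On the support of the cutoff \<open>1 - 2 * \<theta> * (\<gamma> i - h g)\<close> stays above \<open>\<delta> / 2\<close>, so integration by parts
  in the \<open>i\<close>-th coordinate bounds the second moment uniformly in the dimension.
\<close>

lemma second_moment_le:
  assumes i[measurable]: "i \<in> I"
  shows "real (card I) * (\<integral>g. w g * X g * ((g i)\<^sup>2 / q g) \<partial>G) \<le> C0 * Z"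
proof -
  define n where "n = real (card I)"
  define X' where "X' = (\<lambda>g. cutoff_deriv v \<epsilon> (h g))"
  define P where "P = (\<lambda>g :: nat \<Rightarrow> real. (g i)\<^sup>2 / q g)"
  define T where "T = (\<lambda>g. 2 * P g * (\<gamma> i - h g) * (w g * (\<theta> * n * X g + X' g)))"
  have n: "n \<ge> 3" using I by (simp add: n_def)
  have [measurable]: "X' \<in> borel_measurable G" "P \<in> borel_measurable G"
    unfolding X'_def P_def by measurable
  have P: "0 \<le> P g" "P g \<le> 1" for g unfolding P_def using coord_over_q[OF i] by auto
  have X': "\<bar>X' g\<bar> \<le> 4 / \<epsilon>" for g unfolding X'_def by (rule abs_cutoff_deriv_le[OF \<epsilon>(1)])
  have iT: "integrable G T"
  proof -
    have "integrable G (\<lambda>g. w g * (2 * (P g * ((\<gamma> i - h g) * (\<theta> * n * X g + X' g)))))"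
    proof (rule integrable_w_bounded)
      show "\<bar>2 * (P g * ((\<gamma> i - h g) * (\<theta> * n * X g + X' g)))\<bar> \<le> 2 * (1 * (c * (\<bar>\<theta>\<bar> * n + 4 / \<epsilon>)))" for g
      proof -
        have "\<bar>\<theta> * n * X g\<bar> \<le> \<bar>\<theta>\<bar> * n * 1"
          unfolding abs_mult using X_bounds[of g] n by (intro mult_mono) auto
        then have "\<bar>\<theta> * n * X g + X' g\<bar> \<le> \<bar>\<theta>\<bar> * n + 4 / \<epsilon>" using X'[of g] by linarith
        then show ?thesis
          unfolding abs_mult using P[of g] abs_\<gamma>_minus_h[OF i, of g] c_nonneg by (intro mult_mono) auto
      qed
    qed measurable
    moreover have "T = (\<lambda>g. w g * (2 * (P g * ((\<gamma> i - h g) * (\<theta> * n * X g + X' g)))))"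
      by (simp add: T_def fun_eq_iff algebra_simps)
    ultimately show ?thesis by simp
  qed
  have iX: "integrable G (\<lambda>g. w g * X g)"
    by (rule integrable_w_bounded[of _ 1]) (use X_bounds in auto)
  have iX2: "integrable G (\<lambda>g. w g * X g * (g i)\<^sup>2)"
    by (rule integrable_w_coord[OF i]) (use X_bounds in auto)
  have iP: "integrable G (\<lambda>g. w g * X g * P g)"
  proof -
    have "integrable G (\<lambda>g. w g * (X g * P g))"
      by (rule integrable_w_bounded[of _ 1]) (use X_bounds P in \<open>auto simp: abs_mult intro: mult_le_one\<close>)
    then show ?thesis by (simp add: mult.assoc)
  qed
  have zero: "(\<integral>g. w g * X g - w g * X g * (g i)\<^sup>2 + T g \<partial>G) = 0"
  proof -
    have "(\<integral>g. w g * X g - w g * X g * (g i)\<^sup>2 + T g \<partial>G)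
      = (\<integral>x. \<integral>t. (\<lambda>g. w g * X g - w g * X g * (g i)\<^sup>2 + T g) (x(i := t)) \<partial>std_normal \<partial>Pi\<^sub>M (I - {i}) (\<lambda>_. std_normal))"
      using iX iX2 iT by (intro integral_coordinate i) auto
    also have "\<dots> = 0"
    proof (rule integral_eq_zero_AE)
      show "AE x in Pi\<^sub>M (I - {i}) (\<lambda>_. std_normal).
          (\<integral>t. (\<lambda>g. w g * X g - w g * X g * (g i)\<^sup>2 + T g) (x(i := t)) \<partial>std_normal) = 0"
        using AE_b_rest_pos[OF i]
      proof eventually_elim
        case (elim x)
        interpret coordinate_weight "a_rest i x" "b_rest i x" c "\<gamma> i" "\<theta> * n" v \<epsilon>
          by (rule coordinate_weight_rest[OF i elim])
        have "(\<lambda>t. (\<lambda>g. w g * X g - w g * X g * (g i)\<^sup>2 + T g) (x(i := t))) =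
          (\<lambda>t. u t - t\<^sup>2 * u t + 2 * (t\<^sup>2 / (b_rest i x + t\<^sup>2)) * (\<gamma> i - \<eta> t) *
            (exp (\<theta> * n * \<eta> t) * (\<theta> * n * cutoff v \<epsilon> (\<eta> t) + cutoff_deriv v \<epsilon> (\<eta> t))))"
          by (simp add: T_def P_def X'_def w_def[folded n_def] X_def u_def q_update[OF i] h_update[OF i elim] mult_ac)
        then show ?case using integral_second_moment by simp
      qed
    qed
    finally show ?thesis .
  qed
  define Y where "Y = (\<integral>g. w g * X g * P g \<partial>G)"
  have "(\<integral>g. w g * X g * (g i)\<^sup>2 \<partial>G) = n * Y"
    unfolding Y_def P_def n_def using integral_coord_over_q[OF i] by simp
  \<comment> \<open>Homogeneity turns the second moment into \<open>n * Y\<close>, so integration by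
    parts expresses the mean of \<open>T\<close> by the very quantity \<open>Y\<close> that is to be
    bounded.\<close>
  with zero have TY: "(\<integral>g. T g \<partial>G) = n * Y - (\<integral>g. w g * X g \<partial>G)"
    using iX iX2 iT by simp
  have XZ: "(\<integral>g. w g * X g \<partial>G) \<le> Z"
    unfolding Z_def using X_bounds w_pos by (intro integral_mono iX integrable_w) (simp add: mult_left_le less_imp_le)
  \<comment> \<open>The main part of \<open>T\<close> combines with
    \<open>n * (w g * X g * P g)\<close> to the factor 1 - 2\<theta>(\<gamma> i - h), at least
    \<delta>/2 wherever \<open>X g\<close> is nonzero. The rest of \<open>T\<close>, from the
    derivative of the cutoff, is at most 8c/\<epsilon> times \<open>w g\<close>.\<close>
  have "(\<integral>g. n * (\<delta> / 2) * (w g * X g * P g) \<partial>G) \<le> (\<integral>g. n * (w g * X g * P g) - T g + 8 * c / \<epsilon> * w g \<partial>G)"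
  proof (intro integral_mono)
    fix g
    have 1: "X g * (\<delta> / 2) \<le> X g * (1 - 2 * \<theta> * (\<gamma> i - h g))"
    proof (cases "\<epsilon> \<le> \<bar>h g - v\<bar>")
      case True
      then show ?thesis using cutoff_eq_0[OF \<epsilon>(1) True] by (simp add: X_def)
    next
      case False
      have "\<bar>2 * \<theta> * (h g - v)\<bar> \<le> 2 * \<bar>\<theta>\<bar> * \<epsilon>"
        using False by (simp add: abs_mult mult_left_mono)
      then have "- (\<delta> / 2) \<le> 2 * \<theta> * (h g - v)" using \<epsilon>(2) by linarith
      moreover have "1 - 2 * \<theta> * (\<gamma> i - h g) = 1 + 2 * \<theta> * (v - \<gamma> i) + 2 * \<theta> * (h g - v)"
        by (simp add: algebra_simps)
      ultimately have "\<delta> / 2 \<le> 1 - 2 * \<theta> * (\<gamma> i - h g)" using \<delta>(2)[OF \<gamma>[OF i]] by linarith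
      then show ?thesis using X_bounds by (intro mult_left_mono) auto
    qed
    have "P g * (2 * ((\<gamma> i - h g) * X' g)) \<le> 1 * (2 * (c * (4 / \<epsilon>)))"
    proof -
      have "\<bar>P g * (2 * ((\<gamma> i - h g) * X' g))\<bar> \<le> 1 * (2 * (c * (4 / \<epsilon>)))"
        unfolding abs_mult using P[of g] abs_\<gamma>_minus_h[OF i, of g] c_nonneg X'[of g] by (intro mult_mono) auto
      then show ?thesis by linarith
    qed
    moreover have "n * P g * (X g * (\<delta> / 2)) \<le> n * P g * (X g * (1 - 2 * \<theta> * (\<gamma> i - h g)))"
      using n P[of g] by (intro mult_left_mono[OF 1] mult_nonneg_nonneg) auto
    ultimately have "w g * (n * P g * (X g * (\<delta> / 2))) \<le> w g * (n * P g * (X g * (1 - 2 * \<theta> * (\<gamma> i - h g))) - P g * (2 * ((\<gamma> i - h g) * X' g)) + 2 * (c * (4 / \<epsilon>)))"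
      using w_pos[of g] by (intro mult_left_mono) auto
    then show "n * (\<delta> / 2) * (w g * X g * P g) \<le> n * (w g * X g * P g) - T g + 8 * c / \<epsilon> * w g"
      unfolding T_def by (simp add: algebra_simps)
  qed (use iP iT integrable_w in auto)
  then have "n * (\<delta> / 2) * Y \<le> n * Y - (\<integral>g. T g \<partial>G) + 8 * c / \<epsilon> * Z"
    using iP iT integrable_w by (simp add: Y_def Z_def)
  then have "n * (\<delta> / 2) * Y \<le> (1 + 8 * c / \<epsilon>) * Z"
    using TY XZ by (simp add: algebra_simps)
  then have "2 / \<delta> * (n * (\<delta> / 2) * Y) \<le> 2 / \<delta> * ((1 + 8 * c / \<epsilon>) * Z)"
    using \<delta>(1) by (intro mult_left_mono) auto
  moreover have "2 / \<delta> * (n * (\<delta> / 2) * Y) = n * Y" using \<delta>(1) by simp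
  ultimately show ?thesis unfolding C0_def Y_def n_def P_def by (simp only: mult.assoc)
qed

text \<open>The integrand on the right of \<open>stein_bound\<close>, times the Gibbs weight and
  read as a function of the whole vector.\<close>

definition R :: "nat \<Rightarrow> (nat \<Rightarrow> real) \<Rightarrow> real" where
  "R i g = w g * (\<bar>g i\<bar> * (2 * \<bar>\<theta>\<bar> * (X g * (c * \<bar>real (card I) / q g - 1\<bar> + \<bar>h g - v\<bar>)) + 8 * c / \<epsilon> * (1 / q g)))"

lemma measurable_R[measurable]: "i \<in> I \<Longrightarrow> R i \<in> borel_measurable G"
  unfolding R_def[abs_def] by measurable

lemma R_nonneg: "R i g \<ge> 0"
  unfolding R_def using w_pos[of g] X_bounds[of g] c_nonneg \<epsilon>(1) q_nonneg[of g]
  by (intro mult_nonneg_nonneg add_nonneg_nonneg) auto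

text \<open>The summands belong to the three terms of \<open>R\<close>: error of the radius, error
  of the energy, derivative of the cutoff. C0 enters through the second moment, 6 bounds 2n/(n - 2)
  for n >= 3.\<close>

definition D0 :: real where "D0 = \<bar>\<theta>\<bar> * c * (C0 + 6) + \<bar>\<theta>\<bar> * (C0 + 1) + 16 * c / \<epsilon>"

lemma D0_nonneg: "D0 \<ge> 0"
  unfolding D0_def using C0_pos c_nonneg \<epsilon> by (intro add_nonneg_nonneg mult_nonneg_nonneg) auto

lemma integrable_w_h: "integrable G (\<lambda>g. w g * (h g - v)\<^sup>2)"
proof (rule integrable_w_bounded)
  show "\<bar>(h g - v)\<^sup>2\<bar> \<le> (c + \<bar>v\<bar>)\<^sup>2" for g
  proof -
    have "\<bar>h g - v\<bar> \<le> \<bar>c + \<bar>v\<bar>\<bar>" using h_bounds[of g] c_nonneg by linarith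
    then show ?thesis by (simp add: abs_le_square_iff)
  qed
qed measurable

text \<open>Each product of \<bar>g i\<bar> with an error is split by \<open>two_mult_le\<close>,
  with parameter sqrt n for the radius and the cutoff and with \<open>t\<close> for the energy. The
  square (n - q)^2 / q is left expanded, because the means of w/q, w and w q are known
  exactly.\<close>

lemma R_le:
  assumes "q g > 0" "t > 0" and i: "i \<in> I"
  defines "n \<equiv> real (card I)"
  shows "R i g \<le> \<bar>\<theta>\<bar> * c * (sqrt n * (w g * X g * ((g i)\<^sup>2 / q g)) + (n\<^sup>2 * (w g / q g) - 2 * n * w g + w g * q g) / sqrt n)
      + \<bar>\<theta>\<bar> * (t * (w g * X g * (g i)\<^sup>2) + w g * (h g - v)\<^sup>2 / t) + 4 * c / \<epsilon> * (sqrt n * (w g / q g) + w g / sqrt n)"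
proof -
  have n: "sqrt n > 0" using I by (simp add: n_def)
  note X = X_bounds[of g]
  have 1: "2 * (X g * (\<bar>g i\<bar> * \<bar>n / q g - 1\<bar>)) \<le> sqrt n * (X g * ((g i)\<^sup>2 / q g)) + (n\<^sup>2 * (1 / q g) - 2 * n + q g) / sqrt n"
  proof -
    have "2 * (\<bar>g i\<bar> * \<bar>n / q g - 1\<bar>) = 2 * (\<bar>g i\<bar> * \<bar>n - q g\<bar>) / q g"
    proof -
      have "\<bar>n / q g - 1\<bar> = \<bar>(n - q g) / q g\<bar>" using assms(1) by (simp add: field_simps)
      then show ?thesis using assms(1) by simp
    qed
    also have "\<dots> \<le> (sqrt n * \<bar>g i\<bar>\<^sup>2 + \<bar>n - q g\<bar>\<^sup>2 / sqrt n) / q g"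
      using assms(1) by (intro divide_right_mono two_mult_le n) auto
    also have "\<dots> = sqrt n * ((g i)\<^sup>2 / q g) + (n\<^sup>2 * (1 / q g) - 2 * n + q g) / sqrt n"
      using assms(1) n by (simp add: field_simps power2_eq_square)
    finally have "X g * (2 * (\<bar>g i\<bar> * \<bar>n / q g - 1\<bar>)) \<le> X g * (sqrt n * ((g i)\<^sup>2 / q g) + (n\<^sup>2 * (1 / q g) - 2 * n + q g) / sqrt n)"
      using X by (intro mult_left_mono) auto
    also have "\<dots> \<le> sqrt n * (X g * ((g i)\<^sup>2 / q g)) + (n\<^sup>2 * (1 / q g) - 2 * n + q g) / sqrt n"
    proof -
      have "n\<^sup>2 * (1 / q g) - 2 * n + q g = (n - q g)\<^sup>2 / q g"
        using assms(1) by (simp add: field_simps power2_eq_square)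
      then have "0 \<le> (n\<^sup>2 * (1 / q g) - 2 * n + q g) / sqrt n" using assms(1) n by simp
      then have "X g * ((n\<^sup>2 * (1 / q g) - 2 * n + q g) / sqrt n) \<le> (n\<^sup>2 * (1 / q g) - 2 * n + q g) / sqrt n"
        using X by (intro mult_left_le_one_le) auto
      then show ?thesis by (simp add: distrib_left mult.left_commute)
    qed
    finally show ?thesis by (simp add: mult_ac)
  qed
  have 2: "2 * (X g * (\<bar>g i\<bar> * \<bar>h g - v\<bar>)) \<le> t * (X g * (g i)\<^sup>2) + (h g - v)\<^sup>2 / t"
  proof -
    have "X g * (2 * (\<bar>g i\<bar> * \<bar>h g - v\<bar>)) \<le> X g * (t * \<bar>g i\<bar>\<^sup>2 + \<bar>h g - v\<bar>\<^sup>2 / t)"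
      using X assms by (intro mult_left_mono two_mult_le) auto
    moreover have "X g * ((h g - v)\<^sup>2 / t) \<le> (h g - v)\<^sup>2 / t"
      using X assms by (intro mult_left_le_one_le) auto
    ultimately show ?thesis by (simp add: distrib_left mult_ac)
  qed
  have 3: "2 * (\<bar>g i\<bar> * (1 / q g)) \<le> sqrt n * (1 / q g) + 1 / sqrt n"
  proof -
    have "2 * (1 * \<bar>g i\<bar>) \<le> sqrt n * 1\<^sup>2 + \<bar>g i\<bar>\<^sup>2 / sqrt n" by (rule two_mult_le[OF n])
    also have "\<dots> \<le> sqrt n + q g / sqrt n"
      using coord_le_q[OF i, of g] n by (simp add: divide_right_mono)
    finally have "2 * \<bar>g i\<bar> / q g \<le> (sqrt n + q g / sqrt n) / q g"
      using assms(1) by (intro divide_right_mono) auto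
    then show ?thesis using assms(1) by (simp add: add_divide_distrib)
  qed
  have "R i g = w g * (\<bar>\<theta>\<bar> * c * (2 * (X g * (\<bar>g i\<bar> * \<bar>n / q g - 1\<bar>))) + \<bar>\<theta>\<bar> * (2 * (X g * (\<bar>g i\<bar> * \<bar>h g - v\<bar>)))
      + 4 * c / \<epsilon> * (2 * (\<bar>g i\<bar> * (1 / q g))))"
    unfolding R_def n_def by (simp add: algebra_simps)
  also have "\<dots> \<le> w g * (\<bar>\<theta>\<bar> * c * (sqrt n * (X g * ((g i)\<^sup>2 / q g)) + (n\<^sup>2 * (1 / q g) - 2 * n + q g) / sqrt n)
     + \<bar>\<theta>\<bar> * (t * (X g * (g i)\<^sup>2) + (h g - v)\<^sup>2 / t) + 4 * c / \<epsilon> * (sqrt n * (1 / q g) + 1 / sqrt n))"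
    using w_pos[of g] c_nonneg \<epsilon>(1) by (intro mult_left_mono add_mono 1 2 3) auto
  finally show ?thesis by (simp add: algebra_simps diff_divide_distrib add_divide_distrib)
qed

lemma integral_R_le:
  assumes i: "i \<in> I" and t: "t > 0" "1 / sqrt (real (card I)) \<le> t"
    and a: "(\<integral>g. w g * (h g - v)\<^sup>2 \<partial>G) \<le> t\<^sup>2 * Z"
  shows "(\<integral>\<^sup>+g. ennreal (R i g) \<partial>G) \<le> ennreal (D0 * t * Z)"
proof -
  define n where "n = real (card I)"
  define S where "S = (\<lambda>g. \<bar>\<theta>\<bar> * c * (sqrt n * (w g * X g * ((g i)\<^sup>2 / q g)) + (n\<^sup>2 * (w g / q g) - 2 * n * w g + w g * q g) / sqrt n)
      + \<bar>\<theta>\<bar> * (t * (w g * X g * (g i)\<^sup>2) + w g * (h g - v)\<^sup>2 / t) + 4 * c / \<epsilon> * (sqrt n * (w g / q g) + w g / sqrt n))"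
  define Y where "Y = (\<integral>g. w g * X g * ((g i)\<^sup>2 / q g) \<partial>G)"
  have n: "n \<ge> 3" using I by (simp add: n_def)
  have sn: "sqrt n > 0" "sqrt n * sqrt n = n" using n by auto
  have iP: "integrable G (\<lambda>g. w g * X g * ((g i)\<^sup>2 / q g))"
  proof -
    have [measurable]: "(\<lambda>g. g i) \<in> borel_measurable G" using i by measurable
    have "integrable G (\<lambda>g. w g * (X g * ((g i)\<^sup>2 / q g)))"
    proof (rule integrable_w_bounded[of _ 1])
      show "\<bar>X g * ((g i)\<^sup>2 / q g)\<bar> \<le> 1" for g
        unfolding abs_mult using X_bounds[of g] coord_over_q[OF i, of g] by (intro mult_le_one) auto
    qed measurable
    then show ?thesis by (simp add: mult.assoc)
  qed
  have iX2: "integrable G (\<lambda>g. w g * X g * (g i)\<^sup>2)"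
    by (rule integrable_w_coord[OF i]) (use X_bounds in auto)
  note int = iP iX2 integrable_w integrable_w_over_q integrable_w_times_q integrable_w_h
  \<comment> \<open>Opaque names, so that the integral of \<open>S\<close> is evaluated by linearity
    alone.\<close>
  define A1 A2 A3 A4 A5 where A: "A1 = (\<lambda>g. w g * X g * ((g i)\<^sup>2 / q g))" "A2 = (\<lambda>g. w g * X g * (g i)\<^sup>2)"
    "A3 = (\<lambda>g. w g / q g)" "A4 = (\<lambda>g. w g * q g)" "A5 = (\<lambda>g. w g * (h g - v)\<^sup>2)"
  note int = int[folded A]
  have S: "S = (\<lambda>g. \<bar>\<theta>\<bar> * c * (sqrt n * A1 g + (n\<^sup>2 * A3 g - 2 * n * w g + A4 g) / sqrt n)
      + \<bar>\<theta>\<bar> * (t * A2 g + A5 g / t) + 4 * c / \<epsilon> * (sqrt n * A3 g + w g / sqrt n))"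
    by (simp add: S_def A)
  have iS: "integrable G S" unfolding S using int by simp
  have nY: "n * Y \<le> C0 * Z" unfolding n_def Y_def by (rule second_moment_le[OF i])
  have X2: "(\<integral>g. w g * X g * (g i)\<^sup>2 \<partial>G) = n * Y"
    using integral_coord_over_q[OF i] by (simp add: n_def Y_def)
  have AE: "AE g in G. R i g \<le> S g"
    using AE_q_pos by eventually_elim (simp only: S_def n_def R_le[OF _ t(1) i])
  have "(\<integral>\<^sup>+g. ennreal (R i g) \<partial>G) \<le> (\<integral>\<^sup>+g. ennreal (S g) \<partial>G)"
    using AE by (intro nn_integral_mono_AE) (auto elim!: eventually_mono intro: ennreal_leI)
  also have "\<dots> = ennreal (\<integral>g. S g \<partial>G)"
  proof (rule nn_integral_eq_integral[OF iS])
    show "AE g in G. 0 \<le> S g"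
      using AE by eventually_elim (rule order_trans[OF R_nonneg])
  qed
  also have "(\<integral>g. S g \<partial>G) = \<bar>\<theta>\<bar> * c * (sqrt n * Y + (n\<^sup>2 * (Z / (n - 2)) - 2 * n * Z + n * Z) / sqrt n)
      + \<bar>\<theta>\<bar> * (t * (n * Y) + (\<integral>g. w g * (h g - v)\<^sup>2 \<partial>G) / t) + 4 * c / \<epsilon> * (sqrt n * (Z / (n - 2)) + Z / sqrt n)"
  proof -
    have "(\<integral>g. S g \<partial>G) = \<bar>\<theta>\<bar> * c * (sqrt n * (\<integral>g. A1 g \<partial>G) + (n\<^sup>2 * (\<integral>g. A3 g \<partial>G) - 2 * n * (\<integral>g. w g \<partial>G) + (\<integral>g. A4 g \<partial>G)) / sqrt n)
      + \<bar>\<theta>\<bar> * (t * (\<integral>g. A2 g \<partial>G) + (\<integral>g. A5 g \<partial>G) / t) + 4 * c / \<epsilon> * (sqrt n * (\<integral>g. A3 g \<partial>G) + (\<integral>g. w g \<partial>G) / sqrt n)"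
      unfolding S using int by simp
    moreover have "(\<integral>g. A1 g \<partial>G) = Y" "(\<integral>g. A2 g \<partial>G) = n * Y" "(\<integral>g. A3 g \<partial>G) = Z / (n - 2)"
      "(\<integral>g. w g \<partial>G) = Z" "(\<integral>g. A4 g \<partial>G) = n * Z"
      unfolding A n_def X2[unfolded n_def] integral_w_over_q integral_w_times_q Y_def Z_def by (rule refl)+
    ultimately show ?thesis unfolding A by (simp only:)
  qed
  also have "\<dots> \<le> \<bar>\<theta>\<bar> * c * ((C0 + 6) * (t * Z)) + \<bar>\<theta>\<bar> * ((C0 + 1) * (t * Z)) + 4 * c / \<epsilon> * (4 * (t * Z))"
  proof -
    have tn: "Z / sqrt n \<le> t * Z"
      using mult_right_mono[OF t(2), of Z] Z_pos by (simp add: n_def)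
    have "sqrt n * Y = n * Y / sqrt n" using sn by (simp add: field_simps)
    also have "\<dots> \<le> C0 * Z / sqrt n" using nY sn by (intro divide_right_mono) auto
    finally have 1: "sqrt n * Y \<le> C0 * (Z / sqrt n)" by simp
    \<comment> \<open>The terms of order n cancel: the mean of (n - q)^2 / q stays bounded, and
      division by sqrt n yields the rate of the radius.\<close>
    have "n\<^sup>2 * (Z / (n - 2)) - 2 * n * Z + n * Z = 2 * n / (n - 2) * Z"
      using n by (simp add: field_simps power2_eq_square)
    also have "\<dots> \<le> 6 * Z" using n Z_pos by (intro mult_right_mono) (auto simp: field_simps)
    finally have 2: "(n\<^sup>2 * (Z / (n - 2)) - 2 * n * Z + n * Z) / sqrt n \<le> 6 * (Z / sqrt n)"
      using sn divide_right_mono[of _ "6 * Z" "sqrt n"] by simp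
    have "sqrt n * (Z / (n - 2)) = (n / sqrt n) * (Z / (n - 2))"
      using n by (simp add: real_div_sqrt)
    also have "\<dots> = (n / (n - 2)) * (Z / sqrt n)" by simp
    also have "\<dots> \<le> 3 * (Z / sqrt n)" using n Z_pos by (intro mult_right_mono) (auto simp: field_simps)
    finally have 3: "sqrt n * (Z / (n - 2)) \<le> 3 * (Z / sqrt n)" .
    have "(\<integral>g. w g * (h g - v)\<^sup>2 \<partial>G) / t \<le> t\<^sup>2 * Z / t" using a t by (intro divide_right_mono) auto
    then have 4: "(\<integral>g. w g * (h g - v)\<^sup>2 \<partial>G) / t \<le> t * Z" using t by (simp add: power2_eq_square)
    have 5: "t * (n * Y) \<le> t * (C0 * Z)" using nY t by (intro mult_left_mono) auto
    have 6: "(C0 + 6) * (Z / sqrt n) \<le> (C0 + 6) * (t * Z)" using tn C0_pos by (intro mult_left_mono) auto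
    show ?thesis
    proof (intro add_mono mult_left_mono)
      show "sqrt n * Y + (n\<^sup>2 * (Z / (n - 2)) - 2 * n * Z + n * Z) / sqrt n \<le> (C0 + 6) * (t * Z)"
        using 1 2 6 unfolding distrib_right by linarith
      show "t * (n * Y) + (\<integral>g. w g * (h g - v)\<^sup>2 \<partial>G) / t \<le> (C0 + 1) * (t * Z)"
        using 4 5 by (simp add: algebra_simps)
      show "sqrt n * (Z / (n - 2)) + Z / sqrt n \<le> 4 * (t * Z)"
        using 3 tn by linarith
    qed (use c_nonneg \<epsilon> in auto)
  qed
  also have "\<dots> = D0 * t * Z" by (simp add: D0_def algebra_simps)
  finally show ?thesis by (simp add: ennreal_leI)
qed


section \<open>Replacement of coordinates by independent normal variables\<close>

definition marg :: "nat \<Rightarrow> real measure" where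
  "marg i = density lborel (\<lambda>x. ennreal (normal_density 0 (sqrt (1 / (1 + 2 * \<theta> * (v - \<gamma> i)))) x))"

text \<open>The elementary replacement step. The result stays a function on the full space, so that
  steps can be iterated.\<close>

definition smooth :: "nat \<Rightarrow> ((nat \<Rightarrow> real) \<Rightarrow> real) \<Rightarrow> (nat \<Rightarrow> real) \<Rightarrow> real" where
  "smooth i F g = (\<integral>z. F (g(i := z)) \<partial>marg i)"

lemma inverse_variance_pos: "i \<in> I \<Longrightarrow> 0 < 1 + 2 * \<theta> * (v - \<gamma> i)"
  using \<delta>(1) \<delta>(2)[OF \<gamma>[of i]] by simp

lemma prob_space_marg: "i \<in> I \<Longrightarrow> prob_space (marg i)"
  unfolding marg_def using inverse_variance_pos by (intro prob_space_normal_density) simp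

lemma sets_marg[measurable_cong, simp]: "sets (marg i) = sets borel"
  by (simp add: marg_def)

sublocale marg: product_sigma_finite marg
  unfolding product_sigma_finite_def marg_def by (intro allI sigma_finite_density_normal)

lemma abs_smooth_le: "i \<in> I \<Longrightarrow> (\<And>g. \<bar>F g\<bar> \<le> M) \<Longrightarrow> \<bar>smooth i F g\<bar> \<le> M"
  unfolding smooth_def by (intro prob_space.abs_integral_le prob_space_marg) auto

lemma measurable_smooth:
  assumes i: "i \<in> I" and [measurable]: "F \<in> borel_measurable G"
  shows "smooth i F \<in> borel_measurable G"
proof -
  have "(\<lambda>p. (fst p)(i := snd p)) \<in> measurable (G \<Otimes>\<^sub>M marg i) G"
  proof (rule measurable_fun_upd)
    show "I = I \<union> {i}" using i by auto
    show "snd \<in> measurable (G \<Otimes>\<^sub>M marg i) std_normal"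
      using measurable_snd[of G "marg i"] by (simp cong: measurable_cong_sets)
  qed simp
  then have "(\<lambda>(g, z). F (g(i := z))) \<in> borel_measurable (G \<Otimes>\<^sub>M marg i)"
    unfolding case_prod_unfold by measurable
  then show ?thesis
    unfolding smooth_def[abs_def]
    by (rule sigma_finite_measure.borel_measurable_lebesgue_integral[OF marg.sigma_finite_measures])
qed

lemma integrable_w_X:
  assumes "F \<in> borel_measurable G" "\<And>g. \<bar>F g\<bar> \<le> M"
  shows "integrable G (\<lambda>g. w g * X g * F g)"
proof -
  have "integrable G (\<lambda>g. w g * (X g * F g))"
  proof (rule integrable_w_bounded)
    show "\<bar>X g * F g\<bar> \<le> 1 * M" for g
      unfolding abs_mult using X_bounds[of g] assms(2)[of g] by (intro mult_mono) auto
  qed (use assms in measurable)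
  then show ?thesis by (simp add: mult.assoc)
qed

text \<open>The Stein factor 2 sqrt(2 pi / s), with s replaced by its lower bound \<delta>, times
  the constant of the mean of \<open>R\<close>.\<close>

definition K0 :: real where "K0 = 2 * sqrt (2 * pi / \<delta>) * D0"

lemma K0_nonneg: "K0 \<ge> 0"
  unfolding K0_def using D0_nonneg \<delta>(1) by simp

text \<open>By Fubini the difference is an integral over slices in direction \<open>i\<close>. On
  almost every slice the one-dimensional Stein bound applies, and its right sides reassemble to the
  mean of \<open>R i\<close>.\<close>

lemma smooth_step:
  assumes i: "i \<in> I" and F[measurable]: "F \<in> borel_measurable G" and M: "\<And>g. \<bar>F g\<bar> \<le> M"
    and t: "t > 0" "1 / sqrt (real (card I)) \<le> t" and a: "(\<integral>g. w g * (h g - v)\<^sup>2 \<partial>G) \<le> t\<^sup>2 * Z"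
  shows "\<bar>(\<integral>g. w g * X g * F g \<partial>G) - (\<integral>g. w g * X g * smooth i F g \<partial>G)\<bar> \<le> K0 * M * t * Z"
proof -
  define s where "s = 1 + 2 * \<theta> * (v - \<gamma> i)"
  have s: "s > 0" "\<delta> \<le> s" using inverse_variance_pos[OF i] \<delta>(2)[OF \<gamma>[OF i]] by (auto simp: s_def)
  have M0: "M \<ge> 0" using M[of undefined] by linarith
  define B where "B = 2 * sqrt (2 * pi / s) * M"
  have B: "0 \<le> B" "B \<le> 2 * sqrt (2 * pi / \<delta>) * M"
    unfolding B_def using s \<delta>(1) M0 by (auto intro!: mult_right_mono mult_left_mono divide_left_mono)
  let ?J = "Pi\<^sub>M (I - {i}) (\<lambda>_. std_normal)"
  let ?E = "\<lambda>g. w g * X g * (F g - smooth i F g)"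
  have [measurable]: "smooth i F \<in> borel_measurable G" by (rule measurable_smooth[OF i F])
  note int = integrable_w_X[OF F M] integrable_w_X[OF measurable_smooth[OF i F] abs_smooth_le[OF i M]]
  have iE: "integrable G ?E"
    using Bochner_Integration.integrable_diff[OF int] by (simp add: right_diff_distrib)
  have "ennreal \<bar>\<integral>g. ?E g \<partial>G\<bar> = ennreal \<bar>\<integral>x. \<integral>y. ?E (x(i := y)) \<partial>std_normal \<partial>?J\<bar>"
    using integral_coordinate[OF i iE] by simp
  also have "\<dots> \<le> (\<integral>\<^sup>+x. ennreal \<bar>\<integral>y. ?E (x(i := y)) \<partial>std_normal\<bar> \<partial>?J)"
    by (rule ennreal_abs_integral_le)
  also have "\<dots> \<le> (\<integral>\<^sup>+x. ennreal B * (\<integral>\<^sup>+y. ennreal (R i (x(i := y))) \<partial>std_normal) \<partial>?J)"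
  proof (rule nn_integral_mono_AE)
    show "AE x in ?J. ennreal \<bar>\<integral>y. ?E (x(i := y)) \<partial>std_normal\<bar> \<le> ennreal B * (\<integral>\<^sup>+y. ennreal (R i (x(i := y))) \<partial>std_normal)"
      using AE_b_rest_pos[OF i] AE_space
    proof eventually_elim
      case (elim x)
      interpret coordinate_weight "a_rest i x" "b_rest i x" c "\<gamma> i" "\<theta> * real (card I)" v \<epsilon>
        by (rule coordinate_weight_rest[OF i elim(1)])
      define f where "f = (\<lambda>y. F (x(i := y)))"
      define m where "m = (\<integral>z. f z * normal_density 0 (sqrt (1 / s)) z \<partial>lborel)"
      have [measurable]: "f \<in> borel_measurable borel"
      proof -
        have "(\<lambda>y. x(i := y)) \<in> measurable std_normal G"
          using measurable_component_update[OF elim(2), of i] i by (simp add: insert_absorb)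
        from measurable_compose[OF this F]
        have A: "(\<lambda>y. F (x(i := y))) \<in> borel_measurable std_normal" .
        have eq: "borel_measurable std_normal = (borel_measurable borel :: (real \<Rightarrow> real) set)"
          by (intro measurable_cong_sets) auto
        show ?thesis unfolding f_def eq[symmetric] by (rule A)
      qed
      have u: "w (x(i := y)) * X (x(i := y)) = u y" for y
        by (simp add: w_def X_def u_def h_update[OF i elim(1)])
      \<comment> \<open>The resampled value overwrites the coordinate, so the smoothed function is
        constant along the slice.\<close>
      have sm: "smooth i F (x(i := y)) = m" for y
        unfolding smooth_def marg_def s_def[symmetric] fun_upd_upd f_def[symmetric] m_def
        by (subst integral_density) (auto simp: mult.commute)
      have um[measurable]: "u \<in> borel_measurable borel"
        using isCont_u by (auto intro!: borel_measurable_continuous_onI simp: continuous_at_imp_continuous_on)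
      have iu: "integrable std_normal u"
        by (rule std_normal.integrable_const_bound[of _ "exp (\<bar>\<theta> * real (card I)\<bar> * c)"])
           (use u_le u_nonneg um in auto)
      have ifu: "integrable std_normal (\<lambda>y. f y * u y)"
      proof (rule std_normal.integrable_const_bound[of _ "M * exp (\<bar>\<theta> * real (card I)\<bar> * c)"])
        show "AE y in std_normal. norm (f y * u y) \<le> M * exp (\<bar>\<theta> * real (card I)\<bar> * c)"
        proof (rule AE_I2)
          fix y
          have "\<bar>f y\<bar> * u y \<le> M * exp (\<bar>\<theta> * real (card I)\<bar> * c)"
            unfolding f_def by (intro mult_mono M u_le u_nonneg M0)
          then show "norm (f y * u y) \<le> M * exp (\<bar>\<theta> * real (card I)\<bar> * c)"
            using u_nonneg[of y] by (simp only: real_norm_def abs_mult[of "f y"] abs_of_nonneg)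
        qed
      qed measurable
      have "(\<integral>y. ?E (x(i := y)) \<partial>std_normal) = (\<integral>y. f y * u y - m * u y \<partial>std_normal)"
        unfolding u sm f_def[symmetric] by (simp add: f_def algebra_simps)
      also have "\<dots> = (\<integral>y. f y * u y \<partial>std_normal) - m * (\<integral>y. u y \<partial>std_normal)"
        using iu ifu by simp
      finally have "ennreal \<bar>\<integral>y. ?E (x(i := y)) \<partial>std_normal\<bar> \<le>
        ennreal B * (\<integral>\<^sup>+y. ennreal (exp (\<theta> * real (card I) * \<eta> y) * (\<bar>y\<bar> *
         (2 * \<bar>\<theta>\<bar> * (cutoff v \<epsilon> (\<eta> y) * (c * \<bar>real (card I) / (b_rest i x + y\<^sup>2) - 1\<bar> + \<bar>\<eta> y - v\<bar>)) + 8 * c / \<epsilon> * (1 / (b_rest i x + y\<^sup>2))))) \<partial>std_normal)"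
        unfolding m_def B_def using M by (simp only:) (intro stein_bound s(1), simp_all add: s_def f_def[symmetric], simp add: f_def)
      also have "(\<lambda>y. exp (\<theta> * real (card I) * \<eta> y) * (\<bar>y\<bar> *
         (2 * \<bar>\<theta>\<bar> * (cutoff v \<epsilon> (\<eta> y) * (c * \<bar>real (card I) / (b_rest i x + y\<^sup>2) - 1\<bar> + \<bar>\<eta> y - v\<bar>)) + 8 * c / \<epsilon> * (1 / (b_rest i x + y\<^sup>2)))))
         = (\<lambda>y. R i (x(i := y)))"
        by (simp add: R_def w_def X_def q_update[OF i] h_update[OF i elim(1)])
      finally show ?case .
    qed
  qed
  also have "\<dots> = ennreal B * (\<integral>\<^sup>+x. \<integral>\<^sup>+y. ennreal (R i (x(i := y))) \<partial>std_normal \<partial>?J)"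
  proof (rule nn_integral_cmult)
    have "(\<lambda>p. (fst p)(i := snd p)) \<in> measurable (?J \<Otimes>\<^sub>M std_normal) G"
      using measurable_add_dim[of i "I - {i}" "\<lambda>_. std_normal"] i by (simp add: insert_absorb case_prod_unfold)
    then have "(\<lambda>(x, y). ennreal (R i (x(i := y)))) \<in> borel_measurable (?J \<Otimes>\<^sub>M std_normal)"
      unfolding case_prod_unfold using i by measurable
    then show "(\<lambda>x. \<integral>\<^sup>+y. ennreal (R i (x(i := y))) \<partial>std_normal) \<in> borel_measurable ?J"
      by (rule sigma_finite_measure.borel_measurable_nn_integral[OF std_normal.sigma_finite_measure_axioms])
  qed
  also have "\<dots> = ennreal B * (\<integral>\<^sup>+g. ennreal (R i g) \<partial>G)"
    by (subst nn_integral_coordinate[OF i]) (use i in measurable)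
  also have "\<dots> \<le> ennreal (2 * sqrt (2 * pi / \<delta>) * M) * ennreal (D0 * t * Z)"
    using B by (intro mult_mono integral_R_le i t a ennreal_leI) auto
  also have "\<dots> = ennreal ((2 * sqrt (2 * pi / \<delta>) * M) * (D0 * t * Z))"
    using M0 \<delta>(1) by (intro ennreal_mult'[symmetric]) auto
  also have "(2 * sqrt (2 * pi / \<delta>) * M) * (D0 * t * Z) = K0 * M * t * Z"
    by (simp only: K0_def mult_ac)
  finally have "\<bar>\<integral>g. ?E g \<partial>G\<bar> \<le> K0 * M * t * Z"
    using K0_nonneg M0 t Z_pos by (subst (asm) ennreal_le_iff) auto
  moreover have "(\<integral>g. ?E g \<partial>G) = (\<integral>g. w g * X g * F g \<partial>G) - (\<integral>g. w g * X g * smooth i F g \<partial>G)"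
    using Bochner_Integration.integral_diff[OF int] by (simp add: right_diff_distrib)
  ultimately show ?thesis by simp
qed

text \<open>A single product integral rather than an iteration: when F depends only on the
  coordinates in J, it is directly the integral against the limit law.\<close>

definition smooths :: "nat set \<Rightarrow> ((nat \<Rightarrow> real) \<Rightarrow> real) \<Rightarrow> (nat \<Rightarrow> real) \<Rightarrow> real" where
  "smooths J F g = (\<integral>y. F (\<lambda>l. if l \<in> J then y l else g l) \<partial>Pi\<^sub>M J marg)"

lemma measurable_override:
  assumes "J \<subseteq> I" "g \<in> space G" and F: "F \<in> borel_measurable G"
  shows "(\<lambda>y. F (\<lambda>l. if l \<in> J then y l else g l)) \<in> borel_measurable (Pi\<^sub>M J marg)"
proof -
  have "(\<lambda>y l. if l \<in> J then y l else g l) \<in> measurable (Pi\<^sub>M J marg) G"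
  proof (rule measurable_PiM_single')
    show "(\<lambda>y l. if l \<in> J then y l else g l) \<in> space (Pi\<^sub>M J marg) \<rightarrow> (\<Pi>\<^sub>E i\<in>I. space std_normal)"
      using assms(1,2) by (auto simp: space_PiM PiE_def extensional_def)
    show "(\<lambda>y. if l \<in> J then y l else g l) \<in> measurable (Pi\<^sub>M J marg) std_normal" for l
    proof (cases "l \<in> J")
      case True
      then have "(\<lambda>y. y l) \<in> measurable (Pi\<^sub>M J marg) (marg l)" by (rule measurable_component_singleton)
      with True show ?thesis by (simp cong: measurable_cong_sets)
    qed simp
  qed
  from measurable_compose[OF this F] show ?thesis .
qed

lemma smooths_empty: "smooths {} F = F"
  by (simp add: smooths_def fun_eq_iff PiM_empty lebesgue_integral_count_space_finite)

lemma smooths_insert: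
  assumes J: "finite J" "i \<notin> J" "insert i J \<subseteq> I" and F: "F \<in> borel_measurable G" "\<And>g. \<bar>F g\<bar> \<le> M"
    and g: "g \<in> space G"
  shows "smooths (insert i J) F g = smooths J (smooth i F) g"
proof -
  have J': "j \<in> insert i J \<Longrightarrow> prob_space (marg j)" for j using J(3) prob_space_marg by auto
  interpret P: prob_space "Pi\<^sub>M (insert i J) marg" by (intro prob_space_PiM J')
  let ?H = "\<lambda>y. F (\<lambda>l. if l \<in> insert i J then y l else g l)"
  have int: "integrable (Pi\<^sub>M (insert i J) marg) ?H"
    by (rule P.integrable_const_bound[of _ M]) (use F measurable_override[OF J(3) g F(1)] in auto)
  have upd: "(\<lambda>l. if l \<in> insert i J then (y(i := z)) l else g l) = (\<lambda>l. if l \<in> J then y l else g l)(i := z)" for y z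
    using J(2) by (auto simp: fun_eq_iff)
  have "smooths (insert i J) F g = (\<integral>y. \<integral>z. ?H (y(i := z)) \<partial>marg i \<partial>Pi\<^sub>M J marg)"
    unfolding smooths_def by (rule marg.product_integral_insert[OF J(1,2) int])
  also have "\<dots> = smooths J (smooth i F) g"
    unfolding smooths_def smooth_def upd ..
  finally show ?thesis .
qed

text \<open>Telescoping over J. Smoothing preserves measurability and the bound M, so every step has
  the same cost.\<close>

lemma smooths_bound:
  assumes t: "t > 0" "1 / sqrt (real (card I)) \<le> t" and a: "(\<integral>g. w g * (h g - v)\<^sup>2 \<partial>G) \<le> t\<^sup>2 * Z"
    and J: "finite J" "J \<subseteq> I" and F: "F \<in> borel_measurable G" "\<And>g. \<bar>F g\<bar> \<le> M"
  shows "\<bar>(\<integral>g. w g * X g * F g \<partial>G) - (\<integral>g. w g * X g * smooths J F g \<partial>G)\<bar> \<le> real (card J) * (K0 * M * t * Z)"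
  using J F
proof (induction J arbitrary: F rule: finite_induct)
  case empty
  then show ?case by (simp add: smooths_empty)
next
  case (insert i J)
  have i: "i \<in> I" using insert.prems by auto
  have eq: "(\<integral>g. w g * X g * smooths (insert i J) F g \<partial>G) = (\<integral>g. w g * X g * smooths J (smooth i F) g \<partial>G)"
    using smooths_insert[OF insert.hyps insert.prems]
    by (intro Bochner_Integration.integral_cong) auto
  have "\<bar>(\<integral>g. w g * X g * F g \<partial>G) - (\<integral>g. w g * X g * smooth i F g \<partial>G)\<bar> \<le> K0 * M * t * Z"
    by (rule smooth_step[OF i insert.prems(2,3) t a])
  moreover have "\<bar>(\<integral>g. w g * X g * smooth i F g \<partial>G) - (\<integral>g. w g * X g * smooths J (smooth i F) g \<partial>G)\<bar>
      \<le> real (card J) * (K0 * M * t * Z)"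
    using insert.prems by (intro insert.IH measurable_smooth abs_smooth_le i) auto
  ultimately show ?case
    unfolding eq using insert.hyps by (simp add: distrib_right)
qed

section \<open>Removal of the cutoff\<close>

lemma Z_one_minus_X_le:
  "(\<integral>g. w g * (1 - X g) \<partial>G) \<le> 2 / \<epsilon>\<^sup>2 * (\<integral>g. w g * (h g - v)\<^sup>2 \<partial>G)"
proof -
  have "(\<integral>g. w g * (1 - X g) \<partial>G) \<le> (\<integral>g. 2 / \<epsilon>\<^sup>2 * (w g * (h g - v)\<^sup>2) \<partial>G)"
  proof (rule integral_mono)
    show "integrable G (\<lambda>g. w g * (1 - X g))"
      by (rule integrable_w_bounded[of _ 1]) (use X_bounds in auto)
    show "integrable G (\<lambda>g. 2 / \<epsilon>\<^sup>2 * (w g * (h g - v)\<^sup>2))" using integrable_w_h by simp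
    show "w g * (1 - X g) \<le> 2 / \<epsilon>\<^sup>2 * (w g * (h g - v)\<^sup>2)" for g
      using mult_left_mono[OF one_minus_cutoff_le[of v \<epsilon> "h g"], of "w g"] w_pos[of g]
      by (simp add: X_def power_divide mult_ac)
  qed
  then show ?thesis using integrable_w_h by simp
qed

text \<open>Smoothing in all coordinates \<open>d j\<close> yields the constant \<open>c0\<close>,
  the limit integral; injectivity of \<open>d\<close> makes the reindexed product measure the right
  one. The part of the weight outside the cutoff has mass of order t^2, whence the summand with an
  additional factor t in the constant.\<close>

lemma marginal_bound:
  fixes d :: "nat \<Rightarrow> nat" and k :: nat and f :: "(nat \<Rightarrow> real) \<Rightarrow> real"
  assumes d: "inj_on d {1..k}" "d ` {1..k} \<subseteq> I"
    and f: "f \<in> borel_measurable (Pi\<^sub>M {1..k} (\<lambda>_. borel))" "\<And>x. x \<in> ({1..k} \<rightarrow>\<^sub>E UNIV) \<Longrightarrow> \<bar>f x\<bar> \<le> M"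
    and t: "t > 0" "1 / sqrt (real (card I)) \<le> t" and a: "(\<integral>g. w g * (h g - v)\<^sup>2 \<partial>G) \<le> t\<^sup>2 * Z"
  shows "\<bar>(1 / Z) * (\<integral>g. f (\<lambda>j\<in>{1..k}. g (d j)) * w g \<partial>G) - (\<integral>x. f x \<partial>Pi\<^sub>M {1..k} (\<lambda>j. marg (d j)))\<bar>
     \<le> (4 / \<epsilon>\<^sup>2 * t + real k * K0) * M * t"
proof -
  define F where "F = (\<lambda>g. f (\<lambda>j\<in>{1..k}. g (d j)))"
  define c0 where "c0 = (\<integral>x. f x \<partial>Pi\<^sub>M {1..k} (\<lambda>j. marg (d j)))"
  define J where "J = d ` {1..k}"
  have dI: "d j \<in> I" if "j \<in> {1..k}" for j using d that by auto
  have FM: "\<bar>F g\<bar> \<le> M" for g unfolding F_def by (intro f(2)) auto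
  have M0: "M \<ge> 0" using FM[of undefined] by linarith
  have F[measurable]: "F \<in> borel_measurable G"
  proof -
    have "(\<lambda>g. \<lambda>j\<in>{1..k}. g (d j)) \<in> measurable G (Pi\<^sub>M {1..k} (\<lambda>_. borel))"
    proof (rule measurable_restrict)
      fix j assume "j \<in> {1..k}"
      then have "(\<lambda>g. g (d j)) \<in> measurable G std_normal" using dI by (intro measurable_component_singleton) auto
      then show "(\<lambda>g. g (d j)) \<in> borel_measurable G" by (simp cong: measurable_cong_sets)
    qed
    from measurable_compose[OF this f(1)] show ?thesis by (simp add: F_def)
  qed
  have const: "smooths J F g = c0" for g
  proof -
    have "c0 = (\<integral>x. f x \<partial>distr (Pi\<^sub>M J marg) (Pi\<^sub>M {1..k} (\<lambda>j. marg (d j))) (\<lambda>\<omega>. \<lambda>j\<in>{1..k}. \<omega> (d j)))"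
      unfolding c0_def using d prob_space_marg dI
      by (subst distr_PiM_reindex) (auto simp: J_def)
    also have "\<dots> = (\<integral>\<omega>. f (\<lambda>j\<in>{1..k}. \<omega> (d j)) \<partial>Pi\<^sub>M J marg)"
    proof (rule integral_distr)
      show "(\<lambda>\<omega>. \<lambda>j\<in>{1..k}. \<omega> (d j)) \<in> measurable (Pi\<^sub>M J marg) (Pi\<^sub>M {1..k} (\<lambda>j. marg (d j)))"
        unfolding J_def by (intro measurable_restrict measurable_component_singleton) auto
      have "sets (Pi\<^sub>M {1..k} (\<lambda>j. marg (d j))) = sets (Pi\<^sub>M {1..k} (\<lambda>_. borel))"
        by (intro sets_PiM_cong) auto
      then show "f \<in> borel_measurable (Pi\<^sub>M {1..k} (\<lambda>j. marg (d j)))"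
        using f(1) by (simp cong: measurable_cong_sets)
    qed
    also have "\<dots> = smooths J F g"
    proof -
      have "(\<lambda>j\<in>{1..k}. \<omega> (d j)) = (\<lambda>j\<in>{1..k}. (\<lambda>l. if l \<in> J then \<omega> l else g l) (d j))" for \<omega> :: "nat \<Rightarrow> real"
        by (auto simp: J_def fun_eq_iff)
      then show ?thesis unfolding smooths_def F_def by simp
    qed
    finally show ?thesis ..
  qed
  have c0: "\<bar>c0\<bar> \<le> M"
  proof -
    have "\<bar>smooths J F undefined\<bar> \<le> M" unfolding smooths_def
      using dI by (intro prob_space.abs_integral_le prob_space_PiM prob_space_marg FM) (auto simp: J_def)
    then show ?thesis using const by simp
  qed
  have iF: "integrable G (\<lambda>g. w g * X g * F g)" "integrable G (\<lambda>g. w g * F g)"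
    using integrable_w_X[OF F FM] integrable_w_bounded[OF F FM] by auto
  have iX: "integrable G (\<lambda>g. w g * X g)"
    by (rule integrable_w_bounded[of _ 1]) (use X_bounds in auto)
  have "card J = k" unfolding J_def using d(1) by (simp add: card_image)
  then have 1: "\<bar>(\<integral>g. w g * X g * F g \<partial>G) - c0 * (\<integral>g. w g * X g \<partial>G)\<bar> \<le> real k * (K0 * M * t * Z)"
    using smooths_bound[OF t a _ _ F FM, of J] d(2) unfolding const by (simp add: J_def mult.commute)
  \<comment> \<open>The contribution of the weight that the cutoff removes. Subtracting
    \<open>c0\<close> inside the integral makes the cutoff part comparable without normalising
    \<open>w g * X g\<close>.\<close>
  define E where "E = (\<integral>g. w g * (1 - X g) * (F g - c0) \<partial>G)"
  have i1: "integrable G (\<lambda>g. w g * (1 - X g))"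
    using integrable_w iX by (simp add: right_diff_distrib)
  have i2: "integrable G (\<lambda>g. w g * (1 - X g) * (F g - c0))"
    using iF iX integrable_w by (simp add: algebra_simps)
  have "\<bar>E\<bar> \<le> (\<integral>g. 2 * M * (w g * (1 - X g)) \<partial>G)"
    unfolding E_def real_norm_def[symmetric]
  proof (rule order_trans[OF integral_norm_bound], rule integral_mono)
    fix g
    have "\<bar>F g - c0\<bar> \<le> 2 * M" using FM[of g] c0 by linarith
    then have "(w g * (1 - X g)) * \<bar>F g - c0\<bar> \<le> (w g * (1 - X g)) * (2 * M)"
      using w_pos[of g] X_bounds[of g] by (intro mult_left_mono) auto
    then show "norm (w g * (1 - X g) * (F g - c0)) \<le> 2 * M * (w g * (1 - X g))"
      using w_pos[of g] X_bounds[of g] by (simp add: abs_mult mult_ac)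
  qed (use i1 i2 in auto)
  also have "\<dots> = 2 * M * (\<integral>g. w g * (1 - X g) \<partial>G)" by simp
  also have "\<dots> \<le> 2 * M * (2 / \<epsilon>\<^sup>2 * (t\<^sup>2 * Z))"
    using M0 a by (intro mult_left_mono order_trans[OF Z_one_minus_X_le]) auto
  finally have 2: "\<bar>E\<bar> \<le> 2 * M * (2 / \<epsilon>\<^sup>2 * (t\<^sup>2 * Z))" .
  have E: "E = ((\<integral>g. w g * F g \<partial>G) - c0 * Z) - ((\<integral>g. w g * X g * F g \<partial>G) - c0 * (\<integral>g. w g * X g \<partial>G))"
  proof -
    have "E = (\<integral>g. (w g * F g - c0 * w g) - (w g * X g * F g - c0 * (w g * X g)) \<partial>G)"
      unfolding E_def by (intro Bochner_Integration.integral_cong) (auto simp: algebra_simps)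
    then show ?thesis using iF iX integrable_w by (simp add: Z_def)
  qed
  have "\<bar>(\<integral>g. w g * F g \<partial>G) - c0 * Z\<bar> \<le> 2 * M * (2 / \<epsilon>\<^sup>2 * (t\<^sup>2 * Z)) + real k * (K0 * M * t * Z)"
    using 1 2 E by linarith
  also have "\<dots> = Z * ((4 / \<epsilon>\<^sup>2 * t + real k * K0) * M * t)"
    by (simp add: algebra_simps power2_eq_square)
  finally have "\<bar>(\<integral>g. w g * F g \<partial>G) - c0 * Z\<bar> / Z \<le> (4 / \<epsilon>\<^sup>2 * t + real k * K0) * M * t"
    using Z_pos by (simp add: divide_le_eq mult.commute)
  moreover have "(1 / Z) * (\<integral>g. w g * F g \<partial>G) - c0 = ((\<integral>g. w g * F g \<partial>G) - c0 * Z) / Z"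
    using Z_pos by (simp add: field_simps)
  ultimately show ?thesis
    using Z_pos unfolding F_def c0_def by (simp add: abs_divide mult.commute[of "w _"])
qed

end

section \<open>The marginals of the Gibbs measure\<close>

lemma hamiltonian_bound:
  assumes "N \<ge> 1" "\<And>i. i \<in> {1..N} \<Longrightarrow> \<gamma> N i \<in> {0..c}" "c > 0"
  shows "0 \<le> hamiltonian \<gamma> N g / real N" "hamiltonian \<gamma> N g / real N \<le> c"
proof -
  define q where "q = (\<Sum>i=1..N. (g i)\<^sup>2)"
  have q: "(L2_set g {1..N})\<^sup>2 = q" "q \<ge> 0" by (simp_all add: q_def L2_set_def sum_nonneg)
  have eq: "hamiltonian \<gamma> N g / real N = (\<Sum>i=1..N. \<gamma> N i * (g i)\<^sup>2) / q"
    unfolding hamiltonian_def q(1) using assms(1) by (simp add: sum_divide_distrib)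
  have "(\<Sum>i=1..N. \<gamma> N i * (g i)\<^sup>2) \<le> c * q"
    unfolding q_def sum_distrib_left using assms(2) by (intro sum_mono mult_right_mono) auto
  then show "hamiltonian \<gamma> N g / real N \<le> c"
    unfolding eq using q(2) assms(3) by (cases "q = 0") (auto simp: divide_simps)
  show "0 \<le> hamiltonian \<gamma> N g / real N"
    unfolding eq using q(2) assms(2) by (intro divide_nonneg_nonneg sum_nonneg mult_nonneg_nonneg) auto
qed

lemma a_rate_bounds:
  assumes "N \<ge> 1" "\<And>i. i \<in> {1..N} \<Longrightarrow> \<gamma> N i \<in> {0..c}" "c > 0"
  shows "0 \<le> a_rate \<gamma> c \<rho> \<theta> N" "a_rate \<gamma> c \<rho> \<theta> N \<le> (c + \<bar>v_lim c \<rho> \<theta>\<bar>)\<^sup>2"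
proof -
  let ?v = "v_lim c \<rho> \<theta>"
  show "0 \<le> a_rate \<gamma> c \<rho> \<theta> N"
    unfolding a_rate_def gibbs_mean_def partition_fun_def
    by (intro mult_nonneg_nonneg divide_nonneg_nonneg integral_nonneg_AE) auto
  have le: "\<bar>(hamiltonian \<gamma> N g / real N - ?v)\<^sup>2\<bar> \<le> (c + \<bar>?v\<bar>)\<^sup>2" for g
  proof -
    have "\<bar>hamiltonian \<gamma> N g / real N - ?v\<bar> \<le> \<bar>c + \<bar>?v\<bar>\<bar>"
      using hamiltonian_bound[where N = N and \<gamma> = \<gamma> and c = c and g = g, OF assms] by linarith
    then show ?thesis by (simp add: abs_le_square_iff)
  qed
  have "\<bar>a_rate \<gamma> c \<rho> \<theta> N\<bar> \<le> (c + \<bar>?v\<bar>)\<^sup>2"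
    unfolding a_rate_def gibbs_mean_def partition_fun_def by (rule abs_weighted_mean_le[OF le]) simp
  then show "a_rate \<gamma> c \<rho> \<theta> N \<le> (c + \<bar>?v\<bar>)\<^sup>2" by linarith
qed

text \<open>Translates the locale into the model. The choice t = \<open>a_tilde\<close> satisfies
  both demands of \<open>marginal_bound\<close>, since each of its two summands is at most
  t.\<close>

lemma (in gibbs) gibbs_mean_bound:
  fixes d :: "nat \<Rightarrow> nat" and k N :: nat and f :: "(nat \<Rightarrow> real) \<Rightarrow> real"
  assumes I_eq: "I = {1..N}" and \<Gamma>: "\<gamma> = \<Gamma> N" and v: "v = v_lim c \<rho> \<theta>" and c: "c > 0"
    and d: "inj_on d {1..k}" "d ` {1..k} \<subseteq> {1..N}"
    and f: "f \<in> borel_measurable (Pi\<^sub>M {1..k} (\<lambda>_. borel))" "\<And>x. x \<in> ({1..k} \<rightarrow>\<^sub>E UNIV) \<Longrightarrow> \<bar>f x\<bar> \<le> M"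
  shows "\<bar>gibbs_mean \<Gamma> \<theta> N (\<lambda>g. f (\<lambda>j\<in>{1..k}. g (d j)))
        - (\<integral>x. f x \<partial>Pi\<^sub>M {1..k} (\<lambda>j. limit_marginal c \<rho> \<theta> (\<Gamma> N (d j))))\<bar>
     \<le> (4 / \<epsilon>\<^sup>2 * (1 + c + \<bar>v\<bar>) + real k * K0) * M * a_tilde \<Gamma> c \<rho> \<theta> N"
proof -
  define a t where "a = a_rate \<Gamma> c \<rho> \<theta> N" and "t = a_tilde \<Gamma> c \<rho> \<theta> N"
  have N: "N \<ge> 3" "card I = N" using I by (auto simp: I_eq)
  have M0: "M \<ge> 0" using f(2)[of "\<lambda>j\<in>{1..k}. 0"] by fastforce
  have ham: "hamiltonian \<Gamma> N g = real (card I) * h g" for g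
  proof -
    have "(L2_set g I)\<^sup>2 = q g" by (simp add: q_def L2_set_def sum_nonneg)
    then show ?thesis
      unfolding hamiltonian_def h_def I_eq[symmetric] \<Gamma>[symmetric] N(2) by (simp add: sum_divide_distrib)
  qed
  have w: "exp (\<theta> * hamiltonian \<Gamma> N g) = w g" for g by (simp add: ham w_def)
  have Z: "partition_fun \<Gamma> \<theta> N = Z"
    unfolding partition_fun_def Z_def w std_gaussian_def I_eq[symmetric] ..
  have mean: "gibbs_mean \<Gamma> \<theta> N F = 1 / Z * (\<integral>g. F g * w g \<partial>G)" for F
    unfolding gibbs_mean_def Z w std_gaussian_def I_eq[symmetric] ..
  have a: "0 \<le> a" "a \<le> (c + \<bar>v\<bar>)\<^sup>2"
    using a_rate_bounds[of N \<Gamma> c \<rho> \<theta>] N c \<gamma> unfolding a_def v \<Gamma> I_eq by auto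
  have "a = 1 / Z * (\<integral>g. (h g - v)\<^sup>2 * w g \<partial>G)"
    unfolding a_def a_rate_def mean using N by (simp add: ham v)
  then have aZ: "(\<integral>g. w g * (h g - v)\<^sup>2 \<partial>G) = a * Z"
    using Z_pos by (simp add: mult.commute)
  have t_def': "t = 1 / sqrt (real N) + sqrt a" by (simp add: t_def a_def a_tilde_def)
  have t: "t > 0" "1 / sqrt (real (card I)) \<le> t" using N a by (auto simp: t_def' intro: add_pos_nonneg)
  \<comment> \<open>An a priori bound for t, used to absorb one factor of the t^2 from the removed
    mass into the constant.\<close>
  have "sqrt a \<le> c + \<bar>v\<bar>" using a c by (intro real_le_lsqrt) auto
  moreover have "1 / sqrt (real N) \<le> 1" using N by simp
  ultimately have t1: "t \<le> 1 + c + \<bar>v\<bar>" by (simp add: t_def')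
  have "a \<le> t\<^sup>2"
  proof -
    have "(sqrt a)\<^sup>2 \<le> t\<^sup>2" using a by (intro power_mono) (auto simp: t_def')
    then show ?thesis using a by simp
  qed
  then have at: "(\<integral>g. w g * (h g - v)\<^sup>2 \<partial>G) \<le> t\<^sup>2 * Z"
    unfolding aZ using Z_pos by (intro mult_right_mono) auto
  have marg: "limit_marginal c \<rho> \<theta> (\<Gamma> N i) = marg i" for i
    unfolding limit_marginal_def limit_variance_def marg_def v[symmetric] \<Gamma>[symmetric] ..
  have "\<bar>gibbs_mean \<Gamma> \<theta> N (\<lambda>g. f (\<lambda>j\<in>{1..k}. g (d j)))
        - (\<integral>x. f x \<partial>Pi\<^sub>M {1..k} (\<lambda>j. limit_marginal c \<rho> \<theta> (\<Gamma> N (d j))))\<bar>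
      \<le> (4 / \<epsilon>\<^sup>2 * t + real k * K0) * M * t"
    unfolding mean marg by (rule marginal_bound[OF d(1) _ f t at]) (use d I_eq in auto)
  also have "\<dots> \<le> (4 / \<epsilon>\<^sup>2 * (1 + c + \<bar>v\<bar>) + real k * K0) * M * t"
    using t1 t(1) M0 by (intro mult_right_mono add_right_mono mult_left_mono) auto
  finally show ?thesis by (simp add: t_def)
qed

text \<open>In dimensions 1 and 2 there is no smallness to prove: the rate is at least 1 / sqrt 2 >
  1/2, so 4 M times the rate exceeds the trivial bound 2 M.\<close>

lemma gibbs_mean_trivial_bound:
  fixes f :: "(nat \<Rightarrow> real) \<Rightarrow> real"
  assumes N: "N \<ge> 1" "N \<le> 2" and \<gamma>: "\<And>i. i \<in> {1..N} \<Longrightarrow> \<gamma> N i \<in> {0..c}" "c > 0"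
    and var: "\<And>y. y \<in> {0..c} \<Longrightarrow> 0 < 1 + 2 * \<theta> * (v_lim c \<rho> \<theta> - y)"
    and d: "d ` {1..k} \<subseteq> {1..N}"
    and f: "f \<in> borel_measurable (Pi\<^sub>M {1..k} (\<lambda>_. borel))" "\<And>x. x \<in> ({1..k} \<rightarrow>\<^sub>E UNIV) \<Longrightarrow> \<bar>f x\<bar> \<le> M"
  shows "\<bar>gibbs_mean \<gamma> \<theta> N (\<lambda>g. f (\<lambda>j\<in>{1..k}. g (d j)))
        - (\<integral>x. f x \<partial>Pi\<^sub>M {1..k} (\<lambda>j. limit_marginal c \<rho> \<theta> (\<gamma> N (d j))))\<bar>
     \<le> 4 * M * a_tilde \<gamma> c \<rho> \<theta> N"
proof -
  let ?P = "Pi\<^sub>M {1..k} (\<lambda>j. limit_marginal c \<rho> \<theta> (\<gamma> N (d j)))"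
  have M0: "M \<ge> 0" using f(2)[of "\<lambda>j\<in>{1..k}. 0"] by fastforce
  have 1: "\<bar>gibbs_mean \<gamma> \<theta> N (\<lambda>g. f (\<lambda>j\<in>{1..k}. g (d j)))\<bar> \<le> M"
    unfolding gibbs_mean_def partition_fun_def by (intro abs_weighted_mean_le f(2)) auto
  have 2: "\<bar>\<integral>x. f x \<partial>?P\<bar> \<le> M"
  proof -
    interpret P: prob_space ?P
    proof (rule prob_space_PiM)
      fix j assume "j \<in> {1..k}"
      then have "d j \<in> {1..N}" using d by blast
      then have "\<gamma> N (d j) \<in> {0..c}" by (rule \<gamma>(1))
      then show "prob_space (limit_marginal c \<rho> \<theta> (\<gamma> N (d j)))"
        unfolding limit_marginal_def limit_variance_def using var by (intro prob_space_normal_density) simp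
    qed
    \<comment> \<open>The bound on \<open>f\<close> is known only on the carrier, whereas
      \<open>abs_integral_le\<close> asks for it everywhere; the values off the carrier are set to
      0.\<close>
    have "(\<integral>x. f x \<partial>?P) = (\<integral>x. (if x \<in> {1..k} \<rightarrow>\<^sub>E UNIV then f x else 0) \<partial>?P)"
      by (intro Bochner_Integration.integral_cong) (auto simp: space_PiM limit_marginal_def)
    also have "\<bar>\<dots>\<bar> \<le> M" using f(2) M0 by (intro P.abs_integral_le) auto
    finally show ?thesis .
  qed
  have "1 / 2 \<le> 1 / sqrt (real N)"
  proof -
    have "sqrt (real N) \<le> 2" using N by (intro real_le_lsqrt) auto
    then show ?thesis using N by (intro frac_le) auto
  qed
  then have "1 / 2 \<le> a_tilde \<gamma> c \<rho> \<theta> N"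
    using a_rate_bounds(1)[of N \<gamma> c \<rho> \<theta>] N \<gamma> by (simp add: a_tilde_def add_increasing2)
  then have "2 * M \<le> 4 * M * a_tilde \<gamma> c \<rho> \<theta> N"
    using mult_left_mono[of "1/2" "a_tilde \<gamma> c \<rho> \<theta> N" "4 * M"] M0 by simp
  with 1 2 show ?thesis by linarith
qed

theorem corollary3p2:
  fixes c :: real and \<rho> :: "real measure" and \<gamma> :: "nat \<Rightarrow> nat \<Rightarrow> real" and \<theta> :: real and k :: nat
  assumes "c > 0"
    and "\<And>N i. N \<ge> 1 \<Longrightarrow> i \<in> {1..N} \<Longrightarrow> \<gamma> N i \<in> {0..c}"
    and "prob_space \<rho>" and "sets \<rho> = sets borel" and "emeasure \<rho> {0..c} = 1"
    and "(\<lambda>N. wasserstein1 (empirical_measure N (\<gamma> N)) \<rho>) \<longlonglongrightarrow> 0"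
    and "\<theta> \<in> T_set c \<rho>"
    and "k \<ge> 1"
  shows "\<exists>K' > 0. \<forall>N \<ge> k. \<forall>d :: nat \<Rightarrow> nat. \<forall>f :: (nat \<Rightarrow> real) \<Rightarrow> real.
           inj_on d {1..k} \<longrightarrow> d ` {1..k} \<subseteq> {1..N} \<longrightarrow>
           f \<in> borel_measurable (Pi\<^sub>M {1..k} (\<lambda>_. borel)) \<longrightarrow> bounded (f ` ({1..k} \<rightarrow>\<^sub>E UNIV)) \<longrightarrow>
           \<bar>gibbs_mean \<gamma> \<theta> N (\<lambda>g. f (\<lambda>j\<in>{1..k}. g (d j)))
              - (\<integral>x. f x \<partial>Pi\<^sub>M {1..k} (\<lambda>j. limit_marginal c \<rho> \<theta> (\<gamma> N (d j))))\<bar>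
             \<le> K' * sup_norm k f * a_tilde \<gamma> c \<rho> \<theta> N"
proof -
  obtain \<delta> where \<delta>: "\<delta> > 0" "\<And>y. y \<in> {0..c} \<Longrightarrow> \<delta> \<le> 1 + 2 * \<theta> * (v_lim c \<rho> \<theta> - y)"
    using inverse_limit_variance_bounded_below[OF assms(3-5,1,7)] by blast
  define v where "v = v_lim c \<rho> \<theta>"
  \<comment> \<open>The largest admissible size up to the shift by 1, which keeps the quotient free
    of conditions on \<theta>.\<close>
  define \<epsilon> where "\<epsilon> = \<delta> / (4 * (\<bar>\<theta>\<bar> + 1))"
  have \<epsilon>: "\<epsilon> > 0" "2 * \<bar>\<theta>\<bar> * \<epsilon> \<le> \<delta> / 2"
    using \<delta>(1) by (auto simp: \<epsilon>_def divide_simps add_pos_nonneg)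
  \<comment> \<open>\<open>gibbs.K0\<close> takes neither the index set nor the eigenvalues as
    arguments, which makes the constant uniform in \<open>N\<close> and \<open>d\<close>. The 4
    serves the dimensions below 3.\<close>
  define K' where "K' = max 4 (4 / \<epsilon>\<^sup>2 * (1 + c + \<bar>v\<bar>) + real k * gibbs.K0 c \<theta> \<delta> \<epsilon>)"
  show ?thesis
  proof (intro exI[of _ K'] conjI allI impI)
    show "K' > 0" by (simp add: K'_def)
    fix N :: nat and d :: "nat \<Rightarrow> nat" and f :: "(nat \<Rightarrow> real) \<Rightarrow> real"
    assume N: "k \<le> N" and d: "inj_on d {1..k}" "d ` {1..k} \<subseteq> {1..N}"
      and f: "f \<in> borel_measurable (Pi\<^sub>M {1..k} (\<lambda>_. borel))" "bounded (f ` ({1..k} \<rightarrow>\<^sub>E UNIV))"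
    let ?M = "sup_norm k f" and ?t = "a_tilde \<gamma> c \<rho> \<theta> N"
    have N1: "N \<ge> 1" using N assms(8) by simp
    note \<gamma> = assms(2)[OF N1]
    have M: "\<bar>f x\<bar> \<le> ?M" if "x \<in> {1..k} \<rightarrow>\<^sub>E UNIV" for x
      unfolding sup_norm_def
    proof (rule cSUP_upper[OF that])
      show "bdd_above ((\<lambda>x. \<bar>f x\<bar>) ` ({1..k} \<rightarrow>\<^sub>E UNIV))"
        using f(2) unfolding bounded_iff bdd_above_def by auto
    qed
    have M0: "?M \<ge> 0" using M[of "\<lambda>j\<in>{1..k}. 0"] by fastforce
    have t0: "?t \<ge> 0"
      using a_rate_bounds(1)[of N \<gamma> c \<rho> \<theta>] N1 \<gamma> assms(1) by (simp add: a_tilde_def)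
    have "\<bar>gibbs_mean \<gamma> \<theta> N (\<lambda>g. f (\<lambda>j\<in>{1..k}. g (d j)))
        - (\<integral>x. f x \<partial>Pi\<^sub>M {1..k} (\<lambda>j. limit_marginal c \<rho> \<theta> (\<gamma> N (d j))))\<bar> \<le> C * ?M * ?t \<longrightarrow> C \<le> K' \<longrightarrow>
      \<bar>gibbs_mean \<gamma> \<theta> N (\<lambda>g. f (\<lambda>j\<in>{1..k}. g (d j)))
        - (\<integral>x. f x \<partial>Pi\<^sub>M {1..k} (\<lambda>j. limit_marginal c \<rho> \<theta> (\<gamma> N (d j))))\<bar> \<le> K' * ?M * ?t" for C
      using mult_right_mono[OF mult_right_mono[of C K' ?M] t0] M0 by (auto intro: order_trans)
    note weaken = this[THEN mp, THEN mp]
    show "\<bar>gibbs_mean \<gamma> \<theta> N (\<lambda>g. f (\<lambda>j\<in>{1..k}. g (d j)))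
        - (\<integral>x. f x \<partial>Pi\<^sub>M {1..k} (\<lambda>j. limit_marginal c \<rho> \<theta> (\<gamma> N (d j))))\<bar> \<le> K' * ?M * ?t"
    proof (cases "N \<ge> 3")
      case True
      interpret gibbs "{1..N}" "\<gamma> N" c \<theta> v \<delta> \<epsilon>
        by unfold_locales (use True \<gamma> \<delta> \<epsilon> in \<open>auto simp: v_def\<close>)
      show ?thesis
        by (rule weaken[OF gibbs_mean_bound[where N = N and \<Gamma> = \<gamma> and \<rho> = \<rho>, OF refl refl v_def assms(1) d f(1) M]]) (simp_all add: K'_def)
    next
      case False
      have "0 < 1 + 2 * \<theta> * (v_lim c \<rho> \<theta> - y)" if "y \<in> {0..c}" for y
        using \<delta>(1) \<delta>(2)[OF that] by simp
      with False show ?thesis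
        by (intro weaken[OF gibbs_mean_trivial_bound[where N = N and \<gamma> = \<gamma> and c = c, OF N1 _ \<gamma> assms(1) _ d(2) f(1) M]]) (auto simp: K'_def)
    qed
  qed
qed

end
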